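(* Let $\mathfrak g$ be of type $B_n^{(1)}$. For every $m\ge0$, the map $$\pi:\mathcal Z(\Lambda_0)_{\Lambda_1-m\delta}\longrightarrow\bigsqcup_{m_1+m_2+2m_3=m}\mathcal{OP}(2m_1+1)\times\mathcal P^{(n)}(m_2)\times\mathcal{DP}_0(m_3),\qquad \pi(Y)=(\pi_0(Y),\pi_1(\widetilde Y)),$$ is a bijection.
   Context: **Type.** $\mathfrak g$ of type $B_n^{(1)}$ ($n\ge3$), colors $0,\dots,n$, $\delta=\alpha_0+\alpha_1+2(\alpha_2+\cdots+\alpha_n)$, $\ell=2n$. **Proper Young walls on $Y_{\Lambda_0}$.** There are infinitely many columns, numbered $1,2,\dots$ from right to left. Each column is a stack of unit-height floors. A floor is a unit cube of the indicated color, or a split floor $\{0,1\}$ made of two half-thickness blocks of colors $0,1$ in two positions A and B, or a floor $[n]$ made of two half-height $n$-blocks one on top of the other. The floors from bottom to top are, repeated cyclically: $\{0,1\},2,\dots,n-1,[n],n-1,\dots,2$. On a floor $\{0,1\}$ of column $k$, position A has color $1$ for $k$ odd and $0$ for $k$ even; B has the other color. The ground state wall $Y_{\Lambda_0}$ consists of the A-block of the bottom floor in every column. A Young wall $Y=(y_k)_{k\ge1}$ is obtained by adding finitely many blocks, where a floor may be started only when the floor below it is completely filled, the two blocks of a split floor above the bottom may be added in either order, and there is no free space to the right of any block (if a place is occupied in column $k+1$, the same place is occupied in column $k$). $|y_k|$ is the number of added blocks in column $k$. A column is full if its top floor is completely filled, i.e. $n\nmid|y_k|$; $Y$ is proper if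 no two full columns have the same height. Equivalently, a proper Young wall is a partition $(|y_k|)_k$ whose parts not divisible by $n$ are distinct, with a choice A or B for each positive part divisible by $\ell$ (position of the top half-thickness block), equal parts having equal choices. $\mathcal Z(\Lambda_0)$ is the set of proper Young walls; $\mathrm{cont}(Y)=\sum_ik_i\alpha_i$ with $k_i$ the number of added $i$-blocks, and $\mathrm{wt}(Y)=\Lambda_0-\mathrm{cont}(Y)$. Here the maximal weight $\Lambda_1$ is normalized as $\Lambda_1=\Lambda_0-\gamma$, $\gamma=\alpha_0+\alpha_2+\alpha_3+\cdots+\alpha_n$, so $\mathcal Z(\Lambda_0)_{\Lambda_1-m\delta}=\{Y\in\mathcal Z(\Lambda_0):\mathrm{cont}(Y)=\gamma+m\delta\}$. **Beads.** Place a bead at position $|y_k|$ for each nonzero $|y_k|$, gray if the top block of column $k$ is a half-thickness block in position B on a half-filled floor, white otherwise. Runners: $R_k=\{s>0:s\equiv k\pmod\ell\}$, $1\le k\le\ell$; $R_k$ is of type I for $k\neq n,\ell$ (at most one bead per position). The bead configuration determines $Y$. Operations: $(B_1)$ if a bead is at $s>\ell$ in a runner of type I and there is no bead at $s-\ell$, move it to $s-\ell$ and switch the color (white/gray) of the beads in $R_\ell$ at positions $k$, $s-\ell<k<s$; $(B_2)$ if a bead is at $s>\ell$ in $R_n$, move it to $s-\ell$ and switch the color of the beads in $R_\ell$ at positions $k$, $s-\ell<k<s$; $(B_3)$ if beads are at $s$ and $\ell-s$ ($1\le s\le n-1$), remove both; $(B_5)$ if at least two beads are at $n$, remove two beads at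 $n$. $\widetilde Y$ is the proper Young wall obtained from $Y$ by applying these until none applies. **Partitions.** $\mathcal P^{(k)}(m)$: $k$-tuples of partitions of total size $m$. $\mathcal{OP}(m)$: partitions of $m$ with all parts odd. A partition is 2-reduced if $\lambda_i-\lambda_{i+1}\le1$ for all $i\ge1$ (trailing zeros included). $\mathcal{DP}_0(m)$: 2-reduced partitions with empty 2-core and 2-weight $m$ (size $2m$). Frobenius notation: $(\lambda'|\lambda'')$, for strictly decreasing sequences of non-negative integers of the same length $r$, is the partition $\lambda$ with exactly $r$ diagonal boxes, $\lambda_k=\lambda''_k+k$, $\lambda^t_k=\lambda'_k+k$ for $1\le k\le r$. A two-colored partition has each positive part colored white ($k$) or gray ($\underline k$). $\mathcal P'$: those in which $k$ and $\underline k$ never both occur, for every $k\ge1$. Addition is partwise; a sum of two positive parts is white if they have the same color, gray otherwise, and $a+0=a$; ordinary partitions are regarded as all white. Every $\mu\in\mathcal P'$ is uniquely $\mu=\mu^0+\mu^1$ with $\mu^0$ an ordinary (white) partition and $\mu^1\in\mathcal P'$ 2-reduced, either empty or of the form $(\underline1^{m_1},2^{m_2},\underline3^{m_3},\dots)$ with $m_1\ne0$. **The map.** Let $Y\in\mathcal Z(\Lambda_0)_{\Lambda_1-m\delta}$. For $1\le k\le n-1$, $R_k$ and $R_{\ell-k}$ contain equally many beads; for $j\in\{k,\ell-k\}$ with bead positions $N_1>N_2>\cdots$ in $R_j$ put $\mu^{(j)}=((N_i-j)/\ell)_i$ and $\lambda^{(k)}=(\mu^{(k)}|\mu^{(\ell-k)})$.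 $\lambda^{(0)}=(1^{m_1},3^{m_3},5^{m_5},\dots)$ with $m_{2k-1}$ the number of beads of $Y$ at $(2k-1)n$. $\pi_0(Y)=(\lambda^{(0)},\lambda^{(1)},\dots,\lambda^{(n-1)})$. Let $t$ be the number of nonempty (i.e. $|y_k|\neq0$) columns of $\widetilde Y$. Let $\mu\in\mathcal P'$ have, if $t$ is odd, $k$ (resp. $\underline k$) with multiplicity the number of white (resp. gray) beads of $\widetilde Y$ at $k\ell$; if $t$ is even, $k$ (resp. $\underline k$) with multiplicity the number of gray (resp. white) beads of $\widetilde Y$ at $k\ell$. $\pi_1(\widetilde Y)=(\mu^0,\mu^1)$, with $\mu^1$ viewed as an ordinary partition. $\pi(Y)$ is read as the triple $\lambda^{(0)}\in\mathcal{OP}(2m_1+1)$, $(\lambda^{(1)},\dots,\lambda^{(n-1)},\mu^0)\in\mathcal P^{(n)}(m_2)$, $\mu^1\in\mathcal{DP}_0(m_3)$. *)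

theory Defs
  imports "HOL-Library.Multiset"
begin

section \<open>Partitions\<close>

text \<open>A partition is the weakly decreasing list of its positive parts; \<open>part xs i\<close> is the
  (i+1)-st part, with trailing zeros, so the parts are indexed from 0.\<close>

definition partition :: "nat list \<Rightarrow> bool" where
  "partition xs \<longleftrightarrow> sorted_wrt (\<ge>) xs \<and> 0 \<notin> set xs"

definition part :: "nat list \<Rightarrow> nat \<Rightarrow> nat" where
  "part xs i = (if i < length xs then xs ! i else 0)"

definition transpose_part :: "nat list \<Rightarrow> nat \<Rightarrow> nat" where
  "transpose_part xs j = card {i. j < part xs i}"

definition diagram :: "nat list \<Rightarrow> (nat \<times> nat) set" where
  "diagram xs = {(i, j). j < part xs i}"

definition tuple_partitions :: "nat \<Rightarrow> nat \<Rightarrow> nat list list set" where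
  "tuple_partitions k m =
     {ps. length ps = k \<and> (\<forall>p\<in>set ps. partition p) \<and> (\<Sum>p\<leftarrow>ps. sum_list p) = m}"

definition odd_partitions :: "nat \<Rightarrow> nat list set" where
  "odd_partitions m = {xs. partition xs \<and> sum_list xs = m \<and> (\<forall>p\<in>set xs. odd p)}"

definition two_reduced :: "nat list \<Rightarrow> bool" where
  "two_reduced xs \<longleftrightarrow> (\<forall>i. part xs i - part xs (Suc i) \<le> 1)"

definition is_domino :: "(nat \<times> nat) set \<Rightarrow> bool" where
  "is_domino D \<longleftrightarrow> (\<exists>i j. D = {(i, j), (i, Suc j)} \<or> D = {(i, j), (Suc i, j)})"

text \<open>Removal of a rim 2-hook.\<close>

definition domino_removal :: "nat list \<Rightarrow> nat list \<Rightarrow> bool" where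
  "domino_removal xs ys \<longleftrightarrow> partition xs \<and> partition ys \<and>
     (\<exists>D. is_domino D \<and> D \<subseteq> diagram xs \<and> diagram ys = diagram xs - D)"

definition has_two_core_and_weight :: "nat list \<Rightarrow> nat list \<Rightarrow> nat \<Rightarrow> bool" where
  "has_two_core_and_weight xs c w \<longleftrightarrow>
     (domino_removal ^^ w) xs c \<and> \<not> (\<exists>ys. domino_removal c ys)"

definition DP0 :: "nat \<Rightarrow> nat list set" where
  "DP0 m = {xs. partition xs \<and> two_reduced xs \<and> has_two_core_and_weight xs [] m}"

text \<open>Frobenius notation: the first argument lists the legs, the second one the arms.\<close>

definition frobenius :: "nat list \<Rightarrow> nat list \<Rightarrow> nat list" where
  "frobenius a b = (THE xs. partition xs \<and>
     card {i. (i, i) \<in> diagram xs} = length a \<and> length b = length a \<and>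
     (\<forall>i<length a. part xs i = b ! i + Suc i \<and> transpose_part xs i = a ! i + Suc i))"


section \<open>Two-colored partitions\<close>

datatype shade = White | Gray

fun flip_shade :: "shade \<Rightarrow> shade" where
  "flip_shade White = Gray"
| "flip_shade Gray = White"

text \<open>The set \<open>\<P>'\<close>: as a part never occurs in both colors, listing the parts in weakly
  decreasing order is unambiguous.\<close>

definition colored_partition :: "(nat \<times> shade) list \<Rightarrow> bool" where
  "colored_partition xs \<longleftrightarrow> partition (map fst xs) \<and>
     (\<forall>k. \<not> ((k, White) \<in> set xs \<and> (k, Gray) \<in> set xs))"

definition all_white :: "nat list \<Rightarrow> (nat \<times> shade) list" where
  "all_white xs = map (\<lambda>k. (k, White)) xs"

fun colored_add :: "(nat \<times> shade) list \<Rightarrow> (nat \<times> shade) list \<Rightarrow> (nat \<times> shade) list" where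
  "colored_add [] ys = ys"
| "colored_add xs [] = xs"
| "colored_add ((a, c) # xs) ((b, d) # ys) =
     (a + b, if c = d then White else Gray) # colored_add xs ys"

text \<open>The summands \<open>\<mu>\<^sup>1\<close>: all odd parts are gray, all even parts are white, and the part 1
  occurs unless the partition is empty.\<close>

definition reduced_colored :: "(nat \<times> shade) list \<Rightarrow> bool" where
  "reduced_colored xs \<longleftrightarrow> colored_partition xs \<and> two_reduced (map fst xs) \<and>
     (xs = [] \<or> (1, Gray) \<in> set xs \<and>
        (\<forall>(k, c)\<in>set xs. c = (if odd k then Gray else White)))"

definition decompose :: "(nat \<times> shade) list \<Rightarrow> nat list \<times> (nat \<times> shade) list" where
  "decompose mu = (THE (mu0, mu1). partition mu0 \<and> reduced_colored mu1 \<and>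
     mu = colored_add (all_white mu0) mu1)"


section \<open>Young walls of type \<open>B\<^sub>n\<^sup>(\<^sup>1\<^sup>)\<close> on the ground state wall of weight \<open>\<Lambda>\<^sub>0\<close>\<close>

text \<open>A block is (column, floor, slot). Columns are numbered from 1 (right to left), floors
  from 0 (bottom to top). \<open>PosA\<close>, \<open>PosB\<close> are the two halves of a floor \<open>{0, 1}\<close>; \<open>Low\<close>, \<open>High\<close>
  the lower and upper half of a floor \<open>[n]\<close>; \<open>Cube\<close> is the only slot of any other floor.\<close>

datatype slot = PosA | PosB | Low | High | Cube

type_synonym block = "nat \<times> nat \<times> slot"
type_synonym wall = "block set"

text \<open>One period \<open>{0,1}, 2, \<dots>, n-1, [n], n-1, \<dots>, 2\<close> consists of \<open>2n-2\<close> floors (and \<open>2n\<close> blocks).\<close>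

definition slots :: "nat \<Rightarrow> nat \<Rightarrow> slot set" where
  "slots n h =
     (if h mod (2*n - 2) = 0 then {PosA, PosB}
      else if h mod (2*n - 2) = n - 1 then {Low, High}
      else {Cube})"

definition color :: "nat \<Rightarrow> block \<Rightarrow> nat" where
  "color n = (\<lambda>(k, h, s). case s of
       PosA \<Rightarrow> (if odd k then 1 else 0)
     | PosB \<Rightarrow> (if odd k then 0 else 1)
     | Low \<Rightarrow> n
     | High \<Rightarrow> n
     | Cube \<Rightarrow> (let r = h mod (2*n - 2) in if r < n - 1 then r + 1 else 2*n - 1 - r))"

definition ground :: wall where
  "ground = {(k, 0, PosA) | k. 1 \<le> k}"

definition floor_filled :: "nat \<Rightarrow> wall \<Rightarrow> nat \<Rightarrow> nat \<Rightarrow> bool" where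
  "floor_filled n Y k h \<longleftrightarrow> (\<forall>s\<in>slots n h. (k, h, s) \<in> Y)"

definition young_wall :: "nat \<Rightarrow> wall \<Rightarrow> bool" where
  "young_wall n Y \<longleftrightarrow>
     (\<forall>k h s. (k, h, s) \<in> Y \<longrightarrow> 1 \<le> k \<and> s \<in> slots n h) \<and>
     ground \<subseteq> Y \<and> finite (Y - ground) \<and>
     (\<forall>k h s. (k, Suc h, s) \<in> Y \<longrightarrow> floor_filled n Y k h) \<and>
     (\<forall>k h. (k, h, High) \<in> Y \<longrightarrow> (k, h, Low) \<in> Y) \<and>
     (\<forall>k h s. 1 \<le> k \<and> (Suc k, h, s) \<in> Y \<longrightarrow> (k, h, s) \<in> Y)"

definition top_floor :: "wall \<Rightarrow> nat \<Rightarrow> nat" where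
  "top_floor Y k = Max {h. \<exists>s. (k, h, s) \<in> Y}"

definition full_column :: "nat \<Rightarrow> wall \<Rightarrow> nat \<Rightarrow> bool" where
  "full_column n Y k \<longleftrightarrow> floor_filled n Y k (top_floor Y k)"

definition proper :: "nat \<Rightarrow> wall \<Rightarrow> bool" where
  "proper n Y \<longleftrightarrow> (\<forall>k k'. 1 \<le> k \<and> 1 \<le> k' \<and> k \<noteq> k' \<and> full_column n Y k \<and> full_column n Y k' \<longrightarrow>
     top_floor Y k \<noteq> top_floor Y k')"

definition proper_young_walls :: "nat \<Rightarrow> wall set" where
  "proper_young_walls n = {Y. young_wall n Y \<and> proper n Y}"

text \<open>Elements of the positive root cone are given by their coefficients with respect to the
  simple roots.\<close>

definition content :: "nat \<Rightarrow> wall \<Rightarrow> nat \<Rightarrow> nat" where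
  "content n Y i = card {b \<in> Y - ground. color n b = i}"

definition delta :: "nat \<Rightarrow> nat \<Rightarrow> nat" where
  "delta n i = (if i = 0 \<or> i = 1 then 1 else if i \<le> n then 2 else 0)"

definition gamma :: "nat \<Rightarrow> nat \<Rightarrow> nat" where
  "gamma n i = (if i = 0 \<or> 2 \<le> i \<and> i \<le> n then 1 else 0)"

text \<open>The proper Young walls of weight \<open>\<Lambda>\<^sub>1 - m\<delta>\<close>, where \<open>\<Lambda>\<^sub>1 = \<Lambda>\<^sub>0 - \<gamma>\<close>.\<close>

definition walls_of_weight :: "nat \<Rightarrow> nat \<Rightarrow> wall set" where
  "walls_of_weight n m =
     {Y \<in> proper_young_walls n. content n Y = (\<lambda>i. gamma n i + m * delta n i)}"


section \<open>Beads\<close>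

definition added_blocks :: "wall \<Rightarrow> nat \<Rightarrow> nat" where
  "added_blocks Y k = card {(h, s). (k, h, s) \<in> Y - ground}"

definition nonempty_columns :: "wall \<Rightarrow> nat set" where
  "nonempty_columns Y = {k. 1 \<le> k \<and> added_blocks Y k \<noteq> 0}"

definition bead_shade :: "wall \<Rightarrow> nat \<Rightarrow> shade" where
  "bead_shade Y k = (if \<exists>h. (k, h, PosB) \<in> Y \<and> (k, h, PosA) \<notin> Y then Gray else White)"

definition beads :: "wall \<Rightarrow> (nat \<times> shade) multiset" where
  "beads Y = {# (added_blocks Y k, bead_shade Y k). k \<in># mset_set (nonempty_columns Y) #}"

definition runner :: "nat \<Rightarrow> nat \<Rightarrow> nat set" where
  "runner n k = {s. 0 < s \<and> s mod (2*n) = k mod (2*n)}"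

definition runner_type_I :: "nat \<Rightarrow> nat \<Rightarrow> bool" where
  "runner_type_I n k \<longleftrightarrow> 1 \<le> k \<and> k \<le> 2*n \<and> k \<noteq> n \<and> k \<noteq> 2*n"

definition switch_between ::
  "nat \<Rightarrow> nat \<Rightarrow> nat \<Rightarrow> (nat \<times> shade) multiset \<Rightarrow> (nat \<times> shade) multiset" where
  "switch_between n a b M =
     {# (if p \<in> runner n (2*n) \<and> a < p \<and> p < b then (p, flip_shade c) else (p, c)). (p, c) \<in># M #}"

text \<open>The moved bead ends at \<open>s - 2n\<close>, outside the open interval, so switching after the move is
  the same as switching the beads between both positions.\<close>

inductive bead_step ::
  "nat \<Rightarrow> (nat \<times> shade) multiset \<Rightarrow> (nat \<times> shade) multiset \<Rightarrow> bool" for n where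
  B1: "\<lbrakk>runner_type_I n k; s \<in> runner n k; 2*n < s; (s, c) \<in># M; \<forall>d. (s - 2*n, d) \<notin># M\<rbrakk> \<Longrightarrow>
     bead_step n M (switch_between n (s - 2*n) s (add_mset (s - 2*n, c) (M - {#(s, c)#})))"
| B2: "\<lbrakk>s \<in> runner n n; 2*n < s; (s, c) \<in># M\<rbrakk> \<Longrightarrow>
     bead_step n M (switch_between n (s - 2*n) s (add_mset (s - 2*n, c) (M - {#(s, c)#})))"
| B3: "\<lbrakk>1 \<le> s; s \<le> n - 1; (s, c) \<in># M; (2*n - s, d) \<in># M\<rbrakk> \<Longrightarrow>
     bead_step n M (M - {#(s, c), (2*n - s, d)#})"
| B5: "{#(n, c), (n, d)#} \<subseteq># M \<Longrightarrow> bead_step n M (M - {#(n, c), (n, d)#})"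

definition tilde :: "nat \<Rightarrow> wall \<Rightarrow> wall" where
  "tilde n Y = (THE Z. Z \<in> proper_young_walls n \<and> (bead_step n)\<^sup>*\<^sup>* (beads Y) (beads Z) \<and>
     \<not> (\<exists>M. bead_step n (beads Z) M))"


section \<open>The map\<close>

definition decreasing_list :: "nat multiset \<Rightarrow> nat list" where
  "decreasing_list M = rev (sorted_list_of_multiset M)"

definition bead_positions :: "wall \<Rightarrow> nat multiset" where
  "bead_positions Y = image_mset fst (beads Y)"

definition runner_list :: "nat \<Rightarrow> wall \<Rightarrow> nat \<Rightarrow> nat list" where
  "runner_list n Y j = map (\<lambda>N. (N - j) div (2*n))
     (decreasing_list (filter_mset (\<lambda>p. p \<in> runner n j) (bead_positions Y)))"

definition lambda :: "nat \<Rightarrow> wall \<Rightarrow> nat \<Rightarrow> nat list" where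
  "lambda n Y k = frobenius (runner_list n Y k) (runner_list n Y (2*n - k))"

text \<open>The positions in the runner \<open>R\<^sub>n\<close> are exactly the odd multiples of \<open>n\<close>.\<close>

definition lambda0 :: "nat \<Rightarrow> wall \<Rightarrow> nat list" where
  "lambda0 n Y = decreasing_list
     {# p div n. p \<in># filter_mset (\<lambda>p. p \<in> runner n n) (bead_positions Y) #}"

definition colored_mu :: "nat \<Rightarrow> wall \<Rightarrow> (nat \<times> shade) list" where
  "colored_mu n Z = (THE mu. colored_partition mu \<and>
     (\<forall>k\<ge>1. \<forall>c. count (mset mu) (k, c) =
        count (beads Z) (k * (2*n), if odd (card (nonempty_columns Z)) then c else flip_shade c)))"

definition pi_map :: "nat \<Rightarrow> wall \<Rightarrow> nat list \<times> nat list list \<times> nat list" where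
  "pi_map n Y = (let (mu0, mu1) = decompose (colored_mu n (tilde n Y)) in
     (lambda0 n Y, map (lambda n Y) [1..<n] @ [mu0], map fst mu1))"

definition target_component :: "nat \<Rightarrow> nat \<Rightarrow> nat \<Rightarrow> nat \<Rightarrow>
    (nat list \<times> nat list list \<times> nat list) set" where
  "target_component n m1 m2 m3 =
     odd_partitions (2*m1 + 1) \<times> tuple_partitions n m2 \<times> DP0 m3"

text \<open>The components are pairwise disjoint, so their union is a disjoint one.\<close>

lemma finite_diagram: "finite (diagram xs)"
  and card_diagram: "card (diagram xs) = sum_list xs"
proof -
  have eq: "diagram xs = (SIGMA i:{..<length xs}. {..<xs ! i})"
    by (auto simp: diagram_def part_def split: if_splits)
  show "finite (diagram xs)" unfolding eq by auto
  have "card (diagram xs) = (\<Sum>i<length xs. xs ! i)" unfolding eq by simp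
  also have "\<dots> = sum_list xs" by (simp add: sum_list_sum_nth atLeast0LessThan)
  finally show "card (diagram xs) = sum_list xs" .
qed

lemma domino_removal_size:
  assumes "domino_removal xs ys"
  shows "sum_list xs = sum_list ys + 2"
proof -
  from assms obtain D where D: "is_domino D" "D \<subseteq> diagram xs" "diagram ys = diagram xs - D"
    by (auto simp: domino_removal_def)
  have "card D = 2" using D(1) by (auto simp: is_domino_def)
  moreover have "card D \<le> card (diagram xs)" by (rule card_mono[OF finite_diagram D(2)])
  moreover have "card (diagram ys) = card (diagram xs) - card D"
    unfolding D(3) by (rule card_Diff_subset[OF finite_subset[OF D(2) finite_diagram] D(2)])
  ultimately show ?thesis by (simp add: card_diagram)
qed

lemma DP0_size:
  assumes "xs \<in> DP0 m"
  shows "sum_list xs = 2 * m"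
proof -
  have "(domino_removal ^^ w) xs ys \<Longrightarrow> sum_list xs = sum_list ys + 2 * w" for w ys
    by (induction w arbitrary: ys) (auto dest: domino_removal_size)
  then show ?thesis using assms by (force simp: DP0_def has_two_core_and_weight_def)
qed

lemma target_components_disjoint:
  assumes "(m1, m2, m3) \<noteq> (k1, k2, k3)"
  shows "target_component n m1 m2 m3 \<inter> target_component n k1 k2 k3 = {}"
  using assms
  by (auto simp: target_component_def odd_partitions_def tuple_partitions_def dest!: DP0_size)

end

theory Submission
  imports Defs
begin

text \<open>
  A proper Young wall of weight \<open>\<Lambda>\<^sub>1 - m\<delta>\<close> is the same as a collection of independent pieces, one for
  each factor of the target, whose sizes satisfy one linear equation.

  Numbering the blocks of a column from bottom to top, a column is an initial segment, except that one
  A-block may be missing below its B-block. Hence walls correspond to bead configurations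
  (\<open>wall_of_proper\<close>, \<open>ex_wall_of\<close>). Let \<open>c\<^sub>i\<close> be the number of \<open>i\<close>-blocks for \<open>2 \<le> i \<le> n\<close>, and \<open>c\<^sub>1\<close> the
  number of 0- and 1-blocks together. The difference \<open>c\<^sub>i - c\<^sub>i\<^sub>+\<^sub>1\<close> is the number of beads in \<open>R\<^sub>i\<close>
  minus the number of beads in \<open>R\<^sub>2\<^sub>n\<^sub>-\<^sub>i\<close>, and the sum of all \<open>c\<^sub>i\<close> is the sum of the positions. So all
  \<open>c\<^sub>i\<close> equal \<open>2m + 1\<close> if and only if opposite runners have equally many beads and the positions add
  up to \<open>n (2m + 1)\<close> (\<open>color_weights_constant_iff\<close>). Two sets of the same cardinality in opposite
  runners are the Frobenius coordinates of an arbitrary partition (\<open>ex_frobenius\<close>,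
  \<open>frobenius_inject\<close>), and the beads of \<open>R\<^sub>n\<close>, at odd multiples of \<open>n\<close>, form an arbitrary partition into
  odd parts. This accounts for all beads outside \<open>R\<^sub>2\<^sub>n\<close>.

  What remains of the weight is that there is one 0-block more than there are 1-blocks. As A and B
  exchange their colors from column to column, this is an alternating sum over the columns, and only
  beads of \<open>R\<^sub>2\<^sub>n\<close> contribute to it in a way that depends on their shade. The bead moves respect it: a
  bead that passes a position of \<open>R\<^sub>2\<^sub>n\<close> shifts the beads there by one column, which changes their signs,
  and flips their shades, which changes the signs back. In the end each bead of \<open>R\<^sub>2\<^sub>n\<close> has been
  flipped once for every bead outside \<open>R\<^sub>2\<^sub>n\<close> that was above it, in whatever order the moves are made
  (\<open>bead_step_invariant\<close>, \<open>normal_form_eq\<close>). So the reduced wall is well defined, and the original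
  shades can be recovered from it once the beads outside \<open>R\<^sub>2\<^sub>n\<close> are known (\<open>assemble_reduce\<close>). For the
  colored partition \<open>\<mu>\<close> of the reduced wall, the condition says that the gray parts at odd places are
  as many as those at even places (\<open>alternating_excess_iff\<close>).

  Finally, in the decomposition \<open>\<mu> = \<mu>\<^sup>0 + \<mu>\<^sup>1\<close> the \<open>i\<close>-th part of \<open>\<mu>\<^sup>1\<close> is the number of color changes
  in \<open>\<mu>\<close> from index \<open>i\<close> on, so that the gray parts of \<open>\<mu>\<close> sit where the parts of \<open>\<mu>\<^sup>1\<close> are odd
  (\<open>ex_recompose\<close>). The condition now says that the checkerboard coloring of the diagram of \<open>\<mu>\<^sup>1\<close> has as
  many black as white cells. This is equivalent to an empty 2-core, because the partitions without
  removable domino are the staircases and a nonempty staircase is not balanced (\<open>DP0_iff\<close>). Dividing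
  the sum of the positions by \<open>n\<close> gives \<open>2m + 1 = |\<lambda>\<^sup>0| + 2 \<Sum>|\<lambda>\<^sup>k| + 2 |\<mu>\<^sup>0| + 2 |\<mu>\<^sup>1|\<close>, which is the relation
  \<open>m = m\<^sub>1 + m\<^sub>2 + 2 m\<^sub>3\<close> of the index set.
\<close>

section \<open>Partitions and Frobenius coordinates\<close>

lemma part_antimono: "partition xs \<Longrightarrow> i \<le> j \<Longrightarrow> part xs j \<le> part xs i"
  by (cases "i = j") (auto simp: partition_def part_def sorted_wrt_iff_nth_less)

lemma part_pos_iff: "partition xs \<Longrightarrow> 0 < part xs i \<longleftrightarrow> i < length xs"
  by (auto simp: partition_def part_def) (metis gr0I nth_mem)

lemma partition_eqI:
  assumes "partition xs" "partition ys" "\<And>i. part xs i = part ys i"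
  shows "xs = ys"
proof (rule nth_equalityI)
  show l: "length xs = length ys"
    using part_pos_iff[OF assms(1)] part_pos_iff[OF assms(2)] assms(3)
    by (metis linorder_neqE_nat less_irrefl)
  fix i assume "i < length xs"
  then show "xs ! i = ys ! i" using assms(3)[of i] l by (simp add: part_def)
qed

text \<open>Partitions are handled as weakly decreasing functions that are eventually zero. Together with
  \<open>partition_eqI\<close> this makes trailing zeros harmless and lets partitions be defined by their rows.\<close>

lemma ex_partition:
  assumes dec: "\<And>i. f (Suc i) \<le> (f i :: nat)" and N: "f N = 0"
  shows "\<exists>xs. partition xs \<and> (\<forall>i. part xs i = f i)"
proof -
  define L where "L = (LEAST k. f k = 0)"
  have L0: "f L = 0" unfolding L_def using N by (rule LeastI)
  have pos: "f i \<noteq> 0" if "i < L" for i using not_less_Least that unfolding L_def by blast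
  have anti: "f j \<le> f i" if "i \<le> j" for i j using lift_Suc_antimono_le[of f, OF dec that] .
  have "partition (map f [0..<L])"
    using pos anti by (auto simp: partition_def sorted_wrt_iff_nth_less) (metis neq0_conv)
  moreover have "part (map f [0..<L]) i = f i" for i
    using anti[of L i] L0 by (auto simp: part_def)
  ultimately show ?thesis by blast
qed

lemma sum_list_eq_sum_part:
  assumes "length xs \<le> N"
  shows "sum_list xs = (\<Sum>i<N. part xs i)"
proof -
  have "(\<Sum>i<N. part xs i) = (\<Sum>i<length xs. part xs i)"
    by (rule sum.mono_neutral_right) (use assms in \<open>auto simp: part_def\<close>)
  then show ?thesis by (simp add: part_def sum_list_sum_nth atLeast0LessThan)
qed

lemma initial_segment_eq:
  fixes S :: "nat set"
  assumes fin: "finite S" and down: "\<And>i j. j \<in> S \<Longrightarrow> i < j \<Longrightarrow> i \<in> S"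
  shows "S = {..<card S}"
proof -
  define m where "m = (LEAST m. m \<notin> S)"
  have "\<exists>m. m \<notin> S" using fin by (metis ex_new_if_finite infinite_UNIV_nat)
  then have "m \<notin> S" unfolding m_def by (rule LeastI_ex)
  then have "S = {..<m}"
    using down not_less_Least[of _ "\<lambda>m. m \<notin> S"] unfolding m_def[symmetric]
    by (auto simp: set_eq_iff) (metis linorder_neqE_nat)
  then show ?thesis by (metis card_lessThan)
qed

text \<open>The rows longer than \<open>j\<close> form an initial segment, so their number tells which rows they are.\<close>

lemma less_transpose_part_iff:
  assumes "partition xs"
  shows "i < transpose_part xs j \<longleftrightarrow> j < part xs i"
proof -
  have "finite {i. j < part xs i}"
    by (rule finite_subset[of _ "{..<length xs}"]) (use part_pos_iff[OF assms] in force)+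
  then have "{i. j < part xs i} = {..<transpose_part xs j}"
    unfolding transpose_part_def
    proof (rule initial_segment_eq)
    fix i i' assume "i' \<in> {i. j < part xs i}" "i < i'"
    then show "i \<in> {i. j < part xs i}" using part_antimono[OF assms, of i i'] by simp
  qed
  then show ?thesis by (auto simp: set_eq_iff)
qed

definition durfee :: "nat list \<Rightarrow> nat" where
  "durfee xs = card {i. (i, i) \<in> diagram xs}"

lemma less_durfee_iff:
  assumes "partition xs"
  shows "i < durfee xs \<longleftrightarrow> i < part xs i"
proof -
  have eq: "{i. (i, i) \<in> diagram xs} = {i. i < part xs i}" by (simp add: diagram_def)
  have "finite {i. i < part xs i}"
    by (rule finite_subset[of _ "{..<length xs}"]) (use part_pos_iff[OF assms] in force)+
  then have "{i. i < part xs i} = {..<durfee xs}"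
    unfolding durfee_def eq
    proof (rule initial_segment_eq)
    fix i j assume "j \<in> {i. i < part xs i}" "i < j"
    then show "i \<in> {i. i < part xs i}" using part_antimono[OF assms, of i j] by simp
  qed
  then show ?thesis by (auto simp: set_eq_iff)
qed

text \<open>The condition that \<open>frobenius\<close> solves by definite description; existence and uniqueness of the
  solution are separate matters.\<close>

definition frobenius_spec :: "nat list \<Rightarrow> nat list \<Rightarrow> nat list \<Rightarrow> bool" where
  "frobenius_spec a b xs \<longleftrightarrow> partition xs \<and> durfee xs = length a \<and> length b = length a \<and>
     (\<forall>i<length a. part xs i = b ! i + Suc i \<and> transpose_part xs i = a ! i + Suc i)"

text \<open>A cell \<open>(i, j)\<close> lies in the row or in the column with number \<open>min i j\<close>, and the diagonal cell with
  this number belongs to the diagram as well. So the rows and columns that meet the diagonal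
  determine every cell.\<close>

lemma frobenius_spec_unique:
  assumes "frobenius_spec a b xs" "frobenius_spec a b ys"
  shows "xs = ys"
proof (rule partition_eqI)
  show px: "partition xs" and py: "partition ys" using assms by (auto simp: frobenius_spec_def)
  have sub: "j < part us i"
    if ab: "frobenius_spec a b us" "frobenius_spec a b vs" and ij: "j < part vs i" for us vs i j
  proof -
    have p: "partition us" "partition vs" using ab by (auto simp: frobenius_spec_def)
    have "min i j < part vs (min i j)"
      using ij part_antimono[OF p(2), of "min i j" i] by linarith
    then have "min i j < length a" using less_durfee_iff[OF p(2)] ab by (simp add: frobenius_spec_def)
    then have "part us (min i j) = part vs (min i j)"
      "transpose_part us (min i j) = transpose_part vs (min i j)"
      using ab by (auto simp: frobenius_spec_def)
    then show ?thesis
      using ij less_transpose_part_iff[OF p(1)] less_transpose_part_iff[OF p(2)]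
      by (metis min_def)
  qed
  show "part xs i = part ys i" for i
    using sub[OF assms] sub[OF assms(2,1)] by (metis linorder_neqE_nat less_irrefl)
qed

text \<open>The partition with Frobenius coordinates \<open>a\<close>, \<open>b\<close>, built from outside to inside: a hook with leg
  \<open>a\<close> and arm \<open>b\<close> is wrapped around the partition with the remaining coordinates. Each of the \<open>a\<close> rows
  below the first one receives a cell of the first column, including rows in which the inner
  partition is already zero.\<close>

fun hooks :: "nat list \<Rightarrow> nat list \<Rightarrow> nat list" where
  "hooks (a # as) (b # bs) = Suc b # map (\<lambda>i. Suc (part (hooks as bs) i)) [0..<a]"
| "hooks _ _ = []"

lemma part_hooks_Cons:
  "part (hooks (a # as) (b # bs)) 0 = Suc b"
  "part (hooks (a # as) (b # bs)) (Suc i) = (if i < a then Suc (part (hooks as bs) i) else 0)"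
  by (auto simp: part_def)

text \<open>Besides the Frobenius condition, the induction carries the number of rows and the length of the
  first row: strict decrease of the coordinates is used to see that the inner partition fits inside
  the hook.\<close>

lemma hooks_properties:
  assumes "sorted_wrt (>) a" "sorted_wrt (>) b" "length b = length a"
  shows "frobenius_spec a b (hooks a b) \<and>
    length (hooks a b) = (case a of [] \<Rightarrow> 0 | x # _ \<Rightarrow> Suc x) \<and>
    part (hooks a b) 0 = (case b of [] \<Rightarrow> 0 | x # _ \<Rightarrow> Suc x) \<and>
    sum_list (hooks a b) = sum_list a + sum_list b + length a"
  using assms(3,1,2)
proof (induction b a rule: list_induct2)
  case (Cons b bs a as)
  define r where "r = hooks as bs"
  define xs where "xs = hooks (a # as) (b # bs)"
  note px = part_hooks_Cons[of a as b bs, folded xs_def r_def]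
  have IH: "frobenius_spec as bs r" "length r = (case as of [] \<Rightarrow> 0 | x # _ \<Rightarrow> Suc x)"
    "part r 0 = (case bs of [] \<Rightarrow> 0 | x # _ \<Rightarrow> Suc x)"
    "sum_list r = sum_list as + sum_list bs + length as"
    using Cons by (auto simp: r_def)
  have pr: "partition r" and dr: "durfee r = length as" and lb: "length bs = length as"
    and hr: "\<And>i. i < length as \<Longrightarrow> part r i = bs ! i + Suc i"
      "\<And>i. i < length as \<Longrightarrow> transpose_part r i = as ! i + Suc i"
    using IH(1) by (auto simp: frobenius_spec_def)
  have la: "length r \<le> a" using IH(2) Cons(3) by (auto split: list.splits)
  have pb: "part r 0 \<le> b" using IH(3) Cons(4) by (auto split: list.splits)
  have rb: "part r i \<le> b" for i using part_antimono[OF pr, of 0 i] pb by simp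
  have ra: "i < a" if "j < part r i" for i j
    using that part_pos_iff[OF pr, of i] la by auto
  have xs: "xs = Suc b # map (\<lambda>i. Suc (part r i)) [0..<a]" by (simp add: xs_def r_def)
  have pxs: "partition xs"
    using rb part_antimono[OF pr]
    by (auto simp: xs partition_def sorted_wrt_iff_nth_less nth_Cons split: nat.splits)
  have "{i. i < part xs i} = insert 0 (Suc ` {i. i < part r i})"
  proof -
    have "i < part xs i \<longleftrightarrow> i = 0 \<or> i \<in> Suc ` {i. i < part r i}" for i
      using ra by (cases i) (auto simp: px)
    then show ?thesis by auto
  qed
  moreover have "finite {i. i < part r i}"
    by (rule finite_subset[of _ "{..<length r}"]) (use part_pos_iff[OF pr] in force)+
  ultimately have dx: "durfee xs = Suc (length as)"
    using dr by (simp add: durfee_def diagram_def card_image)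
  have t0: "transpose_part xs 0 = Suc a"
  proof -
    have "i < transpose_part xs 0 \<longleftrightarrow> i < Suc a" for i
      using less_transpose_part_iff[OF pxs, of i 0] part_pos_iff[OF pxs, of i] by (simp add: xs)
    then show ?thesis by (metis linorder_neqE_nat less_irrefl)
  qed
  have tS: "transpose_part xs (Suc j) = Suc (transpose_part r j)" if j: "j < length as" for j
  proof -
    have jb: "j < b" using hr(1)[OF j] rb[of j] by simp
    have "i < transpose_part xs (Suc j) \<longleftrightarrow> i < Suc (transpose_part r j)" for i
      using jb ra by (cases i)
        (auto simp: less_transpose_part_iff[OF pxs] less_transpose_part_iff[OF pr] px)
    then show ?thesis by (metis linorder_neqE_nat less_irrefl)
  qed
  have pS: "part xs (Suc j) = bs ! j + Suc (Suc j)" if j: "j < length as" for j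
    using hr(1)[OF j] ra[of 0 j] by (simp add: px)
  have "frobenius_spec (a # as) (b # bs) xs"
    unfolding frobenius_spec_def
    using pxs dx lb t0 tS pS hr(2) px(1) by (auto simp: nth_Cons split: nat.splits)
  moreover have "(\<Sum>i<c. Suc (part r i)) = c + (\<Sum>i<c. part r i)" for c
    by (induction c) auto
  then have "sum_list xs = Suc b + a + (\<Sum>i<a. part r i)"
    by (simp add: xs interv_sum_list_conv_sum_set_nat atLeast0LessThan)
  moreover have "length xs = Suc a" by (simp add: xs)
  ultimately show ?case
    unfolding xs_def[symmetric] using sum_list_eq_sum_part[OF la] IH(4) px(1) by simp
qed (auto simp: frobenius_spec_def partition_def durfee_def diagram_def part_def)

lemma frobenius_unfold: "frobenius a b = (THE xs. frobenius_spec a b xs)"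
  by (simp add: frobenius_def frobenius_spec_def durfee_def)

lemma frobenius_eq_iff:
  assumes "sorted_wrt (>) a" "sorted_wrt (>) b" "length b = length a"
  shows "frobenius a b = xs \<longleftrightarrow> frobenius_spec a b xs"
proof -
  have "\<exists>!xs. frobenius_spec a b xs"
    using hooks_properties[OF assms] frobenius_spec_unique by blast
  then show ?thesis unfolding frobenius_unfold by (metis (mono_tags, lifting) theI')
qed

lemma partition_frobenius:
  assumes "sorted_wrt (>) a" "sorted_wrt (>) b" "length b = length a"
  shows "partition (frobenius a b)"
    and "sum_list (frobenius a b) = sum_list a + sum_list b + length a"
  using frobenius_eq_iff[OF assms, of "frobenius a b"] frobenius_eq_iff[OF assms, of "hooks a b"]
    hooks_properties[OF assms] by (auto simp: frobenius_spec_def)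

lemma frobenius_inject:
  assumes "sorted_wrt (>) a" "sorted_wrt (>) b" "length b = length a"
    and "sorted_wrt (>) a'" "sorted_wrt (>) b'" "length b' = length a'"
    and "frobenius a b = frobenius a' b'"
  shows "a = a' \<and> b = b'"
proof -
  have "frobenius_spec a b (frobenius a b)" "frobenius_spec a' b' (frobenius a b)"
    using frobenius_eq_iff[OF assms(1-3), of "frobenius a b"]
      frobenius_eq_iff[OF assms(4-6), of "frobenius a b"] assms(7) by auto
  then show ?thesis by (auto simp: frobenius_spec_def intro!: nth_equalityI)
qed

text \<open>The coordinates are the arm and leg lengths of the diagonal cells. They decrease strictly because
  rows and columns decrease weakly while the diagonal moves on by one.\<close>

lemma ex_frobenius:
  assumes p: "partition xs"
  shows "\<exists>a b. sorted_wrt (>) a \<and> sorted_wrt (>) b \<and> length b = length a \<and> frobenius a b = xs"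
proof -
  define a where "a = map (\<lambda>i. transpose_part xs i - Suc i) [0..<durfee xs]"
  define b where "b = map (\<lambda>i. part xs i - Suc i) [0..<durfee xs]"
  have d1: "i < part xs i" "i < transpose_part xs i" if "i < durfee xs" for i
    using that less_durfee_iff[OF p] less_transpose_part_iff[OF p] by auto
  have tr: "transpose_part xs k \<le> transpose_part xs i" if "i \<le> k" for i k
    using less_transpose_part_iff[OF p] that by (metis leI le_less_trans less_irrefl)
  have "transpose_part xs k - Suc k < transpose_part xs i - Suc i" if "i < k" "k < durfee xs" for i k
    using tr[of i k] d1(2)[of k] that by simp
  then have sa: "sorted_wrt (>) a" by (simp add: a_def sorted_wrt_iff_nth_less)
  have "part xs k - Suc k < part xs i - Suc i" if "i < k" "k < durfee xs" for i k
    using part_antimono[OF p, of i k] d1(1)[of k] that by simp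
  then have sb: "sorted_wrt (>) b" by (simp add: b_def sorted_wrt_iff_nth_less)
  have l: "length b = length a" by (simp add: a_def b_def)
  have "frobenius_spec a b xs"
    using p d1 by (fastforce simp: frobenius_spec_def a_def b_def dest: Suc_leI)
  then show ?thesis using sa sb l frobenius_eq_iff[OF sa sb l] by blast
qed

section \<open>Two-cores and the checkerboard coloring\<close>

fun alternating_sum :: "('a \<Rightarrow> int) \<Rightarrow> 'a list \<Rightarrow> int" where
  "alternating_sum f [] = 0"
| "alternating_sum f (x # xs) = f x - alternating_sum f xs"

lemma alternating_sum_eq_sum:
  "alternating_sum f xs = (\<Sum>i<length xs. (-1) ^ i * f (xs ! i))"
proof (induction xs)
  case (Cons x xs)
  then show ?case
    by (simp del: sum.lessThan_Suc add: sum.lessThan_Suc_shift sum_negf)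
qed simp

text \<open>The surplus of black over white cells in the checkerboard coloring.\<close>

definition balance :: "(nat \<times> nat) set \<Rightarrow> int" where
  "balance D = (\<Sum>(i, j)\<in>D. (-1) ^ (i + j))"

abbreviation odd_indicator :: "nat \<Rightarrow> int" where
  "odd_indicator p \<equiv> of_bool (odd p)"

text \<open>The cells of a row cancel in pairs, which leaves the first cell of each row of odd length.\<close>

lemma balance_diagram: "balance (diagram xs) = alternating_sum odd_indicator xs"
proof -
  have eq: "diagram xs = (SIGMA i:{..<length xs}. {..<xs ! i})"
    by (auto simp: diagram_def part_def split: if_splits)
  have "(\<Sum>j<p. (-1) ^ (i + j)) = (-1) ^ i * odd_indicator p" for i p
    by (induction p) (auto simp: power_add algebra_simps)
  then show ?thesis
    by (simp add: balance_def eq alternating_sum_eq_sum flip: sum.Sigma)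
qed

lemma balance_domino: "is_domino D \<Longrightarrow> balance D = 0 \<and> finite D"
  by (auto simp: is_domino_def balance_def)

lemma balance_domino_removal:
  assumes "domino_removal xs ys"
  shows "balance (diagram ys) = balance (diagram xs)"
proof -
  from assms obtain D where "is_domino D" "D \<subseteq> diagram xs" "diagram ys = diagram xs - D"
    by (auto simp: domino_removal_def)
  then show ?thesis
    using balance_domino[of D] sum_diff[OF finite_diagram, of D xs "\<lambda>(i, j). (-1) ^ (i + j) :: int"]
    by (simp add: balance_def)
qed

text \<open>In a staircase the rows of odd length are every second row, so their first cells all have the same
  color and nothing cancels.\<close>

lemma balance_staircase:
  assumes "\<And>i. i < length xs \<Longrightarrow> xs ! i = length xs - i" "xs \<noteq> []"
  shows "alternating_sum odd_indicator xs \<noteq> 0"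
proof -
  let ?L = "length xs"
  have "alternating_sum odd_indicator xs = (\<Sum>i<?L. (-1) ^ Suc ?L * odd_indicator (?L - i))"
    unfolding alternating_sum_eq_sum
  proof (rule sum.cong[OF refl])
    fix i assume "i \<in> {..<?L}"
    then show "(-1) ^ i * odd_indicator (xs ! i) = (-1) ^ Suc ?L * odd_indicator (?L - i)"
      using assms(1)[of i] by (cases "even i"; cases "even ?L") auto
  qed
  also have "\<dots> = (-1) ^ Suc ?L * (\<Sum>i<?L. odd_indicator (?L - i))"
    by (rule sum_distrib_left[symmetric])
  also have "(\<Sum>i<?L. odd_indicator (?L - i)) \<ge> odd_indicator (?L - (?L - 1))"
    by (rule member_le_sum) (use assms(2) in auto)
  then have "(-1) ^ Suc ?L * (\<Sum>i<?L. odd_indicator (?L - i)) \<noteq> 0"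
    using assms(2) by (auto simp: Suc_leI)
  finally show ?thesis .
qed

lemma domino_removalI:
  assumes p: "partition xs" and dec: "\<And>i. f (Suc i) \<le> f i" and N: "f N = 0"
    and D: "is_domino D" "D \<subseteq> diagram xs" "{(i, j). j < f i} = diagram xs - D"
  shows "\<exists>ys. domino_removal xs ys"
proof -
  obtain ys where "partition ys" "\<forall>i. part ys i = f i" using ex_partition[OF dec N] by blast
  then have "domino_removal xs ys"
    using p D unfolding domino_removal_def by (intro conjI exI[of _ D]) (auto simp: diagram_def)
  then show ?thesis ..
qed

text \<open>If some row is longer than the next one by at least two, a horizontal domino can be removed from its
  end. If two consecutive nonzero rows are equal, a vertical domino can be removed from the end of the
  lowest such pair, because the row below is strictly shorter. If neither happens, the partition
  is a staircase, and a nonempty staircase is not balanced.\<close>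

lemma ex_domino_removal:
  assumes p: "partition xs" and ne: "xs \<noteq> []" and bal: "alternating_sum odd_indicator xs = 0"
  shows "\<exists>ys. domino_removal xs ys"
proof -
  have anti: "part xs j \<le> part xs i" if "i \<le> j" for i j using part_antimono[OF p that] .
  have zero: "part xs (length xs) = 0" "part xs (Suc (length xs)) = 0" by (auto simp: part_def)
  \<comment> \<open>in the second case the row below the two equal ones is shorter, so shortening both leaves a partition\<close>
  consider (wide) i where "part xs (Suc i) + 2 \<le> part xs i"
    | (tall) i where "part xs i = part xs (Suc i)" "0 < part xs i"
        "part xs (Suc (Suc i)) < part xs (Suc i)"
    | (stair) "\<And>i. 0 < part xs i \<Longrightarrow> part xs i = Suc (part xs (Suc i))"
  proof (cases "\<exists>i. part xs i = part xs (Suc i) \<and> 0 < part xs i")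
    case True
    let ?S = "{i. part xs i = part xs (Suc i) \<and> 0 < part xs i}"
    have fin: "finite ?S"
      by (rule finite_subset[of _ "{..<length xs}"]) (use part_pos_iff[OF p] in force)+
    define i where "i = Max ?S"
    have i1: "i \<in> ?S" unfolding i_def using True by (intro Max_in[OF fin]) auto
    moreover have "Suc i \<notin> ?S" using Max_ge[OF fin, of "Suc i"] unfolding i_def by (meson Suc_n_not_le_n)
    ultimately have i: "i \<in> ?S" "Suc i \<notin> ?S" .
    then have "part xs (Suc (Suc i)) < part xs (Suc i)"
      using anti[of "Suc i" "Suc (Suc i)"] by auto
    then show ?thesis using that(2)[of i] i by simp
  next
    case False
    then show ?thesis using that(1,3) anti[of i "Suc i" for i]
      by (metis Suc_lessI add_2_eq_Suc' le_SucI le_less_linear le_neq_implies_less lessI less_Suc_eq_le not_less_eq Suc_leI)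
  qed
  then show ?thesis
  proof cases
    case (wide i)
    let ?f = "(part xs)(i := part xs i - 2)"
    let ?D = "{(i, part xs i - 2), (i, Suc (part xs i - 2))}"
    show ?thesis
    proof (rule domino_removalI[OF p, of ?f])
      show "?f (Suc k) \<le> ?f k" for k using wide anti[of k "Suc k"] by auto
      show "?f (length xs) = 0" using zero wide by auto
      show "is_domino ?D" by (auto simp: is_domino_def)
      show "?D \<subseteq> diagram xs" "{(i, j). j < ?f i} = diagram xs - ?D"
        using wide by (auto simp: diagram_def split: if_splits)
    qed
  next
    case (tall i)
    let ?f = "(part xs)(i := part xs i - 1, Suc i := part xs i - 1)"
    let ?D = "{(i, part xs i - 1), (Suc i, part xs i - 1)}"
    show ?thesis
    proof (rule domino_removalI[OF p, of ?f])
      show "?f (Suc k) \<le> ?f k" for k using tall anti[of k "Suc k"] by auto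
      show "?f (length xs) = 0" using zero tall by auto
      show "is_domino ?D" by (auto simp: is_domino_def)
      show "?D \<subseteq> diagram xs" "{(i, j). j < ?f i} = diagram xs - ?D"
        using tall by (auto simp: diagram_def split: if_splits)
    qed
  next
    case stair
    have "part xs (length xs - k) = k" if "k \<le> length xs" for k
      using that
    proof (induction k)
      case (Suc k)
      have "Suc (length xs - Suc k) = length xs - k" using Suc.prems by simp
      then show ?case using Suc stair[of "length xs - Suc k"] part_pos_iff[OF p, of "length xs - Suc k"] by simp
    qed (simp add: zero)
    then have "xs ! i = length xs - i" if "i < length xs" for i
      using that by (metis diff_diff_cancel diff_le_self less_imp_le_nat part_def)
    then show ?thesis using balance_staircase[OF _ ne] bal by blast
  qed
qed

text \<open>A domino covers one cell of each color, so balance is invariant under removal of dominoes, and a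
  partition with empty 2-core is balanced. Conversely a balanced partition can be dismantled
  completely, since only the empty partition among the balanced ones admits no removal.\<close>

lemma DP0_iff:
  "xs \<in> DP0 m \<longleftrightarrow> partition xs \<and> two_reduced xs \<and> sum_list xs = 2 * m \<and>
     alternating_sum odd_indicator xs = 0"
proof -
  have nil: "\<not> domino_removal [] ys" for ys
    using domino_removal_size[of "[]" ys] by auto
  have "(domino_removal ^^ w) xs ys \<Longrightarrow> balance (diagram ys) = balance (diagram xs)" for w ys
    by (induction w arbitrary: ys) (auto dest: balance_domino_removal)
  from this[of m "[]"] have "xs \<in> DP0 m \<Longrightarrow> alternating_sum odd_indicator xs = 0"
    by (auto simp: DP0_def has_two_core_and_weight_def balance_diagram)
  moreover have "(domino_removal ^^ m) xs []"
    if "partition xs" "sum_list xs = 2 * m" "alternating_sum odd_indicator xs = 0"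
    using that
  proof (induction m arbitrary: xs)
    case 0
    then have "xs = []" by (cases xs) (auto simp: partition_def)
    then show ?case by simp
  next
    case (Suc m)
    then have "xs \<noteq> []" by auto
    then obtain ys where ys: "domino_removal xs ys" using ex_domino_removal Suc.prems by blast
    then have "(domino_removal ^^ m) ys []"
      using Suc.prems domino_removal_size[OF ys] balance_domino_removal[OF ys]
      by (intro Suc.IH) (auto simp: domino_removal_def balance_diagram)
    then show ?case using ys by (metis relpowp_Suc_I2)
  qed
  ultimately show ?thesis using nil DP0_size[of xs m]
    by (auto simp: DP0_def has_two_core_and_weight_def)
qed

section \<open>Two-colored partitions\<close>

text \<open>White zeros are the right padding: a white zero is neutral for the addition of colored parts, so
  \<open>colored_add\<close> becomes an operation on single indices.\<close>

definition cpart :: "(nat \<times> shade) list \<Rightarrow> nat \<Rightarrow> nat \<times> shade" where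
  "cpart xs i = (if i < length xs then xs ! i else (0, White))"

lemma fst_cpart: "fst (cpart xs i) = part (map fst xs) i"
  by (simp add: cpart_def part_def)

lemma cpart_eqI:
  assumes "0 \<notin> set (map fst xs)" "0 \<notin> set (map fst ys)" "\<And>i. cpart xs i = cpart ys i"
  shows "xs = ys"
proof (rule nth_equalityI)
  have pos: "0 < fst (cpart zs i) \<longleftrightarrow> i < length zs" if "0 \<notin> set (map fst zs)" for zs i
    using that by (auto simp: cpart_def)
  show l: "length xs = length ys"
    using pos[OF assms(1)] pos[OF assms(2)] assms(3) by (metis linorder_neqE_nat less_irrefl)
  fix i assume "i < length xs"
  then show "xs ! i = ys ! i" using assms(3)[of i] l by (simp add: cpart_def)
qed

lemma colored_partition_no_zero: "colored_partition xs \<Longrightarrow> 0 \<notin> set (map fst xs)"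
  by (simp add: colored_partition_def partition_def)

lemma length_colored_add: "length (colored_add xs ys) = max (length xs) (length ys)"
  by (induction xs ys rule: colored_add.induct) auto

lemma cpart_Cons: "cpart (x # xs) i = (case i of 0 \<Rightarrow> x | Suc j \<Rightarrow> cpart xs j)"
  by (auto simp: cpart_def split: nat.splits)

lemma cpart_colored_add:
  "cpart (colored_add xs ys) i = (fst (cpart xs i) + fst (cpart ys i),
     if snd (cpart xs i) = snd (cpart ys i) then White else Gray)"
proof (induction xs ys arbitrary: i rule: colored_add.induct)
  case (1 ys)
  then show ?case by (cases "cpart ys i"; cases "snd (cpart ys i)") (auto simp: cpart_def[of "[]"])
next
  case (2 x xs)
  then show ?case
    by (cases "cpart (x # xs) i"; cases "snd (cpart (x # xs) i)") (auto simp: cpart_def[of "[]"])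
next
  case (3 a c xs b d ys)
  then show ?case by (auto simp: cpart_Cons split: nat.splits)
qed

text \<open>The color that a part of the reduced summand must carry.\<close>

definition tint :: "nat \<Rightarrow> nat \<times> shade" where
  "tint k = (k, if odd k then Gray else White)"

text \<open>The sum \<open>\<mu>\<^sup>0 + \<mu>\<^sup>1\<close>, where the second summand is given without its colors.\<close>

definition recompose :: "nat list \<Rightarrow> nat list \<Rightarrow> (nat \<times> shade) list" where
  "recompose mu nu = colored_add (all_white mu) (map tint nu)"

lemma cpart_all_white: "cpart (all_white xs) i = (part xs i, White)"
  by (simp add: cpart_def all_white_def part_def)

lemma cpart_map_tint: "cpart (map tint xs) i = tint (part xs i)"
  by (simp add: cpart_def part_def tint_def)

lemma cpart_recompose:
  "cpart (recompose mu nu) i =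
    (part mu i + part nu i, if odd (part nu i) then Gray else White)"
  by (simp add: recompose_def cpart_colored_add cpart_all_white cpart_map_tint tint_def)

text \<open>The last part exceeds the zero after it by at most one.\<close>

lemma last_part_two_reduced:
  assumes "partition xs" "two_reduced xs" "xs \<noteq> []"
  shows "1 \<in> set xs"
proof -
  have "part xs (length xs - 1) - part xs (Suc (length xs - 1)) \<le> 1"
    using assms(2) by (auto simp: two_reduced_def)
  then have "xs ! (length xs - 1) \<le> 1" using assms(3) by (simp add: part_def)
  moreover have "xs ! (length xs - 1) \<in> set xs" using assms(3) by simp
  moreover have "0 \<notin> set xs" using assms(1) by (simp add: partition_def)
  ultimately show ?thesis by (metis One_nat_def gr0I le_neq_implies_less less_one)
qed

text \<open>The colors of a reduced summand are determined by the parity of its parts, so reduced colored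
  partitions are the same as 2-reduced partitions.\<close>

lemma reduced_colored_iff:
  "reduced_colored ys \<longleftrightarrow> (\<exists>xs. ys = map tint xs \<and> partition xs \<and> two_reduced xs)"
proof
  assume r: "reduced_colored ys"
  then have "ys = map tint (map fst ys)"
    by (intro nth_equalityI) (fastforce simp: reduced_colored_def tint_def prod_eq_iff dest: nth_mem)+
  moreover have "partition (map fst ys)" "two_reduced (map fst ys)"
    using r by (auto simp: reduced_colored_def colored_partition_def)
  ultimately show "\<exists>xs. ys = map tint xs \<and> partition xs \<and> two_reduced xs" by blast
next
  assume "\<exists>xs. ys = map tint xs \<and> partition xs \<and> two_reduced xs"
  then obtain xs where xs: "ys = map tint xs" "partition xs" "two_reduced xs" by blast
  have m: "map fst ys = xs" by (simp add: xs tint_def comp_def)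
  show "reduced_colored ys"
    unfolding reduced_colored_def colored_partition_def m
    using xs last_part_two_reduced[OF xs(2,3)] by (force simp: tint_def)
qed

text \<open>Both summands decrease weakly, so two equal parts of the sum have equal summands, and the parity of
  the second summand, that is, the color, agrees.\<close>

lemma colored_partition_recompose:
  assumes "partition mu" "partition nu" "two_reduced nu"
  shows "colored_partition (recompose mu nu)"
proof -
  let ?r = "recompose mu nu"
  have len: "length ?r = max (length mu) (length nu)"
    by (simp add: recompose_def length_colored_add all_white_def)
  have nth: "?r ! i = (part mu i + part nu i, if odd (part nu i) then Gray else White)"
    if "i < length ?r" for i
    using cpart_recompose[of mu nu i] that by (simp add: cpart_def)
  have "sorted_wrt (\<ge>) (map fst ?r)"
    using part_antimono[OF assms(1)] part_antimono[OF assms(2)]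
    by (auto simp: sorted_wrt_iff_nth_less nth add_mono)
  moreover have "0 \<notin> set (map fst ?r)"
  proof -
    have "0 < fst (?r ! i)" if "i < length ?r" for i
      using that part_pos_iff[OF assms(1), of i] part_pos_iff[OF assms(2), of i]
      by (auto simp: nth len less_max_iff_disj)
    then show ?thesis by (auto simp: in_set_conv_nth) (metis fst_conv less_irrefl)
  qed
  moreover have "snd (?r ! i) = snd (?r ! j)"
    if "i \<le> j" "j < length ?r" "fst (?r ! i) = fst (?r ! j)" for i j
  proof -
    have "part mu j \<le> part mu i" "part nu j \<le> part nu i"
      using part_antimono assms that by auto
    then have "part nu i = part nu j" using that by (simp add: nth)
    then show ?thesis using that by (simp add: nth)
  qed
  then have "\<not> ((k, White) \<in> set ?r \<and> (k, Gray) \<in> set ?r)" for k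
    by (auto simp: in_set_conv_nth) (metis fst_conv snd_conv nle_le shade.distinct(1))
  ultimately show ?thesis by (simp add: colored_partition_def partition_def)
qed

text \<open>Reading the parts from the last one upwards, each part either equals the one after it or exceeds it by one,
  and its parity tells which.\<close>

lemma two_reduced_parity_unique:
  assumes "partition xs" "two_reduced xs" "partition ys" "two_reduced ys"
    and "\<And>i. odd (part xs i) = odd (part ys i)"
  shows "xs = ys"
proof (rule partition_eqI[OF assms(1,3)])
  fix i
  define N where "N = max (length xs) (length ys)"
  have z: "part xs j = part ys j" if "N \<le> j" for j using that by (simp add: part_def N_def)
  have step: "part xs j = part ys j" if "part xs (Suc j) = part ys (Suc j)" for j
  proof -
    have "part xs (Suc j) \<le> part xs j" "part ys (Suc j) \<le> part ys j"
      using part_antimono assms(1,3) by auto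
    moreover have "part xs j - part xs (Suc j) \<le> 1" "part ys j - part ys (Suc j) \<le> 1"
      using assms(2,4) by (auto simp: two_reduced_def)
    ultimately have "(part xs j = part xs (Suc j) \<or> part xs j = Suc (part xs (Suc j))) \<and>
       (part ys j = part ys (Suc j) \<or> part ys j = Suc (part ys (Suc j)))" by linarith
    then show ?thesis using that assms(5)[of j] by auto
  qed
  have "part xs (N - k) = part ys (N - k)" for k
  proof (induction k)
    case (Suc k)
    then show ?case using step[of "N - Suc k"] by (cases "k < N") (auto simp: Suc_diff_Suc)
  qed (simp add: z)
  from this[of "N - i"] show "part xs i = part ys i" using z[of i] by (cases "i \<le> N") auto
qed

lemma recompose_inject:
  assumes "partition mu" "partition nu" "two_reduced nu"
    and "partition mu'" "partition nu'" "two_reduced nu'"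
    and eq: "recompose mu nu = recompose mu' nu'"
  shows "mu = mu' \<and> nu = nu'"
proof -
  have c: "part mu i + part nu i = part mu' i + part nu' i" "odd (part nu i) = odd (part nu' i)" for i
    using cpart_recompose[of mu nu i] cpart_recompose[of mu' nu' i] eq by (auto split: if_splits)
  have nu: "nu = nu'" by (rule two_reduced_parity_unique) (use assms c(2) in auto)
  then show ?thesis using partition_eqI[OF assms(1,4)] c(1) by auto
qed

text \<open>The \<open>i\<close>-th part of the reduced summand is the number of color changes at or after index \<open>i\<close>, where
  the padding counts as white. Its parity reproduces the color. As no part occurs in both colors, every change of
  color is accompanied by a strict descent of the parts; this is why the difference of the parts and
  these numbers is again a partition.\<close>

lemma ex_recompose:
  assumes cp: "colored_partition xs"
  shows "\<exists>mu nu. partition mu \<and> partition nu \<and> two_reduced nu \<and> recompose mu nu = xs"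
proof -
  let ?N = "length xs"
  define v where "v i = fst (cpart xs i)" for i
  define change where "change j \<longleftrightarrow> snd (cpart xs j) \<noteq> snd (cpart xs (Suc j))" for j
  \<comment> \<open>the parts of the reduced summand\<close>
  define lev where "lev i = card {j. i \<le> j \<and> change j}" for i
  have p: "partition (map fst xs)" using cp by (simp add: colored_partition_def)
  have v: "v i = part (map fst xs) i" for i by (simp add: v_def fst_cpart)
  have sub: "{j. i \<le> j \<and> change j} \<subseteq> {..<?N}" for i
    by (auto simp: change_def cpart_def split: if_splits)
  have fin: "finite {j. i \<le> j \<and> change j}" for i using finite_subset[OF sub] by blast
  have lev_step: "lev i = (if change i then 1 else 0) + lev (Suc i)" for i
  proof -
    have "{j. i \<le> j \<and> change j} = (if change i then {i} else {}) \<union> {j. Suc i \<le> j \<and> change j}"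
      by (auto simp: Suc_le_eq le_less)
    then show ?thesis using fin[of "Suc i"] by (auto simp: lev_def)
  qed
  have levN: "lev i = 0" if "?N \<le> i" for i
  proof -
    have "{j. i \<le> j \<and> change j} = {}" using sub[of i] that by auto
    then show ?thesis by (simp only: lev_def card.empty)
  qed
  \<comment> \<open>a change of color forces a strict descent\<close>
  have vdec: "v (Suc i) + (if change i then 1 else 0) \<le> v i" for i
  proof -
    have le: "v (Suc i) \<le> v i" unfolding v by (rule part_antimono[OF p]) simp
    moreover have "v (Suc i) \<noteq> v i" if "change i"
    proof
      assume eq: "v (Suc i) = v i"
      have iN: "i < ?N" using sub[of i] that by auto
      then have "0 < v i" unfolding v by (simp add: part_pos_iff[OF p])
      then have sN: "Suc i < ?N" using eq v part_pos_iff[OF p, of "Suc i"] by simp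
      have "snd (xs ! i) = snd (xs ! Suc i)"
      proof (rule ccontr)
        assume "snd (xs ! i) \<noteq> snd (xs ! Suc i)"
        moreover have "xs ! i \<in> set xs" "xs ! Suc i \<in> set xs" using iN sN by auto
        moreover have "fst (xs ! i) = fst (xs ! Suc i)" using eq iN sN by (simp add: v_def cpart_def)
        ultimately show False using cp unfolding colored_partition_def
          by (metis (full_types) prod.collapse shade.exhaust)
      qed
      then show False using that iN sN by (simp add: change_def cpart_def)
    qed
    ultimately show ?thesis by (auto simp: le_less)
  qed
  have key: "lev i \<le> v i \<and> odd (lev i) = (snd (cpart xs i) = Gray)" for i
  proof -
    have base: "lev j \<le> v j \<and> odd (lev j) = (snd (cpart xs j) = Gray)" if "?N \<le> j" for j
      using levN[OF that] that by (simp add: cpart_def)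
    have step: "lev j \<le> v j \<and> odd (lev j) = (snd (cpart xs j) = Gray)"
      if "lev (Suc j) \<le> v (Suc j) \<and> odd (lev (Suc j)) = (snd (cpart xs (Suc j)) = Gray)" for j
    proof (cases "change j")
      case True
      then have "(snd (cpart xs j) = Gray) \<noteq> (snd (cpart xs (Suc j)) = Gray)"
        unfolding change_def by (metis (full_types) shade.exhaust)
      then show ?thesis using True that lev_step[of j] vdec[of j] by auto
    next
      case False
      then show ?thesis using that lev_step[of j] vdec[of j] by (auto simp: change_def)
    qed
    have "lev (?N - k) \<le> v (?N - k) \<and> odd (lev (?N - k)) = (snd (cpart xs (?N - k)) = Gray)" for k
    proof (induction k)
      case (Suc k)
      show ?case
      proof (cases "k < ?N")
        case True
        then have "Suc (?N - Suc k) = ?N - k" by simp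
        then show ?thesis using Suc step[of "?N - Suc k"] by metis
      next
        case False
        then show ?thesis using Suc by simp
      qed
    qed (simp add: base)
    from this[of "?N - i"] show ?thesis using base[of i] by (cases "i \<le> ?N") auto
  qed
  obtain nu where nu: "partition nu" "\<And>i. part nu i = lev i"
    using ex_partition[of lev ?N] lev_step levN by (metis le_add2 order_refl)
  have "v (Suc i) - lev (Suc i) \<le> v i - lev i" for i
    using vdec[of i] lev_step[of i] by (auto split: if_splits)
  moreover have "v ?N - lev ?N = 0" by (simp add: v part_def)
  ultimately obtain mu where mu: "partition mu" "\<And>i. part mu i = v i - lev i"
    using ex_partition[of "\<lambda>i. v i - lev i" ?N] by blast
  have "lev i - lev (Suc i) \<le> 1" for i by (subst lev_step) simp
  then have tr: "two_reduced nu" by (simp add: two_reduced_def nu(2))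
  have "recompose mu nu = xs"
  proof (rule cpart_eqI)
    show "0 \<notin> set (map fst (recompose mu nu))"
      using colored_partition_no_zero[OF colored_partition_recompose[OF mu(1) nu(1) tr]] .
    show "0 \<notin> set (map fst xs)" using colored_partition_no_zero[OF cp] .
    show "cpart (recompose mu nu) i = cpart xs i" for i
      using key[of i] by (auto simp: cpart_recompose nu(2) mu(2) v_def prod_eq_iff)
        (metis (full_types) shade.exhaust)
  qed
  then show ?thesis using mu(1) nu(1) tr by blast
qed

lemma decompose_recompose:
  assumes "partition mu" "partition nu" "two_reduced nu"
  shows "decompose (recompose mu nu) = (mu, map tint nu)"
proof -
  have "mu0 = mu \<and> mu1 = map tint nu"
    if a: "partition mu0" "reduced_colored mu1"
      "recompose mu nu = colored_add (all_white mu0) mu1" for mu0 mu1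
  proof -
    obtain xs where xs: "mu1 = map tint xs" "partition xs" "two_reduced xs"
      using a(2) by (auto simp: reduced_colored_iff)
    then have "recompose mu nu = recompose mu0 xs" using a(3) by (simp add: recompose_def)
    then show ?thesis using recompose_inject[OF assms a(1) xs(2,3)] xs(1) by simp
  qed
  then show ?thesis
    unfolding decompose_def using assms
    by (intro the_equality) (auto simp: recompose_def reduced_colored_iff)
qed

lemma sum_recompose:
  assumes "partition mu" "partition nu" "two_reduced nu"
  shows "sum_list (map fst (recompose mu nu)) = sum_list mu + sum_list nu"
proof -
  let ?N = "max (length mu) (length nu)"
  have "length (map fst (recompose mu nu)) \<le> ?N"
    by (simp add: recompose_def length_colored_add all_white_def)
  then have "sum_list (map fst (recompose mu nu)) = (\<Sum>i<?N. part mu i + part nu i)"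
    by (simp add: sum_list_eq_sum_part flip: fst_cpart) (simp add: cpart_recompose)
  then show ?thesis by (simp add: sum.distrib sum_list_eq_sum_part[of _ ?N])
qed

abbreviation gray_indicator :: "nat \<times> shade \<Rightarrow> int" where
  "gray_indicator x \<equiv> of_bool (snd x = Gray)"

text \<open>The gray parts of the sum are those with an odd second summand.\<close>

lemma alternating_sum_recompose:
  "alternating_sum gray_indicator (recompose mu nu) = alternating_sum odd_indicator nu"
proof -
  let ?N = "max (length mu) (length nu)"
  have len: "length (recompose mu nu) = ?N"
    by (simp add: recompose_def length_colored_add all_white_def)
  have nth: "recompose mu nu ! i = cpart (recompose mu nu) i" if "i < ?N" for i
    using that by (simp add: cpart_def len)
  have "alternating_sum gray_indicator (recompose mu nu) =
      (\<Sum>i<?N. (-1) ^ i * odd_indicator (part nu i))"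
    unfolding alternating_sum_eq_sum len by (rule sum.cong) (auto simp: nth cpart_recompose)
  also have "\<dots> = (\<Sum>i<length nu. (-1) ^ i * odd_indicator (part nu i))"
    by (rule sum.mono_neutral_right) (auto simp: part_def)
  finally show ?thesis by (simp add: alternating_sum_eq_sum part_def)
qed

text \<open>A multiset in which no part has both colors is listed by sorting the parts and attaching to each
  part the color that it has in the multiset.\<close>

definition colored_list_of :: "(nat \<times> shade) multiset \<Rightarrow> (nat \<times> shade) list" where
  "colored_list_of M = map (\<lambda>k. (k, if (k, Gray) \<in># M then Gray else White))
     (rev (sorted_list_of_multiset (image_mset fst M)))"

definition colored_multiset :: "(nat \<times> shade) multiset \<Rightarrow> bool" where
  "colored_multiset M \<longleftrightarrow> (\<forall>(k, c)\<in>#M. 0 < k) \<and> (\<forall>k. \<not> ((k, White) \<in># M \<and> (k, Gray) \<in># M))"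

lemma mset_colored_list_of:
  assumes "colored_multiset M"
  shows "mset (colored_list_of M) = M"
proof -
  have "mset (colored_list_of M) = image_mset (\<lambda>x. (fst x, if (fst x, Gray) \<in># M then Gray else White)) M"
    by (simp add: colored_list_of_def multiset.map_comp comp_def)
  also have "\<dots> = image_mset (\<lambda>x. x) M"
    by (rule image_mset_cong) (use assms in \<open>auto simp: colored_multiset_def\<close>,
        (metis (full_types) shade.exhaust)+)
  finally show ?thesis by simp
qed

lemma colored_partition_iff:
  "colored_partition xs \<longleftrightarrow> sorted_wrt (\<ge>) (map fst xs) \<and> colored_multiset (mset xs)"
  by (force simp: colored_partition_def partition_def colored_multiset_def)

lemma colored_partition_colored_list_of:
  assumes "colored_multiset M"
  shows "colored_partition (colored_list_of M)"
proof -
  have "map fst (colored_list_of M) = rev (sorted_list_of_multiset (image_mset fst M))"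
    by (simp add: colored_list_of_def comp_def)
  then show ?thesis
    using assms by (simp add: colored_partition_iff mset_colored_list_of sorted_wrt_rev)
qed

lemma colored_list_of_mset:
  assumes "colored_partition xs"
  shows "colored_list_of (mset xs) = xs"
proof -
  have "sorted (rev (map fst xs))"
    using assms by (simp add: colored_partition_iff sorted_wrt_rev)
  then have "sorted_list_of_multiset (image_mset fst (mset xs)) = rev (map fst xs)"
    by (metis mset_map mset_rev sorted_list_of_multiset_mset sorted_sort_id)
  then have "colored_list_of (mset xs) =
      map (\<lambda>x. (fst x, if (fst x, Gray) \<in> set xs then Gray else White)) xs"
    by (simp add: colored_list_of_def comp_def)
  also have "\<dots> = map (\<lambda>x. x) xs"
    by (rule map_cong) (use assms in \<open>auto simp: colored_partition_def\<close>,
        (metis (full_types) shade.exhaust)+)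
  finally show ?thesis by simp
qed

section \<open>Young walls as bead configurations\<close>

definition slot_offset :: "nat \<Rightarrow> nat \<Rightarrow> slot \<Rightarrow> nat" where
  "slot_offset n h s = (case s of PosA \<Rightarrow> 0 | PosB \<Rightarrow> 1 | Low \<Rightarrow> n | High \<Rightarrow> n + 1
     | Cube \<Rightarrow> (let r = h mod (2*n - 2) in if r < n - 1 then r + 1 else r + 2))"

text \<open>The blocks of a column are numbered from bottom to top, A before B and lower before upper half, with
  \<open>2n\<close> blocks in each period and the ground state block as number 0.\<close>

definition block_index :: "nat \<Rightarrow> nat \<Rightarrow> slot \<Rightarrow> nat" where
  "block_index n h s = 2*n * (h div (2*n - 2)) + slot_offset n h s"

lemma slot_table:
  assumes n: "3 \<le> (n::nat)" and s: "s \<in> slots n h"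
  obtains (a) "s = PosA" "h mod (2*n - 2) = 0" "slot_offset n h s = 0"
    | (b) "s = PosB" "h mod (2*n - 2) = 0" "slot_offset n h s = 1"
    | (l) "s = Low" "h mod (2*n - 2) = n - 1" "slot_offset n h s = n"
    | (u) "s = High" "h mod (2*n - 2) = n - 1" "slot_offset n h s = n + 1"
    | (lo) r where "s = Cube" "h mod (2*n - 2) = r" "1 \<le> r" "r < n - 1" "slot_offset n h s = r + 1"
    | (hi) r where "s = Cube" "h mod (2*n - 2) = r" "n - 1 < r" "r < 2*n - 2" "slot_offset n h s = r + 2"
proof -
  define r where "r = h mod (2*n - 2)"
  have r: "r < 2*n - 2" using n by (simp add: r_def)
  consider "r = 0" | "r = n - 1" | "1 \<le> r" "r < n - 1" | "n - 1 < r" using n by linarith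
  then show ?thesis
  proof cases
    case 1
    then have "s = PosA \<or> s = PosB" using s by (simp add: slots_def r_def)
    then show ?thesis using a b 1 unfolding r_def by (auto simp: slot_offset_def)
  next
    case 2
    then have "s = Low \<or> s = High" using s n by (simp add: slots_def r_def)
    then show ?thesis using l u 2 unfolding r_def by (auto simp: slot_offset_def)
  next
    case 3
    then have "s = Cube" using s by (simp add: slots_def r_def)
    then show ?thesis using lo[of r] 3 unfolding r_def by (simp add: slot_offset_def)
  next
    case 4
    then have "s = Cube" using s n by (simp add: slots_def r_def)
    then show ?thesis using hi[of r] 4 r unfolding r_def by (simp add: slot_offset_def)
  qed
qed

lemma slot_offset_less:
  assumes n: "3 \<le> n" and s: "s \<in> slots n h"
  shows "slot_offset n h s < 2*n"
  by (cases rule: slot_table[OF n s]) (use n in auto)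

lemma block_index_div_mod:
  assumes "3 \<le> n" "s \<in> slots n h"
  shows "block_index n h s div (2*n) = h div (2*n - 2)"
    and "block_index n h s mod (2*n) = slot_offset n h s"
  using slot_offset_less[OF assms] assms(1) by (auto simp: block_index_def)

lemma block_index_mono:
  assumes n: "3 \<le> n" and s: "s \<in> slots n h" "s' \<in> slots n h'" and h: "h < h'"
  shows "block_index n h s < block_index n h' s'"
proof (cases "h div (2*n - 2) = h' div (2*n - 2)")
  case True
  then have "h mod (2*n - 2) < h' mod (2*n - 2)"
    using h by (metis div_mult_mod_eq nat_add_left_cancel_less)
  then have "slot_offset n h s < slot_offset n h' s'"
    using n by (cases rule: slot_table[OF n s(1)]; cases rule: slot_table[OF n s(2)]) auto
  then show ?thesis using True by (simp add: block_index_def)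
next
  case False
  then have "Suc (h div (2*n - 2)) \<le> h' div (2*n - 2)"
    using h by (metis Suc_leI div_le_mono le_neq_implies_less less_imp_le_nat)
  then have "2*n * Suc (h div (2*n - 2)) \<le> 2*n * (h' div (2*n - 2))" by (rule mult_le_mono2)
  then show ?thesis using slot_offset_less[OF n s(1)] by (simp add: block_index_def)
qed

lemma block_index_inject:
  assumes n: "3 \<le> n" and s: "s \<in> slots n h" "s' \<in> slots n h'"
    and eq: "block_index n h s = block_index n h' s'"
  shows "h = h' \<and> s = s'"
proof -
  have h: "h = h'"
    using block_index_mono[OF n s] block_index_mono[OF n s(2,1)] eq by (metis less_irrefl linorder_neqE_nat)
  then have "slot_offset n h s = slot_offset n h s'" using eq by (simp add: block_index_def)
  then have "s = s'"
    using n s(2)[folded h] by (cases rule: slot_table[OF n s(1)]; cases rule: slot_table[OF n s(2)[folded h]]) auto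
  then show ?thesis using h by simp
qed

lemma block_index_surj:
  assumes n: "3 \<le> n"
  obtains h s where "s \<in> slots n h" "block_index n h s = j"
proof -
  define q o' where "q = j div (2*n)" and "o' = j mod (2*n)"
  have j: "j = 2*n * q + o'" by (simp add: q_def o'_def)
  have o': "o' < 2*n" using n by (simp add: o'_def)
  note that' = that
  have *: thesis if "r < 2*n - 2" "s \<in> slots n r" "slot_offset n r s = o'" for r s
  proof (rule that')
    let ?h = "(2*n - 2) * q + r"
    have m: "?h mod (2*n - 2) = r" "?h div (2*n - 2) = q" "r mod (2*n - 2) = r" using that(1) by auto
    show "s \<in> slots n ?h" using that(2) unfolding slots_def m .
    show "block_index n ?h s = j"
      using that(3) m by (simp add: block_index_def slot_offset_def j split: slot.splits if_splits)
  qed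
  consider "o' = 0" | "o' = 1" | "2 \<le> o'" "o' < n" | "o' = n" | "o' = n + 1" | "n + 2 \<le> o'"
    using o' by linarith
  then show ?thesis
  proof cases
    case 1 then show ?thesis using n by (intro *[of 0 PosA]) (auto simp: slots_def slot_offset_def)
  next
    case 2 then show ?thesis using n by (intro *[of 0 PosB]) (auto simp: slots_def slot_offset_def)
  next
    case 3 then show ?thesis using n by (intro *[of "o' - 1" Cube]) (auto simp: slots_def slot_offset_def Let_def)
  next
    case 4 then show ?thesis using n by (intro *[of "n - 1" Low]) (auto simp: slots_def slot_offset_def)
  next
    case 5 then show ?thesis using n by (intro *[of "n - 1" High]) (auto simp: slots_def slot_offset_def)
  next
    case 6 then show ?thesis using n o' by (intro *[of "o' - 2" Cube]) (auto simp: slots_def slot_offset_def Let_def)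
  qed
qed

lemma dvd_block_index_iff:
  assumes n: "3 \<le> n" and s: "s \<in> slots n h"
  shows "n dvd block_index n h s \<longleftrightarrow> s = PosA \<or> s = Low"
    and "2*n dvd block_index n h s \<longleftrightarrow> s = PosA"
proof -
  have "n dvd block_index n h s \<longleftrightarrow> n dvd slot_offset n h s"
    by (simp add: block_index_def dvd_add_right_iff)
  also have "\<dots> \<longleftrightarrow> s = PosA \<or> s = Low"
  proof (cases rule: slot_table[OF n s])
    case (6 r)
    then have "n < slot_offset n h s" "slot_offset n h s < n + n" using n by auto
    then have "\<not> n dvd slot_offset n h s"
      by (metis dvd_imp_mod_0 le_add_diff_inverse less_imp_le_nat mod_add_self1 mod_less nat_add_left_cancel_less not_less_iff_gr_or_eq zero_less_diff)
    then show ?thesis using 6 by simp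
  next
    case 4
    moreover have "n dvd n + 1 \<longleftrightarrow> n dvd 1" by (rule dvd_add_right_iff) simp
    ultimately have "\<not> n dvd slot_offset n h s" using n by simp
    then show ?thesis using 4 by simp
  qed (use n in \<open>auto dest: dvd_imp_le\<close>)
  finally show "n dvd block_index n h s \<longleftrightarrow> s = PosA \<or> s = Low" .
  show "2*n dvd block_index n h s \<longleftrightarrow> s = PosA"
    unfolding dvd_eq_mod_eq_0 block_index_div_mod[OF n s]
    by (cases rule: slot_table[OF n s]) (use n in auto)
qed

text \<open>A column that contains exactly the blocks up to a given one is full if and only if the number of
  this block is not divisible by \<open>n\<close>.\<close>

lemma block_index_top_iff:
  assumes n: "3 \<le> n" and s: "s \<in> slots n h"
  shows "(\<forall>s'\<in>slots n h. block_index n h s' \<le> block_index n h s) \<longleftrightarrow> \<not> n dvd block_index n h s"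
  unfolding dvd_block_index_iff[OF n s]
  by (cases rule: slot_table[OF n s]) (use n in \<open>auto simp: slots_def block_index_def slot_offset_def\<close>)

definition block_color :: "nat \<Rightarrow> nat \<Rightarrow> nat \<Rightarrow> nat" where
  "block_color n k j = (let r = j mod (2*n) in
     if r = 0 then (if odd k then 1 else 0)
     else if r = 1 then (if odd k then 0 else 1)
     else if r \<le> n then r else 2*n + 1 - r)"

lemma color_eq_block_color:
  assumes n: "3 \<le> n" and s: "s \<in> slots n h"
  shows "color n (k, h, s) = block_color n k (block_index n h s)"
  unfolding block_color_def block_index_div_mod[OF n s]
  by (cases rule: slot_table[OF n s]) (use n in \<open>auto simp: color_def Let_def\<close>)


text \<open>The numbers of the blocks in a column with bead \<open>(s, c)\<close>, the ground state block included. In a gray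
  column the B-block number \<open>s + 1\<close> is present although the A-block number \<open>s\<close> is missing. An empty
  column is encoded by \<open>(0, White)\<close>.\<close>

definition filling :: "nat \<times> shade \<Rightarrow> nat set" where
  "filling x = (if snd x = White then {..fst x} else insert (Suc (fst x)) {..<fst x})"

definition column_state :: "nat \<Rightarrow> nat \<times> shade \<Rightarrow> bool" where
  "column_state n x \<longleftrightarrow> (snd x = Gray \<longrightarrow> 2*n dvd fst x \<and> 0 < fst x)"

lemma shade_not_White [simp]: "c \<noteq> White \<longleftrightarrow> c = Gray"
  by (cases c) auto

text \<open>The only block that may be missing below another one is an A-block below its B-block.\<close>

lemma filling_gap:
  assumes "column_state n x" "j \<in> filling x" "i < j"
  shows "i \<in> filling x \<or> 2*n dvd i \<and> j = Suc i"
  using assms by (cases "snd x"; cases "i = fst x") (auto simp: filling_def column_state_def)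

lemma finite_filling [simp]: "finite (filling x)"
  by (simp add: filling_def)

text \<open>A gray column sticks out one block above \<open>{..s}\<close>. This never breaks containment in a taller column,
  because the positions of two gray beads differ by at least \<open>2n\<close>.\<close>

lemma filling_subset_iff:
  assumes n: "3 \<le> n" and x: "column_state n x" "column_state n y"
  shows "filling x \<subseteq> filling y \<longleftrightarrow> fst x < fst y \<or> x = y"
proof
  assume "filling x \<subseteq> filling y"
  then show "fst x < fst y \<or> x = y"
    using subsetD[of "filling x" "filling y" "fst x"] subsetD[of "filling x" "filling y" "fst y"]
      subsetD[of "filling x" "filling y" "Suc (fst x)"]
    by (cases "snd x"; cases "snd y") (auto simp: filling_def prod_eq_iff)
next
  have gap: "a + 2*n \<le> b" if ab: "2*n dvd a" "2*n dvd b" "a < b" for a b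
  proof -
    have "2*n dvd b - a" using ab by (auto intro: dvd_diff_nat)
    then have "2*n \<le> b - a" using ab(3) by (intro dvd_imp_le) auto
    then show ?thesis using ab(3) by linarith
  qed
  assume "fst x < fst y \<or> x = y"
  then show "filling x \<subseteq> filling y"
    using x n gap[of "fst x" "fst y"]
    by (cases "snd x"; cases "snd y") (auto simp: filling_def column_state_def)
qed

text \<open>If some block is missing below another one, everything else below the missing block \<open>i\<close> is present,
  and nothing above number \<open>i + 1\<close> can be.\<close>

lemma ex_filling:
  assumes n: "3 \<le> n" and fin: "finite X" and zero: "0 \<in> X"
    and down: "\<And>i j. j \<in> X \<Longrightarrow> i < j \<Longrightarrow> i \<in> X \<or> 2*n dvd i \<and> j = Suc i"
  shows "\<exists>x. column_state n x \<and> X = filling x"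
proof (cases "\<exists>i j. j \<in> X \<and> i < j \<and> i \<notin> X")
  case False
  then have "X = {..<card X}" using initial_segment_eq[OF fin] by blast
  moreover have "card X > 0" using fin zero by (auto simp: card_gt_0_iff)
  ultimately have "X = filling (card X - 1, White)"
    by (metis Suc_diff_1 filling_def fst_conv lessThan_Suc_atMost snd_conv)
  then show ?thesis by (intro exI[of _ "(card X - 1, White)"]) (simp add: column_state_def)
next
  case True
  then obtain i where i: "Suc i \<in> X" "i \<notin> X" "2*n dvd i" using down by blast
  have lower: "k \<in> X" if "k < i" for k using down[OF i(1), of k] that by auto
  have upper: "k = Suc i" if "k \<in> X" "\<not> k < i" for k
  proof -
    have "k \<noteq> i" using that(1) i(2) by auto
    then show ?thesis using down[OF that(1), of i] i(2) that(2) by linarith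
  qed
  have "X = filling (i, Gray)"
  proof (rule set_eqI)
    fix k
    show "k \<in> X \<longleftrightarrow> k \<in> filling (i, Gray)"
      using lower[of k] upper[of k] i(1) by (auto simp: filling_def)
  qed
  moreover have "i \<noteq> 0" using i(2) zero by metis
  ultimately show ?thesis using i(3) by (intro exI[of _ "(i, Gray)"]) (simp add: column_state_def)
qed

definition blocks_at :: "nat \<Rightarrow> nat set \<Rightarrow> (nat \<times> slot) set" where
  "blocks_at n F = {(h, s). s \<in> slots n h \<and> block_index n h s \<in> F}"

lemma bij_betw_blocks_at:
  assumes n: "3 \<le> n"
  shows "bij_betw (\<lambda>(h, s). block_index n h s) (blocks_at n F) F"
  unfolding bij_betw_def
proof
  show "inj_on (\<lambda>(h, s). block_index n h s) (blocks_at n F)"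
    by (auto simp: inj_on_def blocks_at_def dest: block_index_inject[OF n])
  show "(\<lambda>(h, s). block_index n h s) ` blocks_at n F = F"
  proof
    show "F \<subseteq> (\<lambda>(h, s). block_index n h s) ` blocks_at n F"
    proof
      fix j assume "j \<in> F"
      moreover obtain h s where "s \<in> slots n h" "block_index n h s = j"
        using block_index_surj[OF n] by blast
      ultimately show "j \<in> (\<lambda>(h, s). block_index n h s) ` blocks_at n F"
        by (intro image_eqI[of _ _ "(h, s)"]) (auto simp: blocks_at_def)
    qed
  qed (auto simp: blocks_at_def)
qed

lemma card_blocks_at: "3 \<le> n \<Longrightarrow> card (blocks_at n F) = card F"
  by (rule bij_betw_same_card[OF bij_betw_blocks_at])

lemma finite_blocks_at: "3 \<le> n \<Longrightarrow> finite F \<Longrightarrow> finite (blocks_at n F)"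
  using bij_betw_finite[OF bij_betw_blocks_at] by blast

lemma PosA_zero: "PosA \<in> slots n 0" "block_index n 0 PosA = 0"
  by (auto simp: slots_def block_index_def slot_offset_def)

lemma block_index_eq_0_iff:
  assumes "3 \<le> n" "s \<in> slots n h"
  shows "block_index n h s = 0 \<longleftrightarrow> h = 0 \<and> s = PosA"
  using block_index_inject[OF assms PosA_zero(1)] PosA_zero by metis

definition wall_of :: "nat \<Rightarrow> (nat \<times> shade) list \<Rightarrow> wall" where
  "wall_of n L = {(k, h, s). 1 \<le> k \<and> (h, s) \<in> blocks_at n (filling (cpart L (k - 1)))}"

text \<open>The bead configurations of proper Young walls: gray beads occur only in the runner \<open>R\<^sub>2\<^sub>n\<close>, and a
  position outside the multiples of \<open>n\<close> carries at most one bead.\<close>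

definition bead_multiset :: "nat \<Rightarrow> (nat \<times> shade) multiset \<Rightarrow> bool" where
  "bead_multiset n M \<longleftrightarrow> colored_multiset M \<and> (\<forall>x\<in>#M. snd x = Gray \<longrightarrow> 2*n dvd fst x) \<and>
     (\<forall>p. \<not> n dvd p \<longrightarrow> count (image_mset fst M) p \<le> 1)"

definition bead_list :: "nat \<Rightarrow> (nat \<times> shade) list \<Rightarrow> bool" where
  "bead_list n L \<longleftrightarrow> colored_partition L \<and> bead_multiset n (mset L)"

lemma count_mset_le_1_iff:
  "count (mset xs) p \<le> 1 \<longleftrightarrow> (\<forall>i<length xs. \<forall>j<length xs. xs ! i = p \<and> xs ! j = p \<longrightarrow> i = j)"
proof -
  have "count (mset xs) p = card {i. i < length xs \<and> xs ! i = p}"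
    unfolding count_mset count_list_eq_length_filter length_filter_conv_card
    by (rule arg_cong[of _ _ card]) auto
  then show ?thesis by (auto simp: card_le_Suc0_iff_eq)
qed

lemma wall_of_ground:
  assumes n: "3 \<le> n" and st: "\<And>i. column_state n (cpart L i)"
  shows "ground \<subseteq> wall_of n L"
    and "wall_of n L - ground =
      (SIGMA k:{1..length L}. blocks_at n (filling (cpart L (k - 1)) - {0}))"
proof -
  have 0: "0 \<in> filling (cpart L i)" for i
    using st[of i] by (auto simp: filling_def column_state_def)
  show "ground \<subseteq> wall_of n L"
    using 0 PosA_zero by (auto simp: ground_def wall_of_def blocks_at_def)
  show "wall_of n L - ground =
      (SIGMA k:{1..length L}. blocks_at n (filling (cpart L (k - 1)) - {0}))" (is "?l = ?r")
  proof -
    have empty: "j = 0" if "length L < k" "j \<in> filling (cpart L (k - 1))" for j k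
      using that by (auto simp: cpart_def filling_def split: if_splits)
    have "(k, h, s) \<in> ?l \<longleftrightarrow> (k, h, s) \<in> ?r" for k h s
      using block_index_eq_0_iff[OF n, of s h] empty[of k "block_index n h s"]
      by (cases "k \<le> length L") (auto simp: ground_def wall_of_def blocks_at_def)
    then show ?thesis by (auto simp only: set_eq_iff split_paired_all)
  qed
qed

lemma floor_filled_wall_of:
  "1 \<le> k \<Longrightarrow> floor_filled n (wall_of n L) k h \<longleftrightarrow>
    (\<forall>s\<in>slots n h. block_index n h s \<in> filling (cpart L (k - 1)))"
  by (auto simp: floor_filled_def wall_of_def blocks_at_def)

lemma top_floor_wall_of:
  assumes n: "3 \<le> n" and s: "s \<in> slots n h"
    and idx: "block_index n h s = Max (filling (cpart L (k - 1)))" and k: "1 \<le> k"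
  shows "top_floor (wall_of n L) k = h"
  unfolding top_floor_def
proof (rule Max_eqI)
  let ?F = "filling (cpart L (k - 1))"
  have ne: "?F \<noteq> {}" by (auto simp: filling_def)
  have eq: "{h. \<exists>s. (k, h, s) \<in> wall_of n L} = fst ` blocks_at n ?F"
    using k by (force simp: wall_of_def)
  show "finite {h. \<exists>s. (k, h, s) \<in> wall_of n L}"
    unfolding eq by (intro finite_imageI finite_blocks_at[OF n]) simp
  show "h \<in> {h. \<exists>s. (k, h, s) \<in> wall_of n L}"
    using s k Max_in[OF finite_filling ne] idx by (auto simp: wall_of_def blocks_at_def)
  fix h' assume "h' \<in> {h. \<exists>s. (k, h, s) \<in> wall_of n L}"
  then obtain s' where s': "s' \<in> slots n h'" "block_index n h' s' \<in> ?F"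
    by (auto simp: wall_of_def blocks_at_def)
  then have "block_index n h' s' \<le> block_index n h s" using idx by simp
  then show "h' \<le> h" using block_index_mono[OF n s s'(1)] by (metis leI not_le)
qed

text \<open>This turns properness into the condition that beads outside the multiples of \<open>n\<close> have distinct
  positions.\<close>

lemma full_column_wall_of_iff:
  assumes n: "3 \<le> n" and k: "1 \<le> k" and st: "column_state n (cpart L (k - 1))"
  shows "full_column n (wall_of n L) k \<longleftrightarrow> \<not> n dvd fst (cpart L (k - 1))"
proof -
  let ?x = "cpart L (k - 1)"
  obtain h s where hs: "s \<in> slots n h" "block_index n h s = Max (filling ?x)"
    using block_index_surj[OF n] by blast
  have full: "full_column n (wall_of n L) k \<longleftrightarrow> (\<forall>s\<in>slots n h. block_index n h s \<in> filling ?x)"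
    using top_floor_wall_of[OF n hs k] floor_filled_wall_of[OF k] by (simp add: full_column_def)
  show ?thesis
  proof (cases "snd ?x")
    case White
    then have F: "filling ?x = {..fst ?x}" by (simp add: filling_def)
    then have "Max (filling ?x) = fst ?x" by (intro Max_eqI) auto
    then show ?thesis using full F hs block_index_top_iff[OF n hs(1)] by auto
  next
    case Gray
    then have F: "filling ?x = insert (Suc (fst ?x)) {..<fst ?x}" by (simp add: filling_def)
    have M: "Max (filling ?x) = Suc (fst ?x)" unfolding F by (intro Max_eqI) auto
    have d: "2*n dvd fst ?x" using st Gray by (simp add: column_state_def)
    obtain h' s' where hs': "s' \<in> slots n h'" "block_index n h' s' = fst ?x"
      using block_index_surj[OF n] by blast
    have "s' = PosA" using dvd_block_index_iff(2)[OF n hs'(1)] d hs'(2) by simp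
    then have B: "PosB \<in> slots n h'" "block_index n h' PosB = Suc (fst ?x)"
      using hs' by (auto simp: slots_def block_index_def slot_offset_def split: if_splits)
    then have "h = h'" using block_index_inject[OF n hs(1) B(1)] hs(2) M by simp
    then have "\<not> full_column n (wall_of n L) k" using full hs' F by auto
    then show ?thesis using d by (metis dvd_mult_right)
  qed
qed

text \<open>Beads at the same position have the same shade, so the columns decrease as sets of blocks.\<close>

lemma cpart_bead_list:
  assumes n: "3 \<le> n" and L: "bead_list n L"
  shows "column_state n (cpart L i)"
    and "i \<le> j \<Longrightarrow> filling (cpart L j) \<subseteq> filling (cpart L i)"
proof -
  show st: "column_state n (cpart L i)" for i
    using L by (auto simp: column_state_def cpart_def bead_list_def bead_multiset_def colored_multiset_def)
      (metis nth_mem prod.collapse case_prodD)+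
  have p: "partition (map fst L)" using L by (auto simp: bead_list_def colored_partition_def)
  assume ij: "i \<le> j"
  then have "fst (cpart L j) \<le> fst (cpart L i)" unfolding fst_cpart by (rule part_antimono[OF p])
  moreover have "cpart L j = cpart L i" if eq: "fst (cpart L j) = fst (cpart L i)"
  proof (cases "j < length L")
    case True
    then have *: "cpart L i \<in> set L" "cpart L j \<in> set L" using ij by (auto simp: cpart_def)
    then have "snd (cpart L j) = snd (cpart L i)"
      using L eq unfolding bead_list_def colored_partition_def
      by (metis (full_types) prod.collapse shade.exhaust)
    then show ?thesis using eq by (simp add: prod_eq_iff)
  next
    case False
    then have "\<not> i < length L" using eq part_pos_iff[OF p, of i] by (auto simp: fst_cpart part_def)
    then show ?thesis using False by (simp add: cpart_def)
  qed
  ultimately show "filling (cpart L j) \<subseteq> filling (cpart L i)"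
    unfolding filling_subset_iff[OF n st st] by (auto simp: le_less)
qed

lemma PosB_above_PosA:
  assumes n: "3 \<le> n" and s: "s \<in> slots n h" "s' \<in> slots n h'"
    and i: "2*n dvd block_index n h s" "block_index n h' s' = Suc (block_index n h s)"
  shows "h' = h \<and> s = PosA \<and> s' = PosB"
proof -
  have A: "s = PosA" using dvd_block_index_iff(2)[OF n s(1)] i(1) by simp
  then have B: "PosB \<in> slots n h" "block_index n h PosB = block_index n h' s'"
    using s(1) i(2) by (auto simp: slots_def block_index_def slot_offset_def split: if_splits)
  then show ?thesis using block_index_inject[OF n B(1) s(2)] A by simp
qed

lemma wall_of_proper:
  assumes n: "3 \<le> n" and L: "bead_list n L"
  shows "wall_of n L \<in> proper_young_walls n"
proof -
  let ?Y = "wall_of n L"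
  note st = cpart_bead_list(1)[OF n L]
  note ground = wall_of_ground[OF n st]
  have "finite (?Y - ground)"
    unfolding ground(2) by (intro finite_SigmaI finite_blocks_at[OF n]) auto
  moreover have "floor_filled n ?Y k h" if "(k, Suc h, s) \<in> ?Y" for k h s
  proof -
    have k: "1 \<le> k" "s \<in> slots n (Suc h)" "block_index n (Suc h) s \<in> filling (cpart L (k - 1))"
      using that by (auto simp: wall_of_def blocks_at_def)
    have "block_index n h s' \<in> filling (cpart L (k - 1))" if s': "s' \<in> slots n h" for s'
      using filling_gap[OF st k(3) block_index_mono[OF n s' k(2)]] PosB_above_PosA[OF n s' k(2)]
      by auto
    then show ?thesis using floor_filled_wall_of[OF k(1)] by blast
  qed
  moreover have "(k, h, Low) \<in> ?Y" if "(k, h, High) \<in> ?Y" for k h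
  proof -
    have k: "1 \<le> k" "High \<in> slots n h" "block_index n h High \<in> filling (cpart L (k - 1))"
      using that by (auto simp: wall_of_def blocks_at_def)
    then have l: "Low \<in> slots n h" "block_index n h Low < block_index n h High"
      by (auto simp: slots_def block_index_def slot_offset_def split: if_splits)
    then have "block_index n h Low \<in> filling (cpart L (k - 1))"
      using filling_gap[OF st k(3) l(2)] dvd_block_index_iff(2)[OF n l(1)] by auto
    then show ?thesis using k l by (auto simp: wall_of_def blocks_at_def)
  qed
  moreover have "(k, h, s) \<in> ?Y" if "1 \<le> k" "(Suc k, h, s) \<in> ?Y" for k h s
    using that cpart_bead_list(2)[OF n L, of "k - 1" k] by (auto simp: wall_of_def blocks_at_def)
  ultimately have "young_wall n ?Y"
    using ground(1) by (auto simp: young_wall_def) (auto simp: wall_of_def blocks_at_def)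
  moreover have "proper n ?Y"
    unfolding proper_def
  proof (intro allI impI notI)
    fix k k' assume *: "1 \<le> k \<and> 1 \<le> k' \<and> k \<noteq> k' \<and> full_column n ?Y k \<and> full_column n ?Y k'"
      "top_floor ?Y k = top_floor ?Y k'"
    have key: "snd (cpart L (i - 1)) = White \<and> (\<exists>s. s \<in> slots n (top_floor ?Y i) \<and>
        block_index n (top_floor ?Y i) s = fst (cpart L (i - 1))) \<and>
        \<not> n dvd fst (cpart L (i - 1))" if i: "1 \<le> i" "full_column n ?Y i" for i
    proof -
      have nd: "\<not> n dvd fst (cpart L (i - 1))" using full_column_wall_of_iff[OF n i(1) st] i(2) by simp
      then have W: "snd (cpart L (i - 1)) = White"
        using st[of "i - 1"] unfolding column_state_def by (metis dvd_mult_right shade.exhaust)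
      obtain h s where hs: "s \<in> slots n h" "block_index n h s = Max (filling (cpart L (i - 1)))"
        using block_index_surj[OF n] by blast
      moreover have "Max (filling (cpart L (i - 1))) = fst (cpart L (i - 1))"
        using W unfolding filling_def by (intro Max_eqI) auto
      ultimately show ?thesis using W nd top_floor_wall_of[OF n hs i(1)] by auto
    qed
    obtain s s' where s: "s \<in> slots n (top_floor ?Y k)" "s' \<in> slots n (top_floor ?Y k)"
      "block_index n (top_floor ?Y k) s = fst (cpart L (k - 1))"
      "block_index n (top_floor ?Y k) s' = fst (cpart L (k' - 1))"
      using key[of k] key[of k'] * by auto
    have nd: "\<not> n dvd fst (cpart L (k - 1))" "\<not> n dvd fst (cpart L (k' - 1))"
      using key[of k] key[of k'] * by auto
    have eq: "fst (cpart L (k - 1)) = fst (cpart L (k' - 1))"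
      using block_index_top_iff[OF n s(1)] block_index_top_iff[OF n s(2)] nd s by (metis le_antisym)
    have "fst (cpart L (k - 1)) \<noteq> 0" "fst (cpart L (k' - 1)) \<noteq> 0" using nd by (metis dvd_0_right)+
    then have lt: "k - 1 < length L" "k' - 1 < length L" by (auto simp: cpart_def split: if_splits)
    have "count (mset (map fst L)) (fst (cpart L (k - 1))) \<le> 1"
      using L nd(1) by (simp add: bead_list_def bead_multiset_def)
    then have "k - 1 = k' - 1"
      unfolding count_mset_le_1_iff using lt eq by (auto simp: cpart_def)
    then show False using * by auto
  qed
  ultimately show ?thesis by (simp add: proper_young_walls_def)
qed

lemma added_blocks_wall_of:
  assumes n: "3 \<le> n" and st: "\<And>i. column_state n (cpart L i)" and k: "1 \<le> k"
  shows "added_blocks (wall_of n L) k = fst (cpart L (k - 1))"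
proof -
  let ?x = "cpart L (k - 1)"
  have "{(h, s). (k, h, s) \<in> wall_of n L - ground} = blocks_at n (filling ?x - {0})"
  proof (cases "k \<le> length L")
    case True
    then show ?thesis unfolding wall_of_ground(2)[OF n st] using k by auto
  next
    case False
    then have "filling ?x - {0} = {}" by (auto simp: filling_def cpart_def)
    then show ?thesis unfolding wall_of_ground(2)[OF n st] using False by (auto simp: blocks_at_def)
  qed
  then have "added_blocks (wall_of n L) k = card (filling ?x - {0})"
    by (simp add: added_blocks_def card_blocks_at[OF n])
  also have "\<dots> = card (filling ?x) - 1"
    using st[of "k - 1"] by (subst card_Diff_singleton) (auto simp: filling_def column_state_def)
  also have "\<dots> = fst ?x" by (simp add: filling_def)
  finally show ?thesis .
qed

lemma bead_shade_wall_of: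
  assumes n: "3 \<le> n" and st: "\<And>i. column_state n (cpart L i)" and k: "1 \<le> k"
  shows "bead_shade (wall_of n L) k = snd (cpart L (k - 1))"
proof -
  let ?x = "cpart L (k - 1)"
  have AB: "PosA \<in> slots n h \<and> block_index n h PosB = Suc (block_index n h PosA)"
    if "PosB \<in> slots n h" for h
    using that by (auto simp: slots_def block_index_def slot_offset_def split: if_splits)
  have eq: "(\<exists>h. (k, h, PosB) \<in> wall_of n L \<and> (k, h, PosA) \<notin> wall_of n L) \<longleftrightarrow>
    (\<exists>h. PosB \<in> slots n h \<and> Suc (block_index n h PosA) \<in> filling ?x \<and> block_index n h PosA \<notin> filling ?x)"
    using k AB by (auto simp: wall_of_def blocks_at_def)
  show ?thesis
  proof (cases "snd ?x")
    case White
    then show ?thesis unfolding bead_shade_def eq by (auto simp: filling_def)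
  next
    case Gray
    then have d: "2*n dvd fst ?x" using st[of "k - 1"] by (simp add: column_state_def)
    obtain h s where hs: "s \<in> slots n h" "block_index n h s = fst ?x"
      using block_index_surj[OF n] by blast
    have "s = PosA" using dvd_block_index_iff(2)[OF n hs(1)] d hs(2) by simp
    then have "PosB \<in> slots n h" "block_index n h PosA = fst ?x"
      using hs by (auto simp: slots_def split: if_splits)
    then show ?thesis using Gray unfolding bead_shade_def eq by (auto simp: filling_def)
  qed
qed

lemma beads_wall_of:
  assumes n: "3 \<le> n" and L: "bead_list n L"
  shows "beads (wall_of n L) = mset L" and "card (nonempty_columns (wall_of n L)) = length L"
proof -
  note st = cpart_bead_list(1)[OF n L]
  have p: "partition (map fst L)" using L by (auto simp: bead_list_def colored_partition_def)
  have "nonempty_columns (wall_of n L) = {k. 1 \<le> k \<and> k - 1 < length L}"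
  proof (rule set_eqI)
    fix k
    show "k \<in> nonempty_columns (wall_of n L) \<longleftrightarrow> k \<in> {k. 1 \<le> k \<and> k - 1 < length L}"
      using part_pos_iff[OF p, of "k - 1"] added_blocks_wall_of[OF n st, of k]
      by (cases "1 \<le> k") (simp_all add: nonempty_columns_def fst_cpart)
  qed
  also have "\<dots> = Suc ` {0..<length L}"
  proof (rule set_eqI)
    fix k show "k \<in> {k. 1 \<le> k \<and> k - 1 < length L} \<longleftrightarrow> k \<in> Suc ` {0..<length L}"
      by (cases k) auto
  qed
  finally have ne: "nonempty_columns (wall_of n L) = Suc ` {0..<length L}" .
  then show "card (nonempty_columns (wall_of n L)) = length L" by (simp add: card_image)
  have e: "mset_set (Suc ` {0..<length L}) = image_mset Suc (mset_set {0..<length L})"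
    by (rule image_mset_mset_set[symmetric]) simp
  have "beads (wall_of n L) =
      image_mset (\<lambda>k. (added_blocks (wall_of n L) (Suc k), bead_shade (wall_of n L) (Suc k))) (mset_set {0..<length L})"
    unfolding beads_def ne e by (simp add: multiset.map_comp comp_def)
  also have "\<dots> = image_mset (\<lambda>k. L ! k) (mset_set {0..<length L})"
    by (rule image_mset_cong)
      (simp add: added_blocks_wall_of[OF n st] bead_shade_wall_of[OF n st], simp add: cpart_def)
  also have "\<dots> = mset L" by (metis map_nth mset_map mset_upt)
  finally show "beads (wall_of n L) = mset L" .
qed

text \<open>The floor condition propagates downwards, so all floors below an occupied floor are filled. On one
  floor, the upper half of a floor \<open>[n]\<close> needs the lower half, while the two halves of a floor \<open>{0, 1}\<close> may come in
  either order; the latter is the gap that \<open>filling\<close> allows.\<close>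

lemma column_of_young_wall:
  assumes n: "3 \<le> n" and Y: "young_wall n Y" and k: "1 \<le> k"
  shows "\<exists>x. column_state n x \<and> {(h, s). (k, h, s) \<in> Y} = blocks_at n (filling x)"
proof -
  define C where "C = {(h, s). (k, h, s) \<in> Y}"
  define X where "X = (\<lambda>(h, s). block_index n h s) ` C"
  have slots: "s \<in> slots n h" if "(h, s) \<in> C" for h s using Y that by (auto simp: young_wall_def C_def)
  have C: "C = blocks_at n X"
    using slots block_index_inject[OF n] by (auto simp: X_def blocks_at_def) (metis slots)
  have ground: "(k, 0, PosA) \<in> Y" using Y k by (auto simp: young_wall_def ground_def)
  have below: "(k, h', s') \<in> Y" if "(k, h, s) \<in> Y" "h' < h" "s' \<in> slots n h'" for h s h' s'
    using that
  proof (induction h arbitrary: s)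
    case (Suc h)
    have ff: "floor_filled n Y k h" using Y Suc.prems(1) unfolding young_wall_def by blast
    show ?case
    proof (cases "h' = h")
      case True
      then show ?thesis using ff Suc.prems(3) by (auto simp: floor_filled_def)
    next
      case False
      have "slots n h \<noteq> {}" by (simp add: slots_def)
      then obtain s'' where "s'' \<in> slots n h" by blast
      then have "(k, h, s'') \<in> Y" using ff by (auto simp: floor_filled_def)
      then show ?thesis using Suc.IH[of s''] False Suc.prems by auto
    qed
  qed simp
  have "finite X"
  proof -
    have "C \<subseteq> insert (0, PosA) (snd ` (Y - ground))" by (force simp: C_def ground_def)
    moreover have "finite (Y - ground)" using Y by (auto simp: young_wall_def)
    ultimately have "finite C" by (meson finite_imageI finite_insert finite_subset)
    then show ?thesis by (simp add: X_def)
  qed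
  moreover have "0 \<in> X"
    using ground PosA_zero(2) unfolding X_def C_def by (intro image_eqI[of _ _ "(0, PosA)"]) auto
  moreover have "i \<in> X \<or> 2*n dvd i \<and> j = Suc i" if ji: "j \<in> X" "i < j" for i j
  proof -
    obtain h s where j: "(k, h, s) \<in> Y" "block_index n h s = j" using ji(1) by (auto simp: X_def C_def)
    have s: "s \<in> slots n h" using slots j by (auto simp: C_def)
    obtain h' s' where i: "s' \<in> slots n h'" "block_index n h' s' = i" using block_index_surj[OF n] by blast
    have "h' \<le> h" using block_index_mono[OF n s i(1)] ji(2) i(2) j(2) by (metis leI less_asym)
    then consider "h' < h" | "h' = h" by linarith
    then show ?thesis
    proof cases
      case 1
      then have "(k, h', s') \<in> Y" using below j(1) i(1) by blast
      then have "i \<in> X" using i(2) unfolding X_def C_def by (intro image_eqI[of _ _ "(h', s')"]) auto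
      then show ?thesis ..
    next
      case 2
      have "s \<noteq> s'" using 2 i(2) j(2) ji(2) by auto
      then consider "s' = PosA" "s = PosB" | "s' = Low" "s = High"
        using 2 s i ji(2) j(2) by (auto simp: slots_def block_index_def slot_offset_def split: if_splits)
      then show ?thesis
      proof cases
        case 1
        then have "j = Suc i" using 2 i(2) j(2) by (simp add: block_index_def slot_offset_def)
        moreover have "2*n dvd i" using dvd_block_index_iff(2)[OF n i(1)] 1 i(2) by simp
        ultimately show ?thesis by simp
      next
        case L: 2
        have "(k, h, High) \<in> Y" using j(1) L by simp
        then have "(k, h', s') \<in> Y" using Y 2 L unfolding young_wall_def by blast
        then have "i \<in> X" using i(2) unfolding X_def C_def by (intro image_eqI[of _ _ "(h', s')"]) auto
        then show ?thesis ..
      qed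
    qed
  qed
  ultimately have "\<exists>x. column_state n x \<and> X = filling x" by (rule ex_filling[OF n])
  then obtain x where "column_state n x" "X = filling x" by blast
  then show ?thesis using C unfolding C_def by blast
qed

lemma ex_wall_of:
  assumes n: "3 \<le> n" and Y: "Y \<in> proper_young_walls n"
  shows "\<exists>L. bead_list n L \<and> Y = wall_of n L"
proof -
  have yw: "young_wall n Y" and pr: "proper n Y" using Y by (auto simp: proper_young_walls_def)
  obtain st where st: "\<And>i. column_state n (st i)"
    "\<And>i. {(h, s). (Suc i, h, s) \<in> Y} = blocks_at n (filling (st i))"
    using column_of_young_wall[OF n yw, of "Suc i" for i] by (metis Suc_eq_plus1_left le_add1)
  have mem: "(Suc i, h, s) \<in> Y \<longleftrightarrow> (h, s) \<in> blocks_at n (filling (st i))" for i h s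
    using st(2)[of i] by auto
  have blocks_mono: "F \<subseteq> G" if sub: "blocks_at n F \<subseteq> blocks_at n G" for F G
  proof
    fix j assume "j \<in> F"
    moreover obtain h s where "s \<in> slots n h" "block_index n h s = j" using block_index_surj[OF n] by blast
    ultimately show "j \<in> G" using sub by (auto simp: blocks_at_def)
  qed
  have "(Suc i, h, s) \<in> Y" if "(Suc (Suc i), h, s) \<in> Y" for i h s
    using yw that unfolding young_wall_def by (metis le_add1 plus_1_eq_Suc)
  then have "filling (st (Suc i)) \<subseteq> filling (st i)" for i
    by (intro blocks_mono) (auto simp: mem)
  then have sub: "filling (st j) \<subseteq> filling (st i)" if "i \<le> j" for i j
    using lift_Suc_antimono_le[of "\<lambda>i. filling (st i)", OF _ that] by blast
  have dec: "fst (st (Suc i)) \<le> fst (st i)" for i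
    using sub[of i "Suc i"] filling_subset_iff[OF n st(1) st(1)] by (metis less_imp_le_nat order_refl le_SucI)
  have "finite (Y - ground)" using yw by (auto simp: young_wall_def)
  then have "finite (fst ` (Y - ground))" by simp
  \<comment> \<open>beyond column \<open>N\<close> the wall agrees with the ground state\<close>
  then obtain N where N: "\<And>k. k \<in> fst ` (Y - ground) \<Longrightarrow> k < N"
    by (meson finite_nat_set_iff_bounded)
  have "fst (st N) = 0"
  proof (rule ccontr)
    assume "fst (st N) \<noteq> 0"
    then have "(if snd (st N) = White then fst (st N) else Suc (fst (st N))) \<in> filling (st N) - {0}"
      by (simp add: filling_def)
    then obtain j where j: "j \<in> filling (st N)" "j \<noteq> 0" by blast
    obtain h s where hs: "s \<in> slots n h" "block_index n h s = j" using block_index_surj[OF n] by blast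
    then have "(Suc N, h, s) \<in> Y" using j mem by (auto simp: blocks_at_def)
    moreover have "(Suc N, h, s) \<notin> ground" using hs j(2) PosA_zero by (auto simp: ground_def)
    ultimately show False using N[of "Suc N"] by force
  qed
  with dec obtain xs where xs: "partition xs" "\<And>i. part xs i = fst (st i)"
    using ex_partition[of "\<lambda>i. fst (st i)" N] by blast
  define L where "L = map st [0..<length xs]"
  have cp: "cpart L i = st i" for i
    using xs(2)[of i] st(1)[of i] part_pos_iff[OF xs(1), of i]
    by (cases "st i"; cases "snd (st i)") (auto simp: cpart_def L_def column_state_def)
  have mf: "map fst L = xs" using xs(2) by (auto simp: L_def part_def intro!: nth_equalityI) (metis)
  have shade: "snd (st i) = snd (st j)" if "fst (st i) = fst (st j)" for i j
  proof -
    have "st i = st j \<or> st j = st i"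
      using sub[of i j] sub[of j i] filling_subset_iff[OF n st(1) st(1)] that
      by (metis less_irrefl nle_le)
    then show ?thesis by auto
  qed
  have Ywall: "Y = wall_of n L"
  proof -
    have "1 \<le> k" if "(k, h, s) \<in> Y" for k h s using yw that by (auto simp: young_wall_def)
    then have "(k, h, s) \<in> Y \<longleftrightarrow> (k, h, s) \<in> wall_of n L" for k h s
      using mem[of "k - 1" h s] by (cases k) (auto simp: wall_of_def cp)
    then show ?thesis by (auto simp only: set_eq_iff split_paired_all)
  qed
  have "colored_partition L"
    unfolding colored_partition_def mf
  proof (intro conjI allI notI xs(1))
    fix k assume "(k, White) \<in> set L \<and> (k, Gray) \<in> set L"
    then obtain i j where "st i = (k, White)" "st j = (k, Gray)" by (auto simp: L_def)
    then show False using shade[of i j] by simp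
  qed
  moreover have "bead_multiset n (mset L)"
    unfolding bead_multiset_def
  proof (intro conjI allI impI ballI)
    show "colored_multiset (mset L)" using calculation by (simp add: colored_partition_iff)
    show "2*n dvd fst x" if "x \<in># mset L" "snd x = Gray" for x
      using that st(1) by (auto simp: L_def column_state_def)
    fix p assume p: "\<not> n dvd p"
    have "i = j" if ij: "i < length xs" "j < length xs" "fst (L ! i) = p" "fst (L ! j) = p" for i j
    proof (rule ccontr)
      assume "i \<noteq> j"
      have e: "fst (st i) = p" "fst (st j) = p" using ij by (auto simp: L_def)
      then have "st i = st j" using shade[of i j] by (simp add: prod_eq_iff)
      then have "top_floor Y (Suc i) = top_floor Y (Suc j)" by (simp add: top_floor_def mem)
      moreover have "full_column n Y (Suc i)" "full_column n Y (Suc j)"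
        unfolding Ywall using full_column_wall_of_iff[OF n] st(1) e p by (auto simp: cp)
      ultimately show False using pr \<open>i \<noteq> j\<close> unfolding proper_def by (metis Suc_inject le_add1 plus_1_eq_Suc)
    qed
    then have "count (mset (map fst L)) p \<le> 1"
      unfolding count_mset_le_1_iff by (simp add: L_def)
    then show "count (image_mset fst (mset L)) p \<le> 1" by simp
  qed
  ultimately show ?thesis using Ywall by (auto simp: bead_list_def)
qed

section \<open>The weight of a wall\<close>

lemma card_residue_class:
  fixes l :: nat
  assumes "a < l"
  shows "card {j. j \<le> s \<and> j mod l = a} = s div l + of_bool (a \<le> s mod l)"
proof (induction s)
  case 0
  have "{j. j \<le> 0 \<and> j mod l = a} = (if a = 0 then {0} else {})" by auto
  then show ?case by simp
next
  case (Suc s)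
  have fin: "finite {j. j \<le> s \<and> j mod l = a}" by (rule finite_subset[of _ "{..s}"]) auto
  have "{j. j \<le> Suc s \<and> j mod l = a} =
      (if Suc s mod l = a then insert (Suc s) {j. j \<le> s \<and> j mod l = a} else {j. j \<le> s \<and> j mod l = a})"
    by (auto simp: le_Suc_eq)
  then have "card {j. j \<le> Suc s \<and> j mod l = a} =
      of_bool (Suc s mod l = a) + (s div l + of_bool (a \<le> s mod l))"
    using fin Suc by simp
  also have "\<dots> = Suc s div l + of_bool (a \<le> Suc s mod l)"
  proof (cases "Suc (s mod l) = l")
    case True
    then have "Suc s mod l = 0" "Suc s div l = Suc (s div l)" by (simp_all add: mod_Suc div_Suc)
    then show ?thesis using assms True by auto
  next
    case False
    then have "Suc s mod l = Suc (s mod l)" "Suc s div l = s div l" by (simp_all add: mod_Suc div_Suc)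
    then show ?thesis by auto
  qed
  finally show ?case .
qed

text \<open>For \<open>2 \<le> i \<le> n\<close> this is the number of \<open>i\<close>-blocks in a column with \<open>s\<close> added blocks: color \<open>i\<close>
  occupies the residues \<open>i\<close> and \<open>2n + 1 - i\<close> of the block numbers. For \<open>i = 1\<close> it counts the blocks of
  colors 0 and 1 together.\<close>

definition color_weight :: "nat \<Rightarrow> nat \<Rightarrow> nat \<Rightarrow> nat" where
  "color_weight n i s =
     2 * (s div (2*n)) + of_bool (i \<le> s mod (2*n)) + of_bool (2*n + 1 - i \<le> s mod (2*n))"

text \<open>The surplus of B-blocks over added A-blocks in a column.\<close>

definition excess :: "nat \<Rightarrow> nat \<times> shade \<Rightarrow> int" where
  "excess n x = (if snd x = Gray then 2 else of_bool (\<not> 2*n dvd fst x))"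

lemma card_color_column:
  assumes n: "3 \<le> n" and x: "column_state n x" and i: "2 \<le> i" "i \<le> n"
  shows "card {j \<in> filling x - {0}. block_color n k j = i} = color_weight n i (fst x)"
proof -
  let ?S = "\<lambda>a. {j. j \<le> fst x \<and> j mod (2*n) = a}"
  have "block_color n k j = i \<longleftrightarrow> j mod (2*n) = i \<or> j mod (2*n) = 2*n + 1 - i" for j
  proof -
    have "j mod (2*n) < 2*n" using n by simp
    then show ?thesis using i by (auto simp: block_color_def Let_def)
  qed
  moreover have "j \<in> filling x - {0} \<longleftrightarrow> j \<le> fst x" if "2 \<le> j mod (2*n)" for j
  proof (cases "snd x")
    case White
    then show ?thesis using that by (cases "j = 0") (auto simp: filling_def)
  next
    case Gray
    then have d: "fst x mod (2*n) = 0" using x by (simp add: column_state_def)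
    then have "Suc (fst x) mod (2*n) = 1" using n by (simp add: mod_Suc)
    moreover have "0 mod (2*n) = 0" by simp
    ultimately have "j \<noteq> fst x" "j \<noteq> Suc (fst x)" "j \<noteq> 0" using that d by (metis not_numeral_le_zero, metis Suc_1 Suc_n_not_le_n One_nat_def, metis not_numeral_le_zero)
    then show ?thesis using Gray by (auto simp: filling_def)
  qed
  ultimately have "j \<in> filling x - {0} \<and> block_color n k j = i \<longleftrightarrow> j \<in> ?S i \<union> ?S (2*n + 1 - i)" for j
    using i by (cases "2 \<le> j mod (2*n)") auto
  then have "{j \<in> filling x - {0}. block_color n k j = i} = ?S i \<union> ?S (2*n + 1 - i)"
    by blast
  moreover have "finite (?S a)" for a by (rule finite_subset[of _ "{..fst x}"]) auto
  moreover have "?S i \<inter> ?S (2*n + 1 - i) = {}" using i by auto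
  ultimately show ?thesis
    using i by (simp add: card_Un_disjoint card_residue_class color_weight_def)
qed

definition count_A :: "nat \<Rightarrow> nat \<times> shade \<Rightarrow> nat" where
  "count_A n x = card {j \<in> filling x - {0}. j mod (2*n) = 0}"

definition count_B :: "nat \<Rightarrow> nat \<times> shade \<Rightarrow> nat" where
  "count_B n x = card {j \<in> filling x - {0}. j mod (2*n) = 1}"

lemma count_A_B:
  assumes n: "3 \<le> n" and x: "column_state n x"
  shows "int (count_B n x) - int (count_A n x) = excess n x"
    and "count_A n x + count_B n x = color_weight n 1 (fst x)"
proof -
  let ?l = "2*n"
  let ?s = "fst x"
  let ?S = "\<lambda>a. {j. j \<le> ?s \<and> j mod ?l = a}"
  have fin: "finite (?S a)" for a by (rule finite_subset[of _ "{..?s}"]) auto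
  have c0: "card (?S 0) = ?s div ?l + 1" and c1: "card (?S 1) = ?s div ?l + of_bool (1 \<le> ?s mod ?l)"
    using card_residue_class[of 0 ?l ?s] card_residue_class[of 1 ?l ?s] n by auto
  have top: "\<not> ?l \<le> ?s mod ?l" using n by (simp add: not_le)
  have "int (count_B n x) - int (count_A n x) = excess n x \<and>
      count_A n x + count_B n x = color_weight n 1 ?s"
  proof (cases "snd x")
    case White
    have "{j \<in> filling x - {0}. j mod ?l = 0} = ?S 0 - {0}"
      "{j \<in> filling x - {0}. j mod ?l = 1} = ?S 1"
      using White by (auto simp: filling_def intro: gr0I)
    moreover have "card (?S 0 - {0}) = ?s div ?l" using c0 fin by (subst card_Diff_singleton) auto
    ultimately have "count_A n x = ?s div ?l" "count_B n x = ?s div ?l + of_bool (1 \<le> ?s mod ?l)"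
      using c1 by (simp_all only: count_A_def count_B_def)
    then show ?thesis using White top
      by (auto simp: excess_def color_weight_def dvd_eq_mod_eq_0)
  next
    case Gray
    then have d: "?s mod ?l = 0" "0 < ?s" using x by (auto simp: column_state_def)
    then have d1: "Suc ?s mod ?l = 1" using n by (simp add: mod_Suc)
    have q: "0 < ?s div ?l" using d using div_mult_mod_eq[of ?s ?l] by (intro gr0I) simp
    have "{j \<in> filling x - {0}. j mod ?l = 0} = ?S 0 - {0, ?s}"
      using Gray d d1 by (auto simp: filling_def)
    moreover have "card (?S 0 - {0, ?s}) = ?s div ?l - 1"
      using c0 fin d by (subst card_Diff_subset) auto
    ultimately have A: "count_A n x = ?s div ?l - 1" by (simp only: count_A_def)
    have "j \<noteq> ?s" if "j mod ?l = 1" for j using that d by auto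
    then have "{j \<in> filling x - {0}. j mod ?l = 1} = insert (Suc ?s) (?S 1)"
      using Gray d1 by (auto simp: filling_def le_less intro: gr0I)
    moreover have "card (insert (Suc ?s) (?S 1)) = ?s div ?l + 1"
      using c1 fin d by (subst card_insert_disjoint) auto
    ultimately have B: "count_B n x = ?s div ?l + 1" by (simp only: count_B_def)
    show ?thesis using A B q Gray d by (auto simp: excess_def color_weight_def)
  qed
  then show "int (count_B n x) - int (count_A n x) = excess n x"
    and "count_A n x + count_B n x = color_weight n 1 ?s" by auto
qed

lemma content_wall_of:
  assumes n: "3 \<le> n" and st: "\<And>i. column_state n (cpart L i)"
  shows "content n (wall_of n L) c =
    (\<Sum>i<length L. card {j \<in> filling (L ! i) - {0}. block_color n (Suc i) j = c})"
proof -
  let ?F = "\<lambda>k. {j \<in> filling (cpart L (k - 1)) - {0}. block_color n k j = c}"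
  have "{b \<in> wall_of n L - ground. color n b = c} = (SIGMA k:{1..length L}. blocks_at n (?F k))"
    unfolding wall_of_ground(2)[OF n st]
    by (auto simp: blocks_at_def color_eq_block_color[OF n])
  then have "content n (wall_of n L) c = (\<Sum>k\<in>{1..length L}. card (?F k))"
    by (simp add: content_def card_SigmaI finite_blocks_at[OF n] card_blocks_at[OF n])
  also have "{1..length L} = Suc ` {..<length L}"
    by (metis One_nat_def atLeastLessThanSuc_atLeastAtMost image_Suc_lessThan)
  also have "(\<Sum>k\<in>Suc ` {..<length L}. card (?F k)) = (\<Sum>i<length L. card (?F (Suc i)))"
    by (simp add: sum.reindex)
  also have "\<dots> = (\<Sum>i<length L. card {j \<in> filling (L ! i) - {0}. block_color n (Suc i) j = c})"
    by (rule sum.cong) (auto simp: cpart_def)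
  finally show ?thesis .
qed

lemma sum_mset_nth: "(\<Sum>i<length L. f (L ! i)) = (\<Sum>x\<in>#mset L. f x)"
proof -
  have "(\<Sum>i<length L. f (L ! i)) = sum_list (map f L)"
    by (simp add: sum_list_sum_nth atLeast0LessThan)
  also have "\<dots> = (\<Sum>x\<in>#mset L. f x)" by (metis mset_map sum_mset_sum_list)
  finally show ?thesis .
qed

lemma content_wall_of_ge_2:
  assumes n: "3 \<le> n" and L: "bead_list n L" and i: "2 \<le> i" "i \<le> n"
  shows "content n (wall_of n L) i = (\<Sum>x\<in>#mset L. color_weight n i (fst x))"
proof -
  note st = cpart_bead_list(1)[OF n L]
  have "column_state n (L ! k)" if "k < length L" for k using st[of k] that by (simp add: cpart_def)
  then have "content n (wall_of n L) i = (\<Sum>k<length L. color_weight n i (fst (L ! k)))"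
    unfolding content_wall_of[OF n st] by (intro sum.cong card_color_column[OF n _ i]) auto
  then show ?thesis using sum_mset_nth[of "\<lambda>x. color_weight n i (fst x)" L] by simp
qed

lemma content_wall_of_gt:
  assumes n: "3 \<le> n" and L: "bead_list n L" and i: "n < i"
  shows "content n (wall_of n L) i = 0"
proof -
  have "block_color n k j \<noteq> i" for k j
    using i n by (auto simp: block_color_def Let_def)
  then show ?thesis unfolding content_wall_of[OF n cpart_bead_list(1)[OF n L]] by simp
qed

text \<open>Positions A and B exchange their colors from one column to the next. Hence the difference of the
  numbers of 0- and 1-blocks is an alternating sum, while their total does not see the shades.\<close>

lemma content_wall_of_0_1:
  assumes n: "3 \<le> n" and L: "bead_list n L"
  shows "int (content n (wall_of n L) 0) - int (content n (wall_of n L) 1) = alternating_sum (excess n) L"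
    and "content n (wall_of n L) 0 + content n (wall_of n L) 1 = (\<Sum>x\<in>#mset L. color_weight n 1 (fst x))"
proof -
  note st = cpart_bead_list(1)[OF n L]
  have stL: "column_state n (L ! k)" if "k < length L" for k using st[of k] that by (simp add: cpart_def)
  have c01: "block_color n k j = 0 \<longleftrightarrow> j mod (2*n) = (if odd k then 1 else 0)"
    "block_color n k j = 1 \<longleftrightarrow> j mod (2*n) = (if odd k then 0 else 1)" for k j
  proof -
    have "j mod (2*n) < 2*n" using n by simp
    then have "r \<le> n \<or> 2*n + 1 - r \<noteq> 0 \<and> 2*n + 1 - r \<noteq> 1" if "r = j mod (2*n)" for r
      using that by linarith
    then show "block_color n k j = 0 \<longleftrightarrow> j mod (2*n) = (if odd k then 1 else 0)"
      "block_color n k j = 1 \<longleftrightarrow> j mod (2*n) = (if odd k then 0 else 1)"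
      by (auto simp: block_color_def Let_def)
  qed
  have c0: "content n (wall_of n L) 0 = (\<Sum>k<length L. if even k then count_B n (L ! k) else count_A n (L ! k))"
    and c1: "content n (wall_of n L) 1 = (\<Sum>k<length L. if even k then count_A n (L ! k) else count_B n (L ! k))"
    unfolding content_wall_of[OF n st] c01 by (auto intro!: sum.cong simp: count_A_def count_B_def)
  have "int (content n (wall_of n L) 0) - int (content n (wall_of n L) 1) =
      (\<Sum>k<length L. (-1) ^ k * (int (count_B n (L ! k)) - int (count_A n (L ! k))))"
    unfolding c0 c1 of_nat_sum sum_subtractf[symmetric] by (rule sum.cong) auto
  also have "\<dots> = alternating_sum (excess n) L"
    unfolding alternating_sum_eq_sum by (rule sum.cong) (auto simp: count_A_B(1)[OF n stL])
  finally show "int (content n (wall_of n L) 0) - int (content n (wall_of n L) 1) = alternating_sum (excess n) L" .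
  have "content n (wall_of n L) 0 + content n (wall_of n L) 1 =
      (\<Sum>k<length L. count_A n (L ! k) + count_B n (L ! k))"
    unfolding c0 c1 sum.distrib[symmetric] by (rule sum.cong) auto
  also have "\<dots> = (\<Sum>k<length L. color_weight n 1 (fst (L ! k)))"
    by (rule sum.cong) (auto simp: count_A_B(2)[OF n stL])
  finally show "content n (wall_of n L) 0 + content n (wall_of n L) 1 = (\<Sum>x\<in>#mset L. color_weight n 1 (fst x))"
    using sum_mset_nth[of "\<lambda>x. color_weight n 1 (fst x)" L] by simp
qed

lemma wall_of_weight_iff:
  assumes n: "3 \<le> n" and L: "bead_list n L"
  shows "wall_of n L \<in> walls_of_weight n m \<longleftrightarrow>
    (\<forall>i\<in>{1..n}. (\<Sum>x\<in>#mset L. color_weight n i (fst x)) = 2*m + 1) \<and> alternating_sum (excess n) L = 1"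
    (is "_ \<longleftrightarrow> ?R")
proof -
  let ?c = "content n (wall_of n L)"
  have "wall_of n L \<in> walls_of_weight n m \<longleftrightarrow> (\<forall>i. ?c i = gamma n i + m * delta n i)"
    using wall_of_proper[OF n L] by (auto simp: walls_of_weight_def)
  also have "\<dots> \<longleftrightarrow> ?c 0 = m + 1 \<and> ?c 1 = m \<and> (\<forall>i\<in>{2..n}. ?c i = 2*m + 1)" (is "?A \<longleftrightarrow> ?B")
  proof
    assume ?A
    then show ?B by (auto simp: gamma_def delta_def)
  next
    assume B: ?B
    show ?A
    proof
      fix i
      consider "i = 0" | "i = 1" | "2 \<le> i" "i \<le> n" | "n < i" by linarith
      then show "?c i = gamma n i + m * delta n i"
        by cases (use B n content_wall_of_gt[OF n L, of i] in \<open>auto simp: gamma_def delta_def\<close>)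
    qed
  qed
  also have "\<dots> \<longleftrightarrow> (?c 0 + ?c 1 = 2*m + 1 \<and> int (?c 0) - int (?c 1) = 1) \<and> (\<forall>i\<in>{2..n}. ?c i = 2*m + 1)"
  proof -
    have "a = m + 1 \<and> b = m \<longleftrightarrow> a + b = 2*m + 1 \<and> int a - int b = 1" for a b :: nat
      by linarith
    then show ?thesis by metis
  qed
  also have "(?c 0 + ?c 1 = 2*m + 1 \<and> int (?c 0) - int (?c 1) = 1) \<and> (\<forall>i\<in>{2..n}. ?c i = 2*m + 1) \<longleftrightarrow> ?R"
  proof -
    have "{1..n} = insert 1 {2..n}" using n by auto
    then show ?thesis
      unfolding content_wall_of_0_1[OF n L] using content_wall_of_ge_2[OF n L] by auto
  qed
  finally show ?thesis by blast
qed

definition residue_count :: "nat \<Rightarrow> nat multiset \<Rightarrow> nat \<Rightarrow> nat" where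
  "residue_count n P i = size (filter_mset (\<lambda>p. p mod (2*n) = i) P)"

lemma size_filter_mset_eq_sum: "size (filter_mset Q P) = (\<Sum>p\<in>#P. of_bool (Q p))"
  by (induction P) auto

text \<open>Every added block is counted once, under its color, where 0 and 1 share the index 1.\<close>

lemma sum_color_weight:
  assumes n: "1 \<le> n"
  shows "(\<Sum>i\<in>{1..n}. color_weight n i p) = p"
proof -
  let ?l = "2*n"
  let ?r = "p mod ?l"
  have r: "?r < ?l" using n by simp
  have "{1..n} \<inter> {i. i \<le> ?r} = {1..min n ?r}" "{1..n} \<inter> {i. ?l + 1 - i \<le> ?r} = {?l + 1 - ?r..n}"
    using r by auto
  then have "(\<Sum>i\<in>{1..n}. color_weight n i p) = n * (2 * (p div ?l)) + min n ?r + (n + 1 - (?l + 1 - ?r))"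
    by (simp add: color_weight_def sum.distrib sum_of_bool_eq)
  moreover have "min n ?r + (n + 1 - (?l + 1 - ?r)) = ?r" using r by linarith
  moreover have "n * (2 * (p div ?l)) + ?r = p" using div_mult_mod_eq[of p ?l] by (simp add: mult_ac)
  ultimately show ?thesis by (metis add.assoc)
qed

text \<open>Passing from color \<open>i\<close> to \<open>i + 1\<close>, a bead of \<open>R\<^sub>i\<close> loses one block and a bead of \<open>R\<^sub>2\<^sub>n\<^sub>-\<^sub>i\<close> gains
  one, and no other bead changes. So the color counts are all equal if and only if opposite runners have
  equally many beads, and their common value is then read off from the sum of all positions.\<close>

lemma color_weights_constant_iff:
  assumes n: "3 \<le> n"
  shows "(\<forall>i\<in>{1..n}. (\<Sum>p\<in>#P. color_weight n i p) = c) \<longleftrightarrow>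
    (\<forall>i\<in>{1..<n}. residue_count n P i = residue_count n P (2*n - i)) \<and> sum_mset P = n * c"
proof -
  let ?c = "\<lambda>i. \<Sum>p\<in>#P. color_weight n i p"
  have step: "?c i + residue_count n P (2*n - i) = ?c (Suc i) + residue_count n P i"
    if i: "1 \<le> i" "i < n" for i
  proof -
    have aux: "color_weight n i p + of_bool (p mod (2*n) = 2*n - i) =
        color_weight n (Suc i) p + of_bool (p mod (2*n) = i)" for p
    proof -
      have split: "of_bool (j \<le> r) = of_bool (Suc j \<le> r) + (of_bool (r = j) :: nat)" for j r :: nat
        by auto
      have "2*n + 1 - i = Suc (2*n - i)" "2*n + 1 - Suc i = 2*n - i" using i by auto
      then show ?thesis
        unfolding color_weight_def by (simp only: split[of i "p mod (2*n)"] split[of "2*n - i" "p mod (2*n)"] add_ac)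
    qed
    show ?thesis
      unfolding residue_count_def size_filter_mset_eq_sum sum_mset.distrib[symmetric] aux ..
  qed
  have total: "(\<Sum>i\<in>{1..n}. ?c i) = sum_mset P"
  proof (induction P)
    case (add x P)
    then show ?case using sum_color_weight[of n x] n by (simp add: sum.distrib)
  qed simp
  show ?thesis
  proof
    assume c: "\<forall>i\<in>{1..n}. ?c i = c"
    have "residue_count n P i = residue_count n P (2*n - i)" if "i \<in> {1..<n}" for i
      using step[of i] c that by auto
    moreover have "sum_mset P = n * c" using total c by simp
    ultimately show "(\<forall>i\<in>{1..<n}. residue_count n P i = residue_count n P (2*n - i)) \<and> sum_mset P = n * c"
      by blast
  next
    assume r: "(\<forall>i\<in>{1..<n}. residue_count n P i = residue_count n P (2*n - i)) \<and> sum_mset P = n * c"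
    have eq: "?c i = ?c 1" if "1 \<le> i" "i \<le> n" for i
      using that
    proof (induction i rule: nat_induct_at_least)
      case (Suc i)
      then show ?case using step[of i] r by auto
    qed simp
    then have "(\<Sum>i\<in>{1..n}. ?c i) = (\<Sum>i\<in>{1..n}. ?c 1)" by (intro sum.cong refl eq) simp_all
    then have "n * ?c 1 = n * c" using total r by simp
    then have "?c 1 = c" using n by simp
    then show "\<forall>i\<in>{1..n}. ?c i = c" using eq by (metis atLeastAtMost_iff)
  qed
qed

section \<open>Bead moves\<close>

lemma wall_of_beads:
  assumes n: "3 \<le> n" and Y: "Y \<in> proper_young_walls n"
  shows "bead_list n (colored_list_of (beads Y))" and "wall_of n (colored_list_of (beads Y)) = Y"
    and "bead_multiset n (beads Y)" and "card (nonempty_columns Y) = size (beads Y)"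
proof -
  obtain L where L: "bead_list n L" "Y = wall_of n L" using ex_wall_of[OF n Y] by blast
  have "colored_list_of (beads Y) = L"
    using L beads_wall_of[OF n L(1)] colored_list_of_mset by (simp add: bead_list_def)
  then show "bead_list n (colored_list_of (beads Y))" and "wall_of n (colored_list_of (beads Y)) = Y"
    using L by auto
  show "bead_multiset n (beads Y)" "card (nonempty_columns Y) = size (beads Y)"
    using L beads_wall_of[OF n L(1)] by (auto simp: bead_list_def)
qed

lemma bead_list_colored_list_of:
  assumes "bead_multiset n M"
  shows "bead_list n (colored_list_of M)" and "mset (colored_list_of M) = M"
proof -
  have c: "colored_multiset M" using assms by (simp add: bead_multiset_def)
  show "mset (colored_list_of M) = M" by (rule mset_colored_list_of[OF c])
  then show "bead_list n (colored_list_of M)"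
    using colored_partition_colored_list_of[OF c] assms by (simp add: bead_list_def)
qed

lemma filter_mset_eq_empty_iff: "filter_mset Q P = {#} \<longleftrightarrow> (\<forall>x\<in>#P. \<not> Q x)"
  by (induction P) auto

definition flip_if :: "bool \<Rightarrow> shade \<Rightarrow> shade" where
  "flip_if b c = (if b then flip_shade c else c)"

lemma flip_shade_flip_shade [simp]: "flip_shade (flip_shade c) = c"
  by (cases c) auto

lemma flip_if_flip_if [simp]: "flip_if a (flip_if b c) = flip_if (a \<noteq> b) c"
  by (auto simp: flip_if_def)

lemma flip_if_False [simp]: "flip_if False c = c"
  by (simp add: flip_if_def)

lemma flip_if_inject [simp]: "flip_if b c = flip_if b d \<longleftrightarrow> c = d"
  by (metis flip_if_flip_if flip_if_False)

definition positions_above :: "nat \<Rightarrow> nat multiset \<Rightarrow> nat \<Rightarrow> nat" where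
  "positions_above n P p = size (filter_mset (\<lambda>q. p < q \<and> \<not> 2*n dvd q) P)"

text \<open>The shades that the beads of \<open>R\<^sub>2\<^sub>n\<close> have after all moves: every bead outside \<open>R\<^sub>2\<^sub>n\<close> that starts above
  such a bead passes it exactly once on its way down and flips it.\<close>

definition settle :: "nat \<Rightarrow> (nat \<times> shade) multiset \<Rightarrow> (nat \<times> shade) multiset" where
  "settle n M = image_mset (\<lambda>x. (fst x, flip_if (odd (positions_above n (image_mset fst M) (fst x))) (snd x)))
     (filter_mset (\<lambda>x. 2*n dvd fst x) M)"

text \<open>The part of the weight condition that controls the bead moves and is preserved by them.\<close>

definition balanced_beads :: "nat \<Rightarrow> (nat \<times> shade) multiset \<Rightarrow> bool" where
  "balanced_beads n M \<longleftrightarrow> (\<forall>x\<in>#M. 0 < fst x \<and> (\<not> 2*n dvd fst x \<longrightarrow> snd x = White)) \<and>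
     (\<forall>i\<in>{1..<n}. residue_count n (image_mset fst M) i = residue_count n (image_mset fst M) (2*n - i)) \<and>
     odd (residue_count n (image_mset fst M) n)"

lemma balanced_beadsD:
  assumes "balanced_beads n M" "(p, c) \<in># M"
  shows "0 < p" and "\<not> 2*n dvd p \<Longrightarrow> c = White"
proof -
  have "\<forall>x\<in>#M. 0 < fst x \<and> (\<not> 2*n dvd fst x \<longrightarrow> snd x = White)"
    using assms(1) by (simp add: balanced_beads_def)
  from bspec[OF this assms(2)] show "0 < p" and "\<not> 2*n dvd p \<Longrightarrow> c = White" by auto
qed

text \<open>Exactly one multiple of \<open>2n\<close> lies between \<open>s - 2n\<close> and \<open>s\<close>. The beads there are flipped once, and the
  number of foreign beads above them drops by one, so their settled shades do not change.\<close>

lemma move_bead: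
  assumes n: "3 \<le> n" and M: "balanced_beads n M" and s: "\<not> 2*n dvd s" "2*n < s" "(s, c) \<in># M"
    and M': "M' = switch_between n (s - 2*n) s (add_mset (s - 2*n, c) (M - {#(s, c)#}))"
  shows "balanced_beads n M' \<and> settle n M' = settle n M \<and>
    sum_mset (image_mset fst M') < sum_mset (image_mset fst M)"
proof -
  define R where "R = M - {#(s, c)#}"
  have MR: "M = add_mset (s, c) R" using s(3) by (simp add: R_def)
  define sw :: "nat \<times> shade \<Rightarrow> nat \<times> shade" where
    "sw = (\<lambda>(p, c). if p \<in> runner n (2*n) \<and> s - 2*n < p \<and> p < s then (p, flip_shade c) else (p, c))"
  have sw: "sw x = (fst x, flip_if (0 < fst x \<and> 2*n dvd fst x \<and> s - 2*n < fst x \<and> fst x < s) (snd x))" for x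
    by (cases x) (auto simp: sw_def runner_def flip_if_def dvd_eq_mod_eq_0)
  have M'R: "M' = image_mset sw (add_mset (s - 2*n, c) R)"
    by (simp add: M' switch_between_def R_def sw_def)
  have fst': "image_mset fst M' = add_mset (s - 2*n) (image_mset fst R)"
    by (simp add: M'R multiset.map_comp comp_def sw)
  have nd: "\<not> 2*n dvd s - 2*n" using s by (auto simp: dvd_minus_self)
  have mod: "(s - 2*n) mod (2*n) = s mod (2*n)" using s(2) by (simp add: le_mod_geq)
  have rc: "residue_count n (image_mset fst M') i = residue_count n (image_mset fst M) i" for i
    by (simp add: fst' MR residue_count_def mod)
  have "0 < fst x \<and> (\<not> 2*n dvd fst x \<longrightarrow> snd x = White)" if "x \<in># M'" for x
  proof -
    obtain y where y: "x = sw y" "y = (s - 2*n, c) \<or> y \<in># R" using \<open>x \<in># M'\<close> unfolding M'R by auto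
    have "fst (s, c) > 0 \<and> (\<not> 2*n dvd fst (s, c) \<longrightarrow> snd (s, c) = White)"
      using M s(3) unfolding balanced_beads_def by blast
    then have "c = White" using s(1) by simp
    have "y \<in># M" if "y \<in># R" using that by (simp add: MR)
    then have "0 < fst y \<and> (\<not> 2*n dvd fst y \<longrightarrow> snd y = White)"
    proof (cases "y = (s - 2*n, c)")
      case True
      then show ?thesis using \<open>c = White\<close> s(2) by simp
    next
      case False
      then show ?thesis using y(2) \<open>y \<in># R \<Longrightarrow> y \<in># M\<close> M unfolding balanced_beads_def by blast
    qed
    then show ?thesis by (simp add: y(1) sw)
  qed
  then have bal: "balanced_beads n M'" using M unfolding balanced_beads_def rc by blast
  have ab: "positions_above n (image_mset fst M) p = positions_above n (image_mset fst R) p + of_bool (p < s)"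
    "positions_above n (image_mset fst M') p = positions_above n (image_mset fst R) p + of_bool (p < s - 2*n)" for p
    using s nd by (auto simp: positions_above_def fst' MR)
  have "settle n M' = image_mset (\<lambda>x. (fst x, flip_if (odd (positions_above n (image_mset fst M') (fst x)))
      (flip_if (s - 2*n < fst x \<and> fst x < s) (snd x)))) (filter_mset (\<lambda>x. 2*n dvd fst x) R)"
  proof -
    have "filter_mset (\<lambda>x. 2*n dvd fst x) M' = image_mset sw (filter_mset (\<lambda>x. 2*n dvd fst x) R)"
      using nd by (simp add: M'R filter_mset_image_mset sw)
    moreover have "0 < fst x" if "x \<in># R" for x using M that by (auto simp: balanced_beads_def MR)
    ultimately show ?thesis
      unfolding settle_def by (simp add: multiset.map_comp comp_def) (rule image_mset_cong, auto simp: sw)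
  qed
  also have "\<dots> = image_mset (\<lambda>x. (fst x, flip_if (odd (positions_above n (image_mset fst M) (fst x))) (snd x)))
      (filter_mset (\<lambda>x. 2*n dvd fst x) R)"
  proof (rule image_mset_cong)
    fix x assume "x \<in># filter_mset (\<lambda>x. 2*n dvd fst x) R"
    then have "fst x \<noteq> s - 2*n" using nd by auto
    then have "(odd (positions_above n (image_mset fst M') (fst x)) \<noteq> (s - 2*n < fst x \<and> fst x < s)) =
        odd (positions_above n (image_mset fst M) (fst x))"
      unfolding ab by (cases "fst x < s"; cases "fst x < s - 2*n") auto
    then show "(fst x, flip_if (odd (positions_above n (image_mset fst M') (fst x)))
        (flip_if (s - 2*n < fst x \<and> fst x < s) (snd x))) =
      (fst x, flip_if (odd (positions_above n (image_mset fst M) (fst x))) (snd x))"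
      by (simp only: flip_if_flip_if)
  qed
  also have "\<dots> = settle n M" using s(1) by (simp add: settle_def MR)
  finally have "settle n M' = settle n M" .
  moreover have "sum_mset (image_mset fst M') < sum_mset (image_mset fst M)"
    using s(2) n by (simp only: fst') (simp add: MR)
  ultimately show ?thesis using bal by blast
qed

text \<open>All beads of \<open>R\<^sub>2\<^sub>n\<close> are at position \<open>2n\<close> or higher, so beads below \<open>2n\<close> have no influence on their
  settled shades.\<close>

lemma remove_low_beads:
  assumes n: "3 \<le> n" and M: "balanced_beads n M" "M = D + M'" "D \<noteq> {#}"
    and D: "\<And>x. x \<in># D \<Longrightarrow> fst x < 2*n"
    and bal: "\<And>i. i \<in> {1..<n} \<Longrightarrow> residue_count n (image_mset fst D) i = residue_count n (image_mset fst D) (2*n - i)"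
      "even (residue_count n (image_mset fst D) n)"
  shows "balanced_beads n M' \<and> settle n M' = settle n M \<and>
    sum_mset (image_mset fst M') < sum_mset (image_mset fst M)"
proof -
  have rc: "residue_count n (image_mset fst M) i =
      residue_count n (image_mset fst D) i + residue_count n (image_mset fst M') i" for i
    by (simp add: M(2) residue_count_def)
  have pos: "0 < fst x" if "x \<in># M" for x using M(1) that by (auto simp: balanced_beads_def)
  have bal': "balanced_beads n M'"
    using M(1) bal unfolding balanced_beads_def rc by (auto simp: M(2))
  have "sum_mset (image_mset fst D) \<noteq> 0"
  proof -
    obtain x where "x \<in># D" using M(3) by (rule multiset_nonemptyE)
    moreover from this have "fst x \<noteq> 0" using pos[of x] by (simp add: M(2))
    moreover obtain D' where "D = add_mset x D'" using \<open>x \<in># D\<close> by (metis insert_DiffM)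
    ultimately show ?thesis by simp
  qed
  moreover have "sum_mset (image_mset fst M) = sum_mset (image_mset fst D) + sum_mset (image_mset fst M')"
    by (simp add: M(2))
  ultimately have "sum_mset (image_mset fst M') < sum_mset (image_mset fst M)" by linarith
  moreover have "settle n M' = settle n M"
  proof -
    have big: "2*n \<le> fst x" if "x \<in># M" "2*n dvd fst x" for x
      using pos[OF that(1)] that(2) by (simp add: dvd_imp_le)
    have "filter_mset (\<lambda>x. 2*n dvd fst x) D = {#}"
      using D big M(2) by (fastforce simp: filter_mset_eq_empty_iff)
    then have fil: "filter_mset (\<lambda>x. 2*n dvd fst x) M = filter_mset (\<lambda>x. 2*n dvd fst x) M'"
      by (simp add: M(2))
    have "positions_above n (image_mset fst M) p = positions_above n (image_mset fst M') p" if "2*n \<le> p" for p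
    proof -
      have "filter_mset (\<lambda>q. p < q \<and> \<not> 2*n dvd q) (image_mset fst D) = {#}"
        using D that by (fastforce simp: filter_mset_eq_empty_iff)
      then show ?thesis by (simp add: positions_above_def M(2))
    qed
    then show ?thesis unfolding settle_def fil by (intro image_mset_cong) (use big M(2) in auto)
  qed
  ultimately show ?thesis using bal' by blast
qed

lemma bead_step_invariant:
  assumes n: "3 \<le> n" and M: "balanced_beads n M" and step: "bead_step n M M'"
  shows "balanced_beads n M' \<and> settle n M' = settle n M \<and>
    sum_mset (image_mset fst M') < sum_mset (image_mset fst M)"
  using step
proof cases
  case (B1 k s c)
  then have "\<not> 2*n dvd s"
    by (auto simp: runner_def runner_type_I_def dvd_eq_mod_eq_0)
  then show ?thesis using move_bead[OF n M] B1 by blast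
next
  case (B2 s c)
  then have "\<not> 2*n dvd s" using n by (auto simp: runner_def dvd_eq_mod_eq_0)
  then show ?thesis using move_bead[OF n M] B2 by blast
next
  case (B3 s c d)
  let ?D = "{#(s, c), (2*n - s, d)#}"
  have ne: "s \<noteq> 2*n - s" using B3(2,3) n by auto
  then have "(2*n - s, d) \<in># M - {#(s, c)#}" using B3(5) ne by (simp add: in_diff_count)
  then have "?D \<subseteq># M" using B3(4) by (simp add: insert_subset_eq_iff)
  then have "M = ?D + M'" unfolding B3(1) by (rule subset_mset.add_diff_inverse[symmetric])
  then show ?thesis
  proof (rule remove_low_beads[OF n M])
    show "residue_count n (image_mset fst ?D) i = residue_count n (image_mset fst ?D) (2*n - i)"
      if "i \<in> {1..<n}" for i
      using that B3(2,3) by (auto simp: residue_count_def)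
    show "even (residue_count n (image_mset fst ?D) n)" using B3(2,3) by (auto simp: residue_count_def)
  qed (use B3(2,3) n in auto)
next
  case (B5 c d)
  have "M = {#(n, c), (n, d)#} + M'"
    unfolding B5(1) by (rule subset_mset.add_diff_inverse[OF B5(2), symmetric])
  then show ?thesis
    by (rule remove_low_beads[OF n M]) (use n in \<open>auto simp: residue_count_def\<close>)
qed

lemma bead_steps_invariant:
  assumes n: "3 \<le> n" and M: "balanced_beads n M" and step: "(bead_step n)\<^sup>*\<^sup>* M M'"
  shows "balanced_beads n M' \<and> settle n M' = settle n M"
  using step by (induction rule: rtranclp_induct) (use M bead_step_invariant[OF n] in auto)

text \<open>Every step decreases the sum of the positions.\<close>

lemma ex_bead_normal_form:
  assumes n: "3 \<le> n" and M: "balanced_beads n M"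
  shows "\<exists>N. (bead_step n)\<^sup>*\<^sup>* M N \<and> \<not> (\<exists>N'. bead_step n N N')"
  using M
proof (induction "sum_mset (image_mset fst M)" arbitrary: M rule: less_induct)
  case less
  show ?case
  proof (cases "\<exists>M'. bead_step n M M'")
    case True
    then obtain M' where M': "bead_step n M M'" by blast
    with bead_step_invariant[OF n less.prems M'] less.hyps[of M'] show ?thesis
      by (meson converse_rtranclp_into_rtranclp)
  qed auto
qed

text \<open>In a runner of type I, the lowest bead can be moved unless it is at the bottom. If one of two
  opposite runners were nonempty, both would be, and their lowest beads could be removed by \<open>B3\<close>. In
  the runner \<open>R\<^sub>n\<close> all beads have come down to \<open>n\<close>; their number is odd and less than two. So the settled beads and one
  bead at \<open>n\<close> remain.\<close>

lemma normal_form_eq: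
  assumes n: "3 \<le> n" and M: "balanced_beads n M" and terminal: "\<not> (\<exists>N. bead_step n M N)"
  shows "M = add_mset (n, White) (settle n M)"
proof -
  note pos = balanced_beadsD(1)[OF M] and white = balanced_beadsD(2)[OF M]
  have bottom: "\<exists>c. (k, c) \<in># M" if k: "1 \<le> k" "k < 2*n" "k \<noteq> n" and ex: "\<exists>s c. (s, c) \<in># M \<and> s mod (2*n) = k" for k
  proof -
    define s where "s = (LEAST s. \<exists>c. (s, c) \<in># M \<and> s mod (2*n) = k)"
    obtain c where c: "(s, c) \<in># M" "s mod (2*n) = k" using LeastI_ex[OF ex] unfolding s_def by blast
    \<comment> \<open>the bead at \<open>s\<close> is the lowest of its runner, so only the bottom can block its move\<close>
    have min: "(t, d) \<notin># M" if "t < s" "t mod (2*n) = k" for t d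
      using not_less_Least[OF that(1)[unfolded s_def]] that(2) by blast
    have "\<not> 2*n < s"
    proof
      assume s: "2*n < s"
      have "\<forall>d. (s - 2*n, d) \<notin># M" using min[of "s - 2*n"] s n c(2) by (simp add: le_mod_geq)
      moreover have "s \<in> runner n k" using s k c(2) by (simp add: runner_def)
      moreover have "runner_type_I n k" using k by (simp add: runner_type_I_def)
      ultimately show False using terminal s c(1) bead_step.B1 by blast
    qed
    moreover have "s \<noteq> 2*n" using c(2) k(1) by auto
    ultimately have "s = k" using c(2) by simp
    then show ?thesis using c(1) by blast
  qed
  have ex_iff: "residue_count n (image_mset fst M) k \<noteq> 0 \<longleftrightarrow> (\<exists>s c. (s, c) \<in># M \<and> s mod (2*n) = k)" for k
    by (auto simp: residue_count_def filter_mset_eq_empty_iff) force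
  have none: "residue_count n (image_mset fst M) k = 0" if k: "1 \<le> k" "k < n" for k
  proof (rule ccontr)
    assume a: "residue_count n (image_mset fst M) k \<noteq> 0"
    moreover have "residue_count n (image_mset fst M) k = residue_count n (image_mset fst M) (2*n - k)"
      using M k unfolding balanced_beads_def by simp
    ultimately have "\<exists>c. (k, c) \<in># M" "\<exists>c. (2*n - k, c) \<in># M"
      using bottom[of k] bottom[of "2*n - k"] k ex_iff[of k] ex_iff[of "2*n - k"] by auto
    then obtain c d where "(k, c) \<in># M" "(2*n - k, d) \<in># M" by blast
    moreover have "k \<le> n - 1" using k by simp
    ultimately show False using terminal bead_step.B3[OF k(1)] by blast
  qed
  have resid: "p mod (2*n) = 0 \<or> p = n" if p: "(p, c) \<in># M" for p c
  proof -
    let ?k = "p mod (2*n)"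
    have l: "?k < 2*n" using n by simp
    have "residue_count n (image_mset fst M) ?k \<noteq> 0" using p ex_iff by blast
    then have "?k = 0 \<or> ?k = n"
    proof (cases "?k < n")
      case True
      then show ?thesis using none[of ?k] \<open>residue_count n (image_mset fst M) ?k \<noteq> 0\<close> by (cases "?k = 0") auto
    next
      case False
      have "residue_count n (image_mset fst M) (2*n - ?k) = residue_count n (image_mset fst M) (2*n - (2*n - ?k))"
        if "n < ?k"
      proof -
        have "2*n - ?k \<in> {1..<n}" using l that by auto
        then show ?thesis using M unfolding balanced_beads_def by blast
      qed
      moreover have "2*n - (2*n - ?k) = ?k" using l by simp
      ultimately have "\<not> n < ?k"
        using none[of "2*n - ?k"] l \<open>residue_count n (image_mset fst M) ?k \<noteq> 0\<close> by auto
      then show ?thesis using False by simp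
    qed
    moreover have "p = n" if "?k = n"
    proof -
      have "\<not> 2*n < p" using bead_step.B2[of p n c M] p that n terminal by (auto simp: runner_def)
      moreover have "p \<noteq> 2*n" using that n by auto
      ultimately show ?thesis using that by simp
    qed
    ultimately show ?thesis by blast
  qed
  have "filter_mset (\<lambda>x. \<not> 2*n dvd fst x) M = {#(n, White)#}"
  proof -
    let ?F = "filter_mset (\<lambda>x. \<not> 2*n dvd fst x) M"
    have "x = (n, White)" if "x \<in># ?F" for x
      using that resid[of "fst x" "snd x"] white[of "fst x" "snd x"] by (auto simp: prod_eq_iff)
    then obtain k where k: "?F = replicate_mset k (n, White)"
      by (metis set_mset_subset_singletonD subsetI singletonI)
    have "residue_count n (image_mset fst M) n = size ?F"
    proof -
      have nn: "n mod (2*n) = n" using n by simp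
      have "filter_mset (\<lambda>x. fst x mod (2*n) = n) M = ?F"
        by (rule filter_mset_cong) (use resid n nn in \<open>auto simp: dvd_eq_mod_eq_0\<close>, fastforce)
      then show ?thesis by (simp add: residue_count_def filter_mset_image_mset)
    qed
    then have "odd k" using M k by (simp add: balanced_beads_def)
    moreover have "\<not> 2 \<le> k"
    proof
      assume "2 \<le> k"
      then have "{#(n, White), (n, White)#} \<subseteq># replicate_mset k (n, White)"
        by (simp add: numeral_2_eq_2 flip: replicate_mset_Suc) (metis Suc_le_D replicate_mset_Suc mset_subset_eq_add_mset_cancel empty_le Suc_le_mono)
      then have "{#(n, White), (n, White)#} \<subseteq># M" using k by (metis multiset_filter_subset subset_mset.order_trans)
      then show False using terminal bead_step.B5 by blast
    qed
    ultimately have "k = 1" by (cases k) auto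
    then show ?thesis using k by simp
  qed
  moreover have "settle n M = filter_mset (\<lambda>x. 2*n dvd fst x) M"
  proof -
    have "positions_above n (image_mset fst M) p = 0" if "2*n \<le> p" for p
      using resid that by (fastforce simp: positions_above_def filter_mset_eq_empty_iff dvd_eq_mod_eq_0)
    moreover have "2*n \<le> fst x" if "x \<in># filter_mset (\<lambda>x. 2*n dvd fst x) M" for x
      using that pos[of "fst x" "snd x"] by (auto dest: dvd_imp_le)
    ultimately have "settle n M = image_mset (\<lambda>x. x) (filter_mset (\<lambda>x. 2*n dvd fst x) M)"
      unfolding settle_def by (intro image_mset_cong) simp
    then show ?thesis by simp
  qed
  ultimately show ?thesis
    using multiset_partition[of M "\<lambda>x. 2*n dvd fst x"] by simp
qed

lemma bead_multiset_settle:
  assumes n: "3 \<le> n" and M: "bead_multiset n M"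
  shows "bead_multiset n (add_mset (n, White) (settle n M))"
proof -
  have nd: "\<not> 2*n dvd n" using n by (auto dest: dvd_imp_le)
  have S: "\<exists>d. (k, d) \<in># M \<and> c = flip_if (odd (positions_above n (image_mset fst M) k)) d \<and> 2*n dvd k"
    if "(k, c) \<in># settle n M" for k c
    using that by (auto simp: settle_def)
  have "colored_multiset (add_mset (n, White) (settle n M))"
    unfolding colored_multiset_def
  proof (intro conjI allI notI ballI)
    fix x assume "x \<in># add_mset (n, White) (settle n M)"
    then have "fst x = n \<or> (\<exists>d. (fst x, d) \<in># M)" using S[of "fst x" "snd x"] by auto
    moreover have "0 < k" if "(k, d) \<in># M" for k d
      using M that unfolding bead_multiset_def colored_multiset_def by blast
    ultimately show "case x of (k, c) \<Rightarrow> 0 < k" using n by (auto simp: case_prod_beta)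
  next
    fix k assume "(k, White) \<in># add_mset (n, White) (settle n M) \<and> (k, Gray) \<in># add_mset (n, White) (settle n M)"
    then have g: "(k, Gray) \<in># settle n M" and w: "k = n \<or> (k, White) \<in># settle n M" by auto
    have "k \<noteq> n" using S[OF g] nd by auto
    then obtain d d' where d: "(k, d) \<in># M" "(k, d') \<in># M" "d \<noteq> d'"
      using S[OF g] S[of k White] w by (metis shade.distinct(1))
    then show False using M unfolding bead_multiset_def colored_multiset_def by (metis (full_types) shade.exhaust)
  qed
  moreover have "2*n dvd fst x" if "x \<in># add_mset (n, White) (settle n M)" "snd x = Gray" for x
    using that S[of "fst x" "snd x"] by (cases x) auto
  moreover have "count (image_mset fst (add_mset (n, White) (settle n M))) p \<le> 1" if "\<not> n dvd p" for p
  proof -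
    have "p \<notin># image_mset fst (add_mset (n, White) (settle n M))"
    proof
      assume "p \<in># image_mset fst (add_mset (n, White) (settle n M))"
      then have "p = n \<or> (\<exists>c. (p, c) \<in># settle n M)" by force
      then have "p = n \<or> 2*n dvd p" using S by blast
      then show False using that by (auto dest: dvd_mult_right)
    qed
    then show ?thesis by (metis not_in_iff zero_le)
  qed
  ultimately show ?thesis by (simp add: bead_multiset_def)
qed

text \<open>Settled shades are invariant and determine the normal form, so the result of the moves depends
  neither on their order nor on any choice.\<close>

lemma beads_tilde:
  assumes n: "3 \<le> n" and Y: "Y \<in> proper_young_walls n" and bal: "balanced_beads n (beads Y)"
  shows "tilde n Y \<in> proper_young_walls n"
    and "beads (tilde n Y) = add_mset (n, White) (settle n (beads Y))"
proof -
  let ?N = "add_mset (n, White) (settle n (beads Y))"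
  let ?P = "\<lambda>Z. Z \<in> proper_young_walls n \<and> (bead_step n)\<^sup>*\<^sup>* (beads Y) (beads Z) \<and>
     \<not> (\<exists>M. bead_step n (beads Z) M)"
  have nf: "N = ?N" if "(bead_step n)\<^sup>*\<^sup>* (beads Y) N" "\<not> (\<exists>N'. bead_step n N N')" for N
    using bead_steps_invariant[OF n bal that(1)] normal_form_eq[OF n _ that(2)] by metis
  obtain N where N: "(bead_step n)\<^sup>*\<^sup>* (beads Y) N" "\<not> (\<exists>N'. bead_step n N N')"
    using ex_bead_normal_form[OF n bal] by blast
  note bm = bead_multiset_settle[OF n wall_of_beads(3)[OF n Y]]
  define Z where "Z = wall_of n (colored_list_of ?N)"
  have Z: "Z \<in> proper_young_walls n" "beads Z = ?N"
    using bead_list_colored_list_of[OF bm] wall_of_proper[OF n] beads_wall_of(1)[OF n] by (auto simp: Z_def)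
  have "?P Z" using Z N nf[OF N] by simp
  moreover have "Z' = Z" if "?P Z'" for Z'
  proof -
    have "beads Z' = ?N" using nf that by blast
    then show ?thesis using wall_of_beads(2)[OF n] that Z_def by metis
  qed
  ultimately have "tilde n Y = Z" unfolding tilde_def by (rule the_equality)
  then show "tilde n Y \<in> proper_young_walls n" "beads (tilde n Y) = ?N" using Z by auto
qed

section \<open>The colored partition of the settled beads\<close>

lemma count_image_mset_inj:
  assumes "inj g"
  shows "count (image_mset g M) (g x) = count M x"
  by (induction M) (use assms in \<open>auto dest: injD\<close>)

text \<open>The colored partition \<open>\<mu>\<close> as a multiset. The reduced wall has one column more than there are settled
  beads; so its number of columns is even, and white and gray are exchanged, if there is an odd number
  of settled beads.\<close>

definition reduce :: "nat \<Rightarrow> (nat \<times> shade) multiset \<Rightarrow> (nat \<times> shade) multiset" where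
  "reduce n M = image_mset (\<lambda>x. (fst x div (2*n), flip_if (odd (size (settle n M))) (snd x))) (settle n M)"

text \<open>The inverse of splitting a configuration into the positions \<open>N\<close> outside \<open>R\<^sub>2\<^sub>n\<close> and the colored partition
  \<open>U\<close>: all flips that lead from the beads of \<open>R\<^sub>2\<^sub>n\<close> to \<open>U\<close> are determined by \<open>N\<close> and by the size of \<open>U\<close>,
  and a flip is its own inverse.\<close>

definition assemble :: "nat \<Rightarrow> nat multiset \<Rightarrow> (nat \<times> shade) multiset \<Rightarrow> (nat \<times> shade) multiset" where
  "assemble n N U = image_mset (\<lambda>p. (p, White)) N +
     image_mset (\<lambda>x. (fst x * (2*n),
       flip_if (odd (positions_above n N (fst x * (2*n))) \<noteq> odd (size U)) (snd x))) U"

abbreviation free_positions :: "nat \<Rightarrow> nat multiset \<Rightarrow> nat multiset" where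
  "free_positions n P \<equiv> filter_mset (\<lambda>p. \<not> 2*n dvd p) P"

lemma positions_above_free:
  "positions_above n (free_positions n P) p = positions_above n P p"
  unfolding positions_above_def filter_filter_mset
  by (intro arg_cong[where f = size] filter_mset_cong) auto

lemma image_settle:
  "image_mset f (settle n M) = image_mset
    (\<lambda>x. f (fst x, flip_if (odd (positions_above n (image_mset fst M) (fst x))) (snd x)))
    (filter_mset (\<lambda>x. 2*n dvd fst x) M)"
  by (simp add: settle_def multiset.map_comp comp_def)

lemma settle_dvd: "x \<in># settle n M \<Longrightarrow> 2*n dvd fst x"
  by (auto simp: settle_def)

lemma settle_eq_image_reduce:
  "settle n M = image_mset (\<lambda>x. (fst x * (2*n), flip_if (odd (size (settle n M))) (snd x))) (reduce n M)"
proof -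
  have "image_mset (\<lambda>x. (fst x * (2*n), flip_if (odd (size (settle n M))) (snd x))) (reduce n M) =
      image_mset (\<lambda>x. x) (settle n M)"
    unfolding reduce_def multiset.map_comp comp_def
    by (rule image_mset_cong) (use settle_dvd in \<open>auto simp: prod_eq_iff\<close>)
  then show ?thesis by simp
qed

lemma size_reduce: "size (reduce n M) = size (settle n M)"
  by (simp add: reduce_def)

lemma assemble_reduce:
  assumes n: "3 \<le> n" and M: "bead_multiset n M"
  shows "assemble n (free_positions n (image_mset fst M)) (reduce n M) = M"
proof -
  let ?N = "free_positions n (image_mset fst M)"
  have "image_mset (\<lambda>p. (p, White)) ?N = image_mset (\<lambda>x. (fst x, White)) (filter_mset (\<lambda>x. \<not> 2*n dvd fst x) M)"
    by (simp add: filter_mset_image_mset multiset.map_comp comp_def)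
  also have "\<dots> = image_mset (\<lambda>x. x) (filter_mset (\<lambda>x. \<not> 2*n dvd fst x) M)"
  proof (rule image_mset_cong)
    fix x assume "x \<in># filter_mset (\<lambda>x. \<not> 2*n dvd fst x) M"
    then have "snd x \<noteq> Gray" using M unfolding bead_multiset_def by auto
    then show "(fst x, White) = x" by (cases x; cases "snd x") auto
  qed
  finally have 1: "image_mset (\<lambda>p. (p, White)) ?N = filter_mset (\<lambda>x. \<not> 2*n dvd fst x) M" by simp
  have "image_mset (\<lambda>x. (fst x * (2*n),
       flip_if (odd (positions_above n ?N (fst x * (2*n))) \<noteq> odd (size (reduce n M))) (snd x))) (reduce n M) =
     image_mset (\<lambda>x. x) (filter_mset (\<lambda>x. 2*n dvd fst x) M)"
    unfolding size_reduce unfolding reduce_def settle_def multiset.map_comp comp_def positions_above_free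
    by (rule image_mset_cong) (auto simp: flip_if_def simp del: flip_if_flip_if)
  then have 2: "image_mset (\<lambda>x. (fst x * (2*n),
       flip_if (odd (positions_above n ?N (fst x * (2*n))) \<noteq> odd (size (reduce n M))) (snd x))) (reduce n M) =
     filter_mset (\<lambda>x. 2*n dvd fst x) M" by simp
  show ?thesis
    unfolding assemble_def 1 2 using multiset_partition[of M "\<lambda>x. 2*n dvd fst x"] by simp
qed

lemma positions_assemble:
  "image_mset fst (assemble n N U) = N + image_mset (\<lambda>x. fst x * (2*n)) U"
  by (simp add: assemble_def multiset.map_comp comp_def)

lemma assemble_properties:
  assumes n: "3 \<le> n" and N: "\<And>p. p \<in># N \<Longrightarrow> \<not> 2*n dvd p"
  shows "free_positions n (image_mset fst (assemble n N U)) = N"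
    and "reduce n (assemble n N U) = U"
proof -
  let ?M = "assemble n N U"
  have "filter_mset (\<lambda>p. \<not> 2*n dvd p) N = N" by (simp add: filter_mset_eq_conv N)
  then show free: "free_positions n (image_mset fst ?M) = N"
    by (simp add: positions_assemble filter_mset_image_mset)
  have "filter_mset (\<lambda>x. 2*n dvd fst x) ?M = image_mset (\<lambda>x. (fst x * (2*n),
       flip_if (odd (positions_above n N (fst x * (2*n))) \<noteq> odd (size U)) (snd x))) U"
    using N by (simp add: assemble_def filter_mset_image_mset filter_mset_eq_empty_iff)
  then have "settle n ?M = image_mset (\<lambda>x. (fst x * (2*n), flip_if (odd (size U)) (snd x))) U"
    unfolding settle_def positions_above_free[of n "image_mset fst ?M", symmetric] free
    by (simp add: multiset.map_comp comp_def del: flip_if_flip_if)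
      (rule image_mset_cong, auto simp: flip_if_def)
  then show "reduce n ?M = U"
    using n by (simp add: reduce_def multiset.map_comp comp_def)
qed

lemma bead_multiset_assemble:
  assumes n: "3 \<le> n" and N: "\<And>p. p \<in># N \<Longrightarrow> \<not> 2*n dvd p" and U: "colored_multiset U"
    and c: "\<And>p. \<not> n dvd p \<Longrightarrow> count N p \<le> 1"
  shows "bead_multiset n (assemble n N U)"
proof -
  let ?M = "assemble n N U"
  have mem: "p \<in># N \<and> d = White \<or> (\<exists>k c. p = k * (2*n) \<and> (k, c) \<in># U \<and>
      d = flip_if (odd (positions_above n N p) \<noteq> odd (size U)) c)" if "(p, d) \<in># ?M" for p d
    using that by (auto simp: assemble_def)
  have "colored_multiset ?M"
    unfolding colored_multiset_def
  proof (intro conjI allI notI ballI)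
    fix x assume "x \<in># ?M"
    then consider "fst x \<in># N" | k c where "fst x = k * (2*n)" "(k, c) \<in># U" using mem[of "fst x" "snd x"] by auto
    then have "0 < fst x"
    proof cases
      case 1
      then show ?thesis using N[OF 1] by (intro gr0I) auto
    next
      case (2 k c)
      then have "0 < k" using U unfolding colored_multiset_def by blast
      then show ?thesis using 2 n by simp
    qed
    then show "case x of (k, c) \<Rightarrow> 0 < k" by (simp add: case_prod_beta)
  next
    fix p assume a: "(p, White) \<in># ?M \<and> (p, Gray) \<in># ?M"
    then obtain k c where k: "p = k * (2*n)" "(k, c) \<in># U"
        "Gray = flip_if (odd (positions_above n N p) \<noteq> odd (size U)) c"
      using mem[of p Gray] by auto
    then have "2*n dvd p" by simp
    then obtain k' c' where k': "p = k' * (2*n)" "(k', c') \<in># U"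
        "White = flip_if (odd (positions_above n N p) \<noteq> odd (size U)) c'"
      using mem[of p White] a N by blast
    have "k = k'" using k(1) k'(1) n by simp
    moreover have "c \<noteq> c'" using k(3) k'(3) by auto
    ultimately show False using U k(2) k'(2) unfolding colored_multiset_def by (metis (full_types) shade.exhaust)
  qed
  moreover have "2*n dvd fst x" if "x \<in># ?M" "snd x = Gray" for x
    using that mem[of "fst x" "snd x"] by (cases x) auto
  moreover have "count (image_mset fst ?M) p \<le> 1" if p: "\<not> n dvd p" for p
  proof -
    have "p \<notin># image_mset (\<lambda>x. fst x * (2*n)) U" using p by auto
    then have "count (image_mset (\<lambda>x. fst x * (2*n)) U) p = 0" by (rule not_in_iff[THEN iffD1])
    then show ?thesis using c[OF p] unfolding positions_assemble by simp
  qed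
  ultimately show ?thesis by (simp add: bead_multiset_def)
qed

lemma colored_multiset_reduce:
  assumes n: "3 \<le> n" and M: "bead_multiset n M"
  shows "colored_multiset (reduce n M)"
proof -
  have S: "colored_multiset (settle n M)"
    using bead_multiset_settle[OF n M] unfolding bead_multiset_def colored_multiset_def by auto
  have mem: "(k * (2*n), flip_if (odd (size (settle n M))) c) \<in># settle n M" if "(k, c) \<in># reduce n M" for k c
    using that by (subst settle_eq_image_reduce) force
  show ?thesis
    unfolding colored_multiset_def
  proof (intro conjI allI notI ballI)
    fix x assume "x \<in># reduce n M"
    then have "(fst x * (2*n), flip_if (odd (size (settle n M))) (snd x)) \<in># settle n M" using mem by simp
    then have "0 < fst x * (2*n)" using S unfolding colored_multiset_def by blast
    then show "case x of (k, c) \<Rightarrow> 0 < k" by (simp add: case_prod_beta)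
  next
    fix k assume "(k, White) \<in># reduce n M \<and> (k, Gray) \<in># reduce n M"
    then have *: "(k * (2*n), flip_if (odd (size (settle n M))) White) \<in># settle n M"
      "(k * (2*n), flip_if (odd (size (settle n M))) Gray) \<in># settle n M" using mem by auto
    then show False using S unfolding colored_multiset_def
      by (cases "odd (size (settle n M))") (auto simp: flip_if_def)
  qed
qed

text \<open>The bead at \<open>n\<close> is invisible to \<open>colored_mu\<close>, which looks at multiples of \<open>2n\<close> only.\<close>

lemma colored_mu_eq:
  assumes n: "3 \<le> n" and M: "bead_multiset n M" and Z: "Z \<in> proper_young_walls n"
    and beads: "beads Z = add_mset (n, White) (settle n M)"
  shows "colored_mu n Z = colored_list_of (reduce n M)"
proof -
  let ?b = "odd (size (settle n M))"
  let ?g = "\<lambda>x. (fst x * (2*n), flip_if ?b (snd x))"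
  let ?U = "reduce n M"
  note U = colored_multiset_reduce[OF n M]
  have g: "inj ?g" using n by (auto simp: inj_def)
  have card: "card (nonempty_columns Z) = Suc (size (settle n M))"
    using wall_of_beads(4)[OF n Z] beads by simp
  have cnt: "count (beads Z) (k * (2*n), if odd (card (nonempty_columns Z)) then c else flip_shade c) =
      count ?U (k, c)" for k c
  proof -
    have e: "(if odd (card (nonempty_columns Z)) then c else flip_shade c) = flip_if ?b c"
      by (simp add: card flip_if_def)
    have "n \<noteq> k * (2*n)" using n by (cases k) auto
    then have "count (beads Z) (k * (2*n), flip_if ?b c) = count (settle n M) (k * (2*n), flip_if ?b c)"
      by (simp add: beads)
    also have "\<dots> = count (image_mset ?g ?U) (?g (k, c))"
      by (subst settle_eq_image_reduce) simp
    also have "\<dots> = count ?U (k, c)" by (rule count_image_mset_inj[OF g])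
    finally show ?thesis unfolding e .
  qed
  have zero: "count V (0, c) = 0" if "colored_multiset V" for V :: "(nat \<times> shade) multiset" and c
    using that by (auto simp: colored_multiset_def not_in_iff[symmetric])
  show ?thesis
    unfolding colored_mu_def cnt
  proof (rule the_equality)
    show "colored_partition (colored_list_of ?U) \<and>
      (\<forall>k\<ge>1. \<forall>c. count (mset (colored_list_of ?U)) (k, c) = count ?U (k, c))"
      using colored_partition_colored_list_of[OF U] mset_colored_list_of[OF U] by simp
    fix mu assume mu: "colored_partition mu \<and> (\<forall>k\<ge>1. \<forall>c. count (mset mu) (k, c) = count ?U (k, c))"
    then have "colored_multiset (mset mu)" by (simp add: colored_partition_iff)
    then have "count (mset mu) (k, c) = count ?U (k, c)" for k c
      using mu zero[OF U] zero[of "mset mu"] by (cases k) auto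
    then have "mset mu = ?U" by (intro multiset_eqI) (metis prod.collapse)
    then show "mu = colored_list_of ?U" using colored_list_of_mset mu by metis
  qed
qed

text \<open>A sequential form of \<open>reduce\<close>: scanning the beads from the highest one downwards, the flag records the
  parity of the flips that the next bead of \<open>R\<^sub>2\<^sub>n\<close> will undergo.\<close>

fun twist :: "nat \<Rightarrow> bool \<Rightarrow> (nat \<times> shade) list \<Rightarrow> (nat \<times> shade) list" where
  "twist n b [] = []"
| "twist n b ((p, c) # xs) =
     (if 2*n dvd p then (p div (2*n), flip_if b c) # twist n b xs else twist n (\<not> b) xs)"

lemma mset_twist:
  assumes "sorted_wrt (\<ge>) (map fst L)"
  shows "mset (twist n b L) = image_mset
    (\<lambda>x. (fst x div (2*n), flip_if (odd (positions_above n (image_mset fst (mset L)) (fst x)) \<noteq> b) (snd x)))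
    (filter_mset (\<lambda>x. 2*n dvd fst x) (mset L))"
  using assms
proof (induction L arbitrary: b)
  case (Cons x L)
  obtain p c where x: "x = (p, c)" by (cases x)
  let ?A = "positions_above n (image_mset fst (mset L))"
  have le: "q \<le> p" if "q \<in># image_mset fst (mset L)" for q using Cons.prems that by (auto simp: x)
  have above: "positions_above n (image_mset fst (mset (x # L))) q = ?A q + of_bool (q < p \<and> \<not> 2*n dvd p)" for q
    by (simp add: positions_above_def x)
  then have above': "positions_above n (add_mset p (image_mset fst (mset L))) q =
      ?A q + of_bool (q < p \<and> \<not> 2*n dvd p)" for q by (simp add: x)
  have IH: "mset (twist n b' L) = image_mset (\<lambda>x. (fst x div (2*n), flip_if (odd (?A (fst x)) \<noteq> b') (snd x)))
      (filter_mset (\<lambda>x. 2*n dvd fst x) (mset L))" for b'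
    using Cons by simp
  show ?case
  proof (cases "2*n dvd p")
    case True
    have "?A p = 0" using le by (auto simp: positions_above_def filter_mset_eq_empty_iff dest: leD)
    then show ?thesis using True by (simp add: x IH above')
  next
    case False
    have "mset (twist n b (x # L)) = image_mset (\<lambda>x. (fst x div (2*n), flip_if (odd (?A (fst x)) \<noteq> (\<not> b)) (snd x)))
      (filter_mset (\<lambda>x. 2*n dvd fst x) (mset L))" using False by (simp add: x IH)
    also have "\<dots> = image_mset (\<lambda>y. (fst y div (2*n),
        flip_if (odd (positions_above n (image_mset fst (mset (x # L))) (fst y)) \<noteq> b) (snd y)))
      (filter_mset (\<lambda>x. 2*n dvd fst x) (mset L))"
    proof (rule image_mset_cong)
      fix y assume y: "y \<in># filter_mset (\<lambda>x. 2*n dvd fst x) (mset L)"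
      then have "fst y \<noteq> p" using False by auto
      moreover have "fst y \<le> p" using le y by auto
      ultimately have "(odd (positions_above n (image_mset fst (mset (x # L))) (fst y)) \<noteq> b) =
          (odd (?A (fst y)) \<noteq> (\<not> b))" unfolding above using False by auto
      then show "(fst y div (2*n), flip_if (odd (?A (fst y)) \<noteq> (\<not> b)) (snd y)) = (fst y div (2*n),
        flip_if (odd (positions_above n (image_mset fst (mset (x # L))) (fst y)) \<noteq> b) (snd y))"
        by simp
    qed
    finally show ?thesis using False by (simp add: x)
  qed
qed simp

lemma sorted_twist:
  assumes "sorted_wrt (\<ge>) (map fst L)"
  shows "sorted_wrt (\<ge>) (map fst (twist n b L))"
proof -
  have mem: "\<exists>y\<in>set L. fst x = fst y div (2*n)" if "x \<in> set (twist n b L)" for x n b L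
    using that by (induction n b L rule: twist.induct) (auto split: if_splits)
  show ?thesis
    using assms
  proof (induction n b L rule: twist.induct)
    case (2 n b p c xs)
    have "fst y div (2*n) \<le> p div (2*n)" if "y \<in> set xs" for y
      using 2(3) that by (intro div_le_mono) auto
    then have "fst x \<le> p div (2*n)" if "x \<in> set (twist n b xs)" for x
      using mem[OF that] by auto
    then show ?case using 2 by auto
  qed simp
qed

text \<open>A bead outside \<open>R\<^sub>2\<^sub>n\<close> contributes 0 to the left-hand side and shifts all later signs; dropping it is
  compensated by toggling the flag. A bead of \<open>R\<^sub>2\<^sub>n\<close> contributes 1 if gray and -1 if white, so a flip of
  its shade is the same as a change of sign.\<close>

lemma alternating_sum_twist:
  assumes "\<forall>x\<in>set L. snd x = Gray \<longrightarrow> 2*n dvd fst x"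
  shows "alternating_sum (\<lambda>x. excess n x - 1) L =
    (if b then -1 else 1) * alternating_sum (\<lambda>x. 2 * gray_indicator x - 1) (twist n b L)"
  using assms
proof (induction n b L rule: twist.induct)
  case (2 n b p c xs)
  then show ?case
    by (cases c; cases b; cases "2*n dvd p") (auto simp: excess_def flip_if_def)
qed simp

lemma alternating_sum_minus_1:
  "alternating_sum (\<lambda>x. f x - 1) xs = alternating_sum f xs - of_bool (odd (length xs))"
  by (induction xs) auto

lemma alternating_sum_double:
  "alternating_sum (\<lambda>x. 2 * f x) xs = 2 * alternating_sum f xs"
  by (induction xs) auto

lemma twist_eq_colored_list_of_reduce:
  assumes n: "3 \<le> n" and M: "bead_multiset n M"
  shows "twist n (odd (size (settle n M))) (colored_list_of M) = colored_list_of (reduce n M)"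
proof -
  let ?b = "odd (size (settle n M))"
  let ?L = "colored_list_of M"
  have L: "bead_list n ?L" "mset ?L = M" using bead_list_colored_list_of[OF M] .
  then have s: "sorted_wrt (\<ge>) (map fst ?L)" by (simp add: bead_list_def colored_partition_iff)
  have "mset (twist n ?b ?L) = reduce n M"
    unfolding mset_twist[OF s] L(2) reduce_def image_settle
    by (rule image_mset_cong) (auto simp: flip_if_def simp del: flip_if_flip_if)
  moreover from this have "colored_partition (twist n ?b ?L)"
    using sorted_twist[OF s] colored_multiset_reduce[OF n M] by (simp add: colored_partition_iff)
  ultimately show ?thesis using colored_list_of_mset by metis
qed

text \<open>The number of columns and the number of beads of \<open>R\<^sub>2\<^sub>n\<close> have different parities. Subtracting 1
  from every term therefore changes the two alternating sums by amounts that cancel, and the condition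
  on colors 0 and 1 says that gray parts are equally frequent at odd and at even places.\<close>

lemma alternating_excess_iff:
  assumes n: "3 \<le> n" and M: "bead_multiset n M"
    and odd: "odd (size (free_positions n (image_mset fst M)))"
  shows "alternating_sum (excess n) (colored_list_of M) = 1 \<longleftrightarrow>
    alternating_sum gray_indicator (colored_list_of (reduce n M)) = 0"
proof -
  let ?b = "odd (size (settle n M))"
  let ?L = "colored_list_of M"
  let ?T = "colored_list_of (reduce n M)"
  have L: "bead_list n ?L" "mset ?L = M" using bead_list_colored_list_of[OF M] .
  have "\<forall>x\<in>set ?L. snd x = Gray \<longrightarrow> 2*n dvd fst x"
    using L M by (metis bead_multiset_def set_mset_mset)
  note key = alternating_sum_twist[OF this, of ?b, unfolded twist_eq_colored_list_of_reduce[OF n M]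
      alternating_sum_minus_1 alternating_sum_double]
  have "size M = size (filter_mset (\<lambda>x. 2*n dvd fst x) M) + size (filter_mset (\<lambda>x. \<not> 2*n dvd fst x) M)"
    by (metis multiset_partition size_union)
  moreover have "size (filter_mset (\<lambda>x. 2*n dvd fst x) M) = size (settle n M)" by (simp add: settle_def)
  moreover have "size (filter_mset (\<lambda>x. \<not> 2*n dvd fst x) M) = size (free_positions n (image_mset fst M))"
    by (simp add: filter_mset_image_mset)
  moreover have "length ?L = size M" using L(2) by (metis size_mset)
  ultimately have len: "odd (length ?L) \<longleftrightarrow> \<not> ?b" using odd by simp
  have "length ?T = size (settle n M)"
    using mset_colored_list_of[OF colored_multiset_reduce[OF n M]] size_reduce by (metis size_mset)
  then show ?thesis using key len by (cases ?b) auto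
qed

definition quotients :: "nat \<Rightarrow> nat multiset \<Rightarrow> nat \<Rightarrow> nat multiset" where
  "quotients n P j = image_mset (\<lambda>p. p div (2*n)) (filter_mset (\<lambda>p. p mod (2*n) = j) P)"

text \<open>The positions outside \<open>R\<^sub>2\<^sub>n\<close>, put together from the rows in which the beads of each runner lie.\<close>

definition join_runners :: "nat \<Rightarrow> (nat \<Rightarrow> nat multiset) \<Rightarrow> nat multiset" where
  "join_runners n V = (\<Sum>j\<in>{1..<2*n}. image_mset (\<lambda>q. 2*n*q + j) (V j))"

lemma size_quotients: "size (quotients n P j) = residue_count n P j"
  by (simp add: quotients_def residue_count_def)

lemma count_quotients:
  assumes "j < 2*n"
  shows "count (quotients n P j) q = count P (2*n*q + j)"
proof (induction P)
  case (add p P)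
  have "p = 2*n*q + j \<longleftrightarrow> p mod (2*n) = j \<and> p div (2*n) = q"
    using assms by (metis Euclidean_Rings.div_eq_0_iff add.right_neutral div_mult_self4 div_mult_mod_eq mod_less mod_mult_self4 mult.commute not_less0)
  then show ?case using add by (auto simp: quotients_def)
qed (simp add: quotients_def)

lemma join_quotients:
  assumes n: "1 \<le> n"
  shows "join_runners n (quotients n P) = free_positions n P"
proof (induction P)
  case (add p P)
  let ?r = "p mod (2*n)"
  have "image_mset (\<lambda>q. 2*n*q + j) (quotients n (add_mset p P) j) =
      (if j = ?r then {#p#} else {#}) + image_mset (\<lambda>q. 2*n*q + j) (quotients n P j)" for j
    by (auto simp: quotients_def)
  then have "join_runners n (quotients n (add_mset p P)) =
      (\<Sum>j\<in>{1..<2*n}. if j = ?r then {#p#} else {#}) + join_runners n (quotients n P)"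
    by (simp add: join_runners_def sum.distrib)
  also have "(\<Sum>j\<in>{1..<2*n}. if j = ?r then {#p#} else {#}) = (if 2*n dvd p then {#} else {#p#})"
  proof -
    have "?r < 2*n" using n by simp
    then show ?thesis by (auto simp: dvd_eq_mod_eq_0)
  qed
  finally show ?case using add by simp
qed (simp add: join_runners_def quotients_def)

lemma quotients_sum: "finite J \<Longrightarrow> quotients n (\<Sum>j\<in>J. F j) i = (\<Sum>j\<in>J. quotients n (F j) i)"
  by (induction J rule: finite_induct) (auto simp: quotients_def)

lemma quotients_join:
  assumes "i \<in> {1..<2*n}"
  shows "quotients n (join_runners n V) i = V i"
proof -
  have "quotients n (image_mset (\<lambda>q. 2*n*q + j) (V j)) i = (if j = i then V i else {#})"
    if "j \<in> {1..<2*n}" for j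
  proof -
    have "(2*n*q + j) mod (2*n) = j" "(2*n*q + j) div (2*n) = q" for q using that by auto
    then show ?thesis by (auto simp: quotients_def filter_mset_image_mset multiset.map_comp comp_def)
  qed
  then have "quotients n (join_runners n V) i = (\<Sum>j\<in>{1..<2*n}. if j = i then V i else {#})"
    unfolding join_runners_def quotients_sum[OF finite_atLeastLessThan] by (intro sum.cong refl)
  then show ?thesis using assms by simp
qed

lemma join_runners_cong:
  "(\<And>j. j \<in> {1..<2*n} \<Longrightarrow> V j = W j) \<Longrightarrow> join_runners n V = join_runners n W"
  unfolding join_runners_def by (intro sum.cong) auto

lemma not_dvd_join_runners: "p \<in># join_runners n V \<Longrightarrow> \<not> 2*n dvd p"
  by (auto simp: join_runners_def in_Union_mset_iff set_mset_sum dvd_eq_mod_eq_0)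

lemma sum_join_runners:
  "sum_mset (join_runners n V) = (\<Sum>j\<in>{1..<2*n}. 2*n * sum_mset (V j) + j * size (V j))"
proof -
  have "sum_mset (\<Sum>j\<in>J. F j) = (\<Sum>j\<in>J. sum_mset (F j))" if "finite J" for J and F :: "nat \<Rightarrow> nat multiset"
    using that by (induction J rule: finite_induct) auto
  moreover have "sum_mset (image_mset (\<lambda>q. 2*n*q + j) W) = 2*n * sum_mset W + j * size W" for j and W :: "nat multiset"
    by (induction W) (auto simp: algebra_simps)
  ultimately show ?thesis by (simp add: join_runners_def)
qed

text \<open>The runners outside \<open>R\<^sub>2\<^sub>n\<close> are \<open>R\<^sub>n\<close> and the pairs of opposite runners.\<close>

lemma sum_paired:
  fixes g :: "nat \<Rightarrow> nat"
  assumes "1 \<le> n"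
  shows "(\<Sum>j\<in>{1..<2*n}. g j) = g n + (\<Sum>k\<in>{1..<n}. g k + g (2*n - k))"
proof -
  have "{1..<2*n} = {1..<n} \<union> {n} \<union> {n<..<2*n}" using assms by auto
  then have "(\<Sum>j\<in>{1..<2*n}. g j) = (\<Sum>j\<in>{1..<n}. g j) + g n + (\<Sum>j\<in>{n<..<2*n}. g j)"
    by (simp add: sum.union_disjoint ivl_disj_int disjoint_iff)
  also have "(\<Sum>j\<in>{n<..<2*n}. g j) = (\<Sum>k\<in>{1..<n}. g (2*n - k))"
    by (rule sum.reindex_bij_witness[of _ "\<lambda>k. 2*n - k" "\<lambda>j. 2*n - j"]) auto
  finally show ?thesis by (simp add: sum.distrib)
qed

section \<open>The bijection\<close>

lemma sorted_decreasing_list: "sorted_wrt (\<ge>) (decreasing_list A)"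
  by (simp add: decreasing_list_def sorted_wrt_rev)

lemma mset_decreasing_list [simp]: "mset (decreasing_list A) = A"
  by (simp add: decreasing_list_def)

lemma decreasing_list_mset:
  assumes "sorted_wrt (\<ge>) xs"
  shows "decreasing_list (mset xs) = xs"
proof -
  have "sorted (rev xs)" using assms by (simp add: sorted_wrt_rev)
  then have "sort xs = rev xs" by (metis mset_rev properties_for_sort)
  then show ?thesis by (simp add: decreasing_list_def)
qed

lemma decreasing_list_inject: "decreasing_list A = decreasing_list B \<longleftrightarrow> A = B"
  by (metis mset_decreasing_list)

lemma length_decreasing_list [simp]: "length (decreasing_list A) = size A"
  by (metis mset_decreasing_list size_mset)

lemma sum_list_decreasing_list [simp]: "sum_list (decreasing_list A) = sum_mset A"
  by (metis mset_decreasing_list sum_mset_sum_list)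

lemma set_decreasing_list [simp]: "set (decreasing_list A) = set_mset A"
  by (metis mset_decreasing_list set_mset_mset)

lemma strict_decreasing_list:
  assumes "\<And>q. count A q \<le> 1"
  shows "sorted_wrt (>) (decreasing_list A)"
proof -
  have "distinct (decreasing_list A)"
    unfolding distinct_count_atmost_1
    using assms by (auto simp: le_Suc_eq not_in_iff) (metis count_greater_zero_iff le_antisym Suc_leI le_eq_less_or_eq less_one)
  moreover have "sorted_wrt (>) xs" if "sorted_wrt (\<ge>) xs" "distinct xs" for xs :: "nat list"
    using that by (induction xs) (auto simp: le_less)
  ultimately show ?thesis using sorted_decreasing_list by blast
qed

lemma strictly_decreasing_list:
  fixes xs :: "nat list"
  assumes "sorted_wrt (>) xs"
  shows "decreasing_list (mset xs) = xs" and "count (mset xs) q \<le> 1"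
proof -
  have "sorted_wrt (\<ge>) xs" using assms by (rule sorted_wrt_mono_rel[rotated]) auto
  then show "decreasing_list (mset xs) = xs" by (rule decreasing_list_mset)
  have "distinct xs" using assms by (induction xs) auto
  then show "count (mset xs) q \<le> 1" by (simp add: distinct_count_atmost_1)
qed

lemma decreasing_list_image:
  assumes "\<And>x y. x \<in># A \<Longrightarrow> y \<in># A \<Longrightarrow> x \<le> y \<Longrightarrow> f x \<le> f y"
  shows "decreasing_list (image_mset f A) = map f (decreasing_list A)"
proof -
  have "sorted_wrt (\<ge>) (map f (decreasing_list A))"
    unfolding sorted_wrt_map
    by (rule sorted_wrt_mono_rel[OF _ sorted_decreasing_list]) (use assms in auto)
  then show ?thesis by (metis decreasing_list_mset mset_decreasing_list mset_map)
qed

lemma even_alternating_sum: "even (alternating_sum odd_indicator xs) \<longleftrightarrow> even (sum_list xs)"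
  by (induction xs) auto

abbreviation target_union :: "nat \<Rightarrow> nat \<Rightarrow> (nat list \<times> nat list list \<times> nat list) set" where
  "target_union n m \<equiv>
    \<Union>(m1, m2, m3) \<in> {(m1, m2, m3). m1 + m2 + 2 * m3 = m}. target_component n m1 m2 m3"

text \<open>A partition with balanced diagram has even size, so the sizes of the three components can be any that
  satisfy the single equation \<open>|\<lambda>\<^sup>0| + 2 \<Sum>|\<lambda>| + 2 |\<mu>\<^sup>1| = 2m + 1\<close>.\<close>

lemma target_iff:
  "(l0, ls, nu) \<in> target_union n m \<longleftrightarrow>
    partition l0 \<and> (\<forall>p\<in>set l0. odd p) \<and> length ls = n \<and> (\<forall>p\<in>set ls. partition p) \<and>
    partition nu \<and> two_reduced nu \<and> alternating_sum odd_indicator nu = 0 \<and>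
    sum_list l0 + 2 * (\<Sum>p\<leftarrow>ls. sum_list p) + 2 * sum_list nu = 2 * m + 1"
  (is "?l \<longleftrightarrow> ?r")
proof
  assume ?l
  then show ?r by (auto simp: target_component_def odd_partitions_def tuple_partitions_def DP0_iff)
next
  assume r: ?r
  then obtain m3 where m3: "sum_list nu = 2 * m3" using even_alternating_sum[of nu] by auto
  have "sum_list l0 + 2 * (\<Sum>p\<leftarrow>ls. sum_list p) + 2 * sum_list nu = 2 * m + 1" using r by blast
  then have "odd (sum_list l0)" by presburger
  then obtain m1 where m1: "sum_list l0 = 2 * m1 + 1" by (auto elim: oddE)
  have "m1 + (\<Sum>p\<leftarrow>ls. sum_list p) + 2 * m3 = m" using r m1 m3 by simp
  moreover have "(l0, ls, nu) \<in> target_component n m1 (\<Sum>p\<leftarrow>ls. sum_list p) m3"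
    using r m1 m3 by (simp add: target_component_def odd_partitions_def tuple_partitions_def DP0_iff)
  ultimately show ?l by blast
qed

abbreviation coordinate_total :: "nat \<Rightarrow> (nat \<Rightarrow> nat multiset) \<Rightarrow> nat" where
  "coordinate_total n V \<equiv> \<Sum>k\<in>{1..<n}. sum_mset (V k) + sum_mset (V (2*n - k)) + size (V k)"

abbreviation runner_partition :: "nat \<Rightarrow> (nat \<Rightarrow> nat multiset) \<Rightarrow> nat \<Rightarrow> nat list" where
  "runner_partition n V k \<equiv> frobenius (decreasing_list (V k)) (decreasing_list (V (2*n - k)))"

text \<open>The independent pieces of a wall of weight \<open>\<Lambda>\<^sub>1 - m\<delta>\<close>: the rows \<open>V j\<close> of the beads in the runner
  \<open>R\<^sub>j\<close>, and the colored partition \<open>U\<close>. The last equation expresses that the positions have sum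
  \<open>n (2m + 1)\<close>, divided by \<open>n\<close>.\<close>

definition bead_data ::
  "nat \<Rightarrow> nat \<Rightarrow> (nat \<Rightarrow> nat multiset) \<Rightarrow> (nat \<times> shade) multiset \<Rightarrow> bool" where
  "bead_data n m V U \<longleftrightarrow>
     (\<forall>k\<in>{1..<n}. size (V k) = size (V (2*n - k))) \<and>
     (\<forall>j\<in>{1..<2*n}. j \<noteq> n \<longrightarrow> (\<forall>q. count (V j) q \<le> 1)) \<and>
     colored_multiset U \<and> alternating_sum gray_indicator (colored_list_of U) = 0 \<and>
     (\<Sum>q\<in>#V n. 2 * q + 1) +
       2 * coordinate_total n V +
       2 * (\<Sum>x\<in>#U. fst x) = 2 * m + 1"

definition pi_data ::
  "nat \<Rightarrow> (nat \<Rightarrow> nat multiset) \<Rightarrow> (nat \<times> shade) multiset \<Rightarrow> nat list \<times> nat list list \<times> nat list" where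
  "pi_data n V U = (let (mu0, mu1) = decompose (colored_list_of U) in
     (decreasing_list {# 2 * q + 1. q \<in># V n #},
      map (\<lambda>k. runner_partition n V k) [1..<n] @ [mu0],
      map fst mu1))"

lemma bead_data_cong:
  assumes n: "3 \<le> n" and eq: "\<And>j. j \<in> {1..<2*n} \<Longrightarrow> V j = W j"
  shows "bead_data n m V U = bead_data n m W U" and "pi_data n V U = pi_data n W U"
proof -
  have e: "V n = W n" "\<And>k. k \<in> {1..<n} \<Longrightarrow> V k = W k" "\<And>k. k \<in> {1..<n} \<Longrightarrow> V (2*n - k) = W (2*n - k)"
    using n by (auto intro!: eq)
  have s: "coordinate_total n V =
      coordinate_total n W"
    by (rule sum.cong) (simp_all add: e)
  have a: "(\<forall>k\<in>{1..<n}. size (V k) = size (V (2*n - k))) = (\<forall>k\<in>{1..<n}. size (W k) = size (W (2*n - k)))"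
    using e by auto
  have b: "(\<forall>j\<in>{1..<2*n}. j \<noteq> n \<longrightarrow> (\<forall>q. count (V j) q \<le> 1)) = (\<forall>j\<in>{1..<2*n}. j \<noteq> n \<longrightarrow> (\<forall>q. count (W j) q \<le> 1))"
    using eq by auto
  show "bead_data n m V U = bead_data n m W U" unfolding bead_data_def s a b e(1) ..
  have l: "map (\<lambda>k. runner_partition n V k) [1..<n] =
      map (\<lambda>k. runner_partition n W k) [1..<n]"
    using e by (intro map_cong) auto
  show "pi_data n V U = pi_data n W U" unfolding pi_data_def l e(1) ..
qed

lemma size_join_runners: "size (join_runners n V) = (\<Sum>j\<in>{1..<2*n}. size (V j))"
proof -
  have "size (\<Sum>j\<in>J. F j) = (\<Sum>j\<in>J. size (F j))" if "finite J" for J and F :: "nat \<Rightarrow> nat multiset"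
    using that by (induction J rule: finite_induct) auto
  then show ?thesis by (simp add: join_runners_def)
qed

lemma sum_mset_double_plus_1: "(\<Sum>q\<in>#A. 2 * q + 1) = 2 * sum_mset A + size (A :: nat multiset)"
  by (induction A) auto

lemma quotients_free:
  assumes "j \<in> {1..<2*n}"
  shows "quotients n (free_positions n P) j = quotients n P j"
  unfolding quotients_def filter_filter_mset
  by (intro arg_cong[where f = "image_mset _"] filter_mset_cong) (use assms in auto)

text \<open>The beads of \<open>R\<^sub>n\<close> are the only odd contribution to the size equation.\<close>

lemma bead_data_parity:
  assumes "bead_data n m V U"
  shows "odd (size (V n))"
proof -
  have "(\<Sum>q\<in>#V n. 2 * q + 1) +
       2 * coordinate_total n V +
       2 * (\<Sum>x\<in>#U. fst x) = 2 * m + 1"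
    using assms unfolding bead_data_def by blast
  then show ?thesis unfolding sum_mset_double_plus_1 by presburger
qed

text \<open>As \<open>k + (2n - k) = 2n\<close>, two opposite runners with equally many beads have a sum of positions
  divisible by \<open>2n\<close>, namely \<open>2n\<close> times the size of the partition with these Frobenius coordinates.\<close>

lemma weight_iff_bead_data:
  assumes n: "3 \<le> n" and M: "bead_multiset n M"
  shows "wall_of n (colored_list_of M) \<in> walls_of_weight n m \<longleftrightarrow>
    bead_data n m (quotients n (image_mset fst M)) (reduce n M)"
proof -
  let ?P = "image_mset fst M"
  let ?V = "quotients n ?P"
  let ?U = "reduce n M"
  let ?N = "free_positions n ?P"
  let ?pairs = "\<forall>k\<in>{1..<n}. size (?V k) = size (?V (2*n - k))"
  let ?S = "(\<Sum>q\<in>#?V n. 2 * q + 1) +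
       2 * coordinate_total n ?V +
       2 * (\<Sum>x\<in>#?U. fst x)"
  have L: "bead_list n (colored_list_of M)" "mset (colored_list_of M) = M"
    using bead_list_colored_list_of[OF M] .
  have N: "?N = join_runners n ?V" using join_quotients[of n ?P] n by simp
  \<comment> \<open>the residues \<open>k\<close> and \<open>2n - k\<close> of a pair add up to \<open>2n\<close>\<close>
  have total: "sum_mset ?P = n * ?S" if p: ?pairs
  proof -
    have "?P = ?N + image_mset (\<lambda>x. fst x * (2*n)) ?U"
      using positions_assemble[of n ?N ?U] unfolding assemble_reduce[OF n M] .
    then have "sum_mset ?P = sum_mset ?N + (\<Sum>x\<in>#?U. fst x * (2*n))" by (metis sum_mset.union)
    also have "(\<Sum>x\<in>#?U. fst x * (2*n)) = n * (2 * (\<Sum>x\<in>#?U. fst x))"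
    proof -
      have "(\<Sum>x\<in>#A. fst x * (2*n)) = n * (2 * (\<Sum>x\<in>#A. fst x))" for A :: "(nat \<times> shade) multiset"
        by (induction A) (auto simp: algebra_simps)
      then show ?thesis .
    qed
    also have "sum_mset ?N = 2*n * sum_mset (?V n) + n * size (?V n) +
        (\<Sum>k\<in>{1..<n}. (2*n * sum_mset (?V k) + k * size (?V k)) +
          (2*n * sum_mset (?V (2*n - k)) + (2*n - k) * size (?V (2*n - k))))"
      unfolding N sum_join_runners using n by (subst sum_paired) auto
    also have "(\<Sum>k\<in>{1..<n}. (2*n * sum_mset (?V k) + k * size (?V k)) +
          (2*n * sum_mset (?V (2*n - k)) + (2*n - k) * size (?V (2*n - k)))) =
        (\<Sum>k\<in>{1..<n}. n * (2 * (sum_mset (?V k) + sum_mset (?V (2*n - k)) + size (?V k))))"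
    proof (rule sum.cong[OF refl])
      fix k assume k: "k \<in> {1..<n}"
      then have "k * size (?V k) + (2*n - k) * size (?V (2*n - k)) = 2*n * size (?V k)"
        using p by (simp flip: add_mult_distrib)
      then show "(2*n * sum_mset (?V k) + k * size (?V k)) +
          (2*n * sum_mset (?V (2*n - k)) + (2*n - k) * size (?V (2*n - k))) =
        n * (2 * (sum_mset (?V k) + sum_mset (?V (2*n - k)) + size (?V k)))"
        by (simp add: algebra_simps)
    qed
    also have "\<dots> = n * (2 * coordinate_total n ?V)"
      by (simp add: sum_distrib_left)
    finally show ?thesis unfolding sum_mset_double_plus_1 by (simp add: algebra_simps)
  qed
  have odd: "odd (size ?N)" if p: ?pairs and s: "?S = 2 * m + 1"
  proof -
    have "odd r" if "2 * a + r + 2 * b + 2 * c = 2 * m + 1" for a b c r :: nat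
      using that by presburger
    from this[OF s[unfolded sum_mset_double_plus_1]] have "odd (size (?V n))" .
    moreover have "size ?N = size (?V n) + (\<Sum>k\<in>{1..<n}. size (?V k) + size (?V (2*n - k)))"
      unfolding N size_join_runners using n by (intro sum_paired) simp
    moreover have "(\<Sum>k\<in>{1..<n}. size (?V k) + size (?V (2*n - k))) = (\<Sum>k\<in>{1..<n}. 2 * size (?V k))"
      using p by (intro sum.cong) auto
    ultimately show ?thesis by (simp flip: sum_distrib_left)
  qed
  have cnt: "count (?V j) q \<le> 1" if j: "j \<in> {1..<2*n}" "j \<noteq> n" for j q
  proof -
    have "\<not> n dvd j"
    proof
      assume "n dvd j"
      then obtain c where "j = n * c" by blast
      then show False using j n by (cases c; cases "c - 1") auto
    qed
    then have "\<not> n dvd 2*n*q + j" by (simp add: dvd_add_right_iff)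
    then show ?thesis using M j count_quotients[of j n ?P q] by (simp add: bead_multiset_def)
  qed
  have "wall_of n (colored_list_of M) \<in> walls_of_weight n m \<longleftrightarrow>
      (\<forall>i\<in>{1..n}. (\<Sum>p\<in>#?P. color_weight n i p) = 2*m + 1) \<and>
      alternating_sum (excess n) (colored_list_of M) = 1"
    unfolding wall_of_weight_iff[OF n L(1)] L(2) by (simp add: multiset.map_comp comp_def)
  also have "\<dots> \<longleftrightarrow> (?pairs \<and> sum_mset ?P = n * (2*m + 1)) \<and> alternating_sum (excess n) (colored_list_of M) = 1"
    unfolding color_weights_constant_iff[OF n] size_quotients ..
  also have "\<dots> \<longleftrightarrow> (?pairs \<and> ?S = 2*m + 1) \<and> alternating_sum (excess n) (colored_list_of M) = 1"
  proof -
    have "n * ?S = n * (2*m + 1) \<longleftrightarrow> ?S = 2*m + 1" using n by (subst mult_cancel1) auto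
    then show ?thesis using total by (cases ?pairs) (simp_all only: simp_thms)
  qed
  also have "\<dots> \<longleftrightarrow> (?pairs \<and> ?S = 2*m + 1) \<and> alternating_sum gray_indicator (colored_list_of ?U) = 0"
    using alternating_excess_iff[OF n M] odd by blast
  also have "\<dots> \<longleftrightarrow> bead_data n m ?V ?U"
    unfolding bead_data_def using cnt colored_multiset_reduce[OF n M] by blast
  finally show ?thesis .
qed

lemma runner_list_eq:
  assumes j: "j \<in> {1..<2*n}"
  shows "runner_list n Y j = decreasing_list (quotients n (bead_positions Y) j)"
proof -
  let ?A = "filter_mset (\<lambda>p. p mod (2*n) = j) (bead_positions Y)"
  have "filter_mset (\<lambda>p. p \<in> runner n j) (bead_positions Y) = ?A"
    by (rule filter_mset_cong) (use j in \<open>auto simp: runner_def intro: gr0I\<close>)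
  moreover have "(p - j) div (2*n) = p div (2*n)" if "p mod (2*n) = j" for p
    using that by (metis minus_mod_eq_mult_div nonzero_mult_div_cancel_left div_mult_self1_is_m mod_0 div_by_0 mult.commute mult_zero_left neq0_conv)
  then have "map (\<lambda>N. (N - j) div (2*n)) (decreasing_list ?A) = map (\<lambda>p. p div (2*n)) (decreasing_list ?A)"
    by (intro map_cong) auto
  moreover have "\<dots> = decreasing_list (image_mset (\<lambda>p. p div (2*n)) ?A)"
    by (rule decreasing_list_image[symmetric]) (auto intro: div_le_mono)
  ultimately show ?thesis by (simp add: runner_list_def quotients_def)
qed

lemma lambda0_eq:
  assumes n: "3 \<le> n"
  shows "lambda0 n Y = decreasing_list {# 2 * q + 1. q \<in># quotients n (bead_positions Y) n #}"
proof -
  have "{# p div n. p \<in># filter_mset (\<lambda>p. p \<in> runner n n) (bead_positions Y) #} =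
      {# 2 * (p div (2*n)) + 1. p \<in># filter_mset (\<lambda>p. p mod (2*n) = n) (bead_positions Y) #}"
  proof -
    have "filter_mset (\<lambda>p. p \<in> runner n n) (bead_positions Y) = filter_mset (\<lambda>p. p mod (2*n) = n) (bead_positions Y)"
      by (rule filter_mset_cong) (use n in \<open>auto simp: runner_def intro: gr0I\<close>)
    moreover have "p div n = 2 * (p div (2*n)) + 1"
      if "p \<in># filter_mset (\<lambda>p. p mod (2*n) = n) (bead_positions Y)" for p
    proof -
      have "p = n * (2 * (p div (2*n)) + 1)"
        using div_mult_mod_eq[of p "2*n"] that by (simp add: algebra_simps)
      then show ?thesis using n by (metis nonzero_mult_div_cancel_left not_numeral_le_zero)
    qed
    ultimately show ?thesis by (simp only:) (rule image_mset_cong)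
  qed
  then show ?thesis by (simp add: lambda0_def quotients_def multiset.map_comp comp_def)
qed

definition wall_quotients :: "nat \<Rightarrow> wall \<Rightarrow> nat \<Rightarrow> nat multiset" where
  "wall_quotients n Y = quotients n (bead_positions Y)"

definition wall_reduce :: "nat \<Rightarrow> wall \<Rightarrow> (nat \<times> shade) multiset" where
  "wall_reduce n Y = reduce n (beads Y)"

lemma walls_of_weight_data:
  assumes n: "3 \<le> n" and Y: "Y \<in> walls_of_weight n m"
  shows "bead_data n m (wall_quotients n Y) (wall_reduce n Y)"
proof -
  have "Y \<in> proper_young_walls n" using Y by (simp add: walls_of_weight_def)
  note W = wall_of_beads[OF n this]
  show ?thesis
    using weight_iff_bead_data[OF n W(3), of m] W(2) Y
    by (simp add: wall_quotients_def wall_reduce_def bead_positions_def)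
qed

text \<open>The weight condition makes the configuration balanced, which is what the description of the reduced
  wall by settled beads requires.\<close>

lemma pi_map_eq_pi_data:
  assumes n: "3 \<le> n" and Y: "Y \<in> walls_of_weight n m"
  shows "pi_map n Y = pi_data n (wall_quotients n Y) (wall_reduce n Y)"
proof -
  let ?M = "beads Y"
  have pY: "Y \<in> proper_young_walls n" using Y by (simp add: walls_of_weight_def)
  note W = wall_of_beads[OF n pY]
  note data = walls_of_weight_data[OF n Y]
  have "balanced_beads n ?M"
    unfolding balanced_beads_def
  proof (intro conjI ballI impI)
    fix x assume x: "x \<in># ?M"
    show "0 < fst x" using W(3) x unfolding bead_multiset_def colored_multiset_def by auto
    assume "\<not> 2*n dvd fst x"
    then have "snd x \<noteq> Gray" using W(3) x unfolding bead_multiset_def by auto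
    then show "snd x = White" by (cases "snd x") auto
  next
    fix i assume "i \<in> {1..<n}"
    then show "residue_count n (image_mset fst ?M) i = residue_count n (image_mset fst ?M) (2*n - i)"
      using data by (simp add: bead_data_def wall_quotients_def bead_positions_def size_quotients)
  next
    show "odd (residue_count n (image_mset fst ?M) n)"
      using bead_data_parity[OF data] by (simp add: wall_quotients_def bead_positions_def size_quotients)
  qed
  note T = beads_tilde[OF n pY this]
  have c: "colored_mu n (tilde n Y) = colored_list_of (wall_reduce n Y)"
    unfolding wall_reduce_def by (rule colored_mu_eq[OF n W(3) T])
  have l: "map (lambda n Y) [1..<n] =
      map (\<lambda>k. runner_partition n (wall_quotients n Y) k) [1..<n]"
    by (rule map_cong) (auto simp: lambda_def wall_quotients_def runner_list_eq)
  show ?thesis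
    unfolding pi_map_def pi_data_def c l lambda0_eq[OF n] wall_quotients_def ..
qed

text \<open>The wall is assembled from the pieces; splitting it returns them.\<close>

lemma ex_wall_with_data:
  assumes n: "3 \<le> n" and d: "bead_data n m V U"
  shows "\<exists>Y\<in>walls_of_weight n m. (\<forall>j\<in>{1..<2*n}. wall_quotients n Y j = V j) \<and> wall_reduce n Y = U"
proof -
  let ?N = "join_runners n V"
  define M where "M = assemble n ?N U"
  have U: "colored_multiset U" using d by (simp add: bead_data_def)
  have N: "\<not> 2*n dvd p" if "p \<in># ?N" for p using not_dvd_join_runners[OF that] .
  have "count ?N p \<le> 1" if "\<not> n dvd p" for p
  proof -
    let ?j = "p mod (2*n)"
    have "?j \<noteq> 0" using that by (metis dvd_mult_right mod_0_imp_dvd)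
    moreover have "?j \<noteq> n" using that by (metis dvd_add_triv_right_iff dvd_mult2 dvd_triv_right div_mult_mod_eq dvd_mult)
    ultimately have j: "?j \<in> {1..<2*n}" "?j \<noteq> n" using n by auto
    have "count ?N p = count (quotients n ?N ?j) (p div (2*n))"
      using count_quotients[of ?j n ?N "p div (2*n)"] j(1) by simp
    also have "\<dots> = count (V ?j) (p div (2*n))" by (simp add: quotients_join[OF j(1)])
    also have "\<dots> \<le> 1" using d j unfolding bead_data_def by blast
    finally show ?thesis .
  qed
  then have M: "bead_multiset n M" unfolding M_def by (intro bead_multiset_assemble[OF n N U])
  define Y where "Y = wall_of n (colored_list_of M)"
  have b: "beads Y = M"
    unfolding Y_def using beads_wall_of(1)[OF n] bead_list_colored_list_of[OF M] by metis
  have r: "reduce n M = U" and f: "free_positions n (image_mset fst M) = ?N"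
    unfolding M_def using assemble_properties[OF n N] by auto
  have q: "quotients n (image_mset fst M) j = V j" if "j \<in> {1..<2*n}" for j
    using quotients_free[OF that, of "image_mset fst M"] f quotients_join[OF that] by simp
  have "bead_data n m (quotients n (image_mset fst M)) (reduce n M)"
    using bead_data_cong(1)[OF n q] d r by simp
  then have "Y \<in> walls_of_weight n m" unfolding Y_def using weight_iff_bead_data[OF n M] by simp
  then show ?thesis
    using q r b by (intro bexI[of _ Y]) (auto simp: wall_quotients_def wall_reduce_def bead_positions_def)
qed

lemma wall_determined_by_data:
  assumes n: "3 \<le> n" and Y: "Y \<in> proper_young_walls n" "Y' \<in> proper_young_walls n"
    and q: "\<And>j. j \<in> {1..<2*n} \<Longrightarrow> wall_quotients n Y j = wall_quotients n Y' j"
    and r: "wall_reduce n Y = wall_reduce n Y'"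
  shows "Y = Y'"
proof -
  have "free_positions n (image_mset fst (beads Y)) = free_positions n (image_mset fst (beads Y'))"
    using join_runners_cong[of n "wall_quotients n Y" "wall_quotients n Y'"] q n
    by (simp add: wall_quotients_def bead_positions_def join_quotients)
  then have "beads Y = beads Y'"
    using assemble_reduce[OF n wall_of_beads(3)[OF n Y(1)]] assemble_reduce[OF n wall_of_beads(3)[OF n Y(2)]] r
    unfolding wall_reduce_def by metis
  then show ?thesis using wall_of_beads(2)[OF n Y(1)] wall_of_beads(2)[OF n Y(2)] by metis
qed

lemma pi_data_components:
  assumes U: "colored_multiset U"
  obtains mu nu where "partition mu" "partition nu" "two_reduced nu" "colored_list_of U = recompose mu nu"
    "pi_data n V U = (decreasing_list {# 2 * q + 1. q \<in># V n #},
      map (\<lambda>k. runner_partition n V k) [1..<n] @ [mu], nu)"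
proof -
  obtain mu nu where "partition mu" "partition nu" "two_reduced nu" "recompose mu nu = colored_list_of U"
    using ex_recompose[OF colored_partition_colored_list_of[OF U]] by blast
  moreover have "map fst (map tint nu) = nu" by (simp add: tint_def comp_def)
  ultimately show ?thesis
    using that[of mu nu] decompose_recompose[of mu nu] by (simp add: pi_data_def)
qed

lemma bead_data_runner_lists:
  assumes d: "bead_data n m V U" and k: "k \<in> {1..<n}"
  shows "sorted_wrt (>) (decreasing_list (V k))" "sorted_wrt (>) (decreasing_list (V (2*n - k)))"
    "length (decreasing_list (V (2*n - k))) = length (decreasing_list (V k))"
proof -
  have "k \<in> {1..<2*n}" "k \<noteq> n" "2*n - k \<in> {1..<2*n}" "2*n - k \<noteq> n" using k by auto
  then show "sorted_wrt (>) (decreasing_list (V k))" "sorted_wrt (>) (decreasing_list (V (2*n - k)))"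
    using d unfolding bead_data_def by (blast intro: strict_decreasing_list)+
  show "length (decreasing_list (V (2*n - k))) = length (decreasing_list (V k))"
    using d k by (simp add: bead_data_def)
qed

lemma sum_fst_colored_list_of:
  "colored_multiset U \<Longrightarrow> sum_list (map fst (colored_list_of U)) = (\<Sum>x\<in>#U. fst x)"
  by (metis mset_colored_list_of mset_map sum_mset_sum_list)

lemma pi_data_in_target:
  assumes d: "bead_data n m V U" and n: "1 \<le> n"
  shows "pi_data n V U \<in>
    target_union n m"
proof -
  have U: "colored_multiset U" using d by (simp add: bead_data_def)
  obtain mu nu where c: "partition mu" "partition nu" "two_reduced nu" "colored_list_of U = recompose mu nu"
    and pd: "pi_data n V U = (decreasing_list {# 2 * q + 1. q \<in># V n #},
      map (\<lambda>k. runner_partition n V k) [1..<n] @ [mu], nu)"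
    by (rule pi_data_components[OF U])
  note fr = partition_frobenius[OF bead_data_runner_lists[OF d]]
  have "partition (decreasing_list {# 2 * q + 1. q \<in># V n #})"
    using sorted_decreasing_list by (auto simp: partition_def)
  moreover have "sum_list (map (\<lambda>k. sum_list (runner_partition n V k)) [1..<n]) =
      coordinate_total n V"
    unfolding interv_sum_list_conv_sum_set_nat by (rule sum.cong) (simp_all add: fr)
  moreover have "sum_list mu + sum_list nu = (\<Sum>x\<in>#U. fst x)"
    using sum_recompose[OF c(1-3)] sum_fst_colored_list_of[OF U] c(4) by simp
  moreover have "alternating_sum odd_indicator nu = 0"
    using d c(4) alternating_sum_recompose[of mu nu] by (simp add: bead_data_def)
  ultimately show ?thesis
    unfolding pd target_iff using c fr d n by (auto simp: bead_data_def comp_def)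
qed

text \<open>Each component of the value determines one piece: the odd parts determine \<open>R\<^sub>n\<close>, Frobenius
  coordinates are unique, and so is the decomposition of a colored partition.\<close>

lemma pi_data_inject:
  assumes n: "1 \<le> n" and d: "bead_data n m V U" "bead_data n m' V' U'" and eq: "pi_data n V U = pi_data n V' U'"
  shows "U = U'" and "j \<in> {1..<2*n} \<Longrightarrow> V j = V' j"
proof -
  have U: "colored_multiset U" "colored_multiset U'" using d by (auto simp: bead_data_def)
  let ?f = "\<lambda>V k. runner_partition n V k"
  obtain mu nu where c: "colored_list_of U = recompose mu nu"
    and pd: "pi_data n V U = (decreasing_list {# 2 * q + 1. q \<in># V n #}, map (?f V) [1..<n] @ [mu], nu)"
    by (rule pi_data_components[OF U(1)])
  obtain mu' nu' where c': "colored_list_of U' = recompose mu' nu'"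
    and pd': "pi_data n V' U' = (decreasing_list {# 2 * q + 1. q \<in># V' n #}, map (?f V') [1..<n] @ [mu'], nu')"
    by (rule pi_data_components[OF U(2)])
  have e: "{# 2 * q + 1. q \<in># V n #} = {# 2 * q + 1. q \<in># V' n #}" "map (?f V) [1..<n] = map (?f V') [1..<n]"
    "mu = mu'" "nu = nu'"
    using eq unfolding pd pd' by (auto simp: decreasing_list_inject)
  show "U = U'" using c c' e(3,4) mset_colored_list_of U by metis
  have "image_mset (\<lambda>p. p div 2) {# 2 * q + 1. q \<in># V n #} = image_mset (\<lambda>p. p div 2) {# 2 * q + 1. q \<in># V' n #}"
    using e(1) by simp
  then have Vn: "V n = V' n" by (simp add: multiset.map_comp comp_def)
  have k: "V k = V' k \<and> V (2*n - k) = V' (2*n - k)" if "k \<in> {1..<n}" for k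
  proof -
    have "?f V k = ?f V' k" using e(2) that by (simp add: map_eq_conv)
    then show ?thesis
      using frobenius_inject[OF bead_data_runner_lists[OF d(1) that] bead_data_runner_lists[OF d(2) that]]
      by (simp add: decreasing_list_inject)
  qed
  show "V j = V' j" if "j \<in> {1..<2*n}"
  proof -
    consider "j < n" | "j = n" | "n < j" by linarith
    then show ?thesis
    proof cases
      case 1
      then show ?thesis using k[of j] that by simp
    next
      case 2
      then show ?thesis using Vn by simp
    next
      case 3
      then have "2*n - j \<in> {1..<n}" "2*n - (2*n - j) = j" using that by auto
      then show ?thesis using k[of "2*n - j"] by simp
    qed
  qed
qed

text \<open>Each piece is chosen as the preimage of one component under the corresponding bijection.\<close>

lemma pi_data_surj:
  assumes n: "1 \<le> n" and x: "x \<in>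
    target_union n m"
  shows "\<exists>V U. bead_data n m V U \<and> pi_data n V U = x"
proof -
  obtain l0 ls nu where xs: "x = (l0, ls, nu)" by (metis prod_cases3)
  note t = x[unfolded xs target_iff]
  define ps mu where "ps = butlast ls" and "mu = last ls"
  have "ls \<noteq> []" using t n by auto
  then have ls: "ls = ps @ [mu]" by (simp add: ps_def mu_def)
  have lps: "length ps = n - 1" using t by (simp add: ps_def)
  let ?coords = "\<lambda>k ab. sorted_wrt (>) (fst ab) \<and> sorted_wrt (>) (snd ab) \<and>
    length (snd ab) = length (fst ab) \<and> frobenius (fst ab) (snd ab) = ps ! (k - 1)"
  have "\<forall>k. \<exists>ab. k \<in> {1..<n} \<longrightarrow> ?coords k ab"
  proof
    fix k
    have "partition (ps ! (k - 1))" if "k \<in> {1..<n}"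
    proof -
      have "ps ! (k - 1) \<in> set ps" using that lps by (intro nth_mem) auto
      then show ?thesis using t ls by auto
    qed
    then show "\<exists>ab. k \<in> {1..<n} \<longrightarrow> ?coords k ab"
      using ex_frobenius by (metis fst_conv snd_conv)
  qed
  then obtain ab where ab: "\<And>k. k \<in> {1..<n} \<Longrightarrow> ?coords k (ab k)"
    by metis
  \<comment> \<open>halving recovers the row \<open>q\<close> from the odd part \<open>2q + 1\<close>; legs go to \<open>R\<^sub>k\<close>, arms to the opposite runner\<close>
  define V where "V j = (if j = n then image_mset (\<lambda>p. p div 2) (mset l0)
     else if j < n then mset (fst (ab j)) else mset (snd (ab (2*n - j))))" for j
  define U where "U = mset (recompose mu nu)"
  have Vk: "V k = mset (fst (ab k))" "V (2*n - k) = mset (snd (ab k))" if "k \<in> {1..<n}" for k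
    using that by (auto simp: V_def)
  have pm: "partition mu" "partition nu" "two_reduced nu" using t ls by auto
  have cp: "colored_partition (recompose mu nu)" by (rule colored_partition_recompose[OF pm])
  have U: "colored_multiset U" "colored_list_of U = recompose mu nu"
    unfolding U_def using cp colored_list_of_mset[OF cp] by (simp_all add: colored_partition_iff)
  have Vn: "{# 2 * q + 1. q \<in># V n #} = mset l0"
  proof -
    have "{# 2 * q + 1. q \<in># V n #} = image_mset (\<lambda>p. 2 * (p div 2) + 1) (mset l0)"
      by (simp add: V_def multiset.map_comp comp_def)
    also have "\<dots> = image_mset (\<lambda>p. p) (mset l0)"
      using t by (intro image_mset_cong) (auto simp: odd_two_times_div_two_succ)
    finally show ?thesis by simp
  qed
  have fr: "runner_partition n V k = ps ! (k - 1)" if "k \<in> {1..<n}" for k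
    using ab[OF that] Vk[OF that] by (simp add: strictly_decreasing_list)
  have lists: "map (\<lambda>k. runner_partition n V k) [1..<n] = ps"
    by (rule nth_equalityI) (use lps fr in \<open>auto\<close>)
  have "pi_data n V U = x"
  proof -
    have "decreasing_list (mset l0) = l0"
      using t by (intro decreasing_list_mset) (simp add: partition_def)
    moreover have "map fst (map tint nu) = nu" by (simp add: tint_def comp_def)
    ultimately show ?thesis
      unfolding pi_data_def U(2) decompose_recompose[OF pm] lists Vn by (simp add: xs ls)
  qed
  moreover have "bead_data n m V U"
    unfolding bead_data_def
  proof (intro conjI ballI impI allI)
    show "size (V k) = size (V (2*n - k))" if "k \<in> {1..<n}" for k
      using ab[OF that] Vk[OF that] by simp
    show "count (V j) q \<le> 1" if "j \<in> {1..<2*n}" "j \<noteq> n" for j q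
    proof (cases "j < n")
      case True
      then show ?thesis using that ab[of j] Vk[of j] strictly_decreasing_list(2) by auto
    next
      case False
      then have "2*n - j \<in> {1..<n}" "2*n - (2*n - j) = j" using that by auto
      then show ?thesis using ab[of "2*n - j"] Vk(2)[of "2*n - j"] strictly_decreasing_list(2) by simp
    qed
    show "colored_multiset U" by (rule U(1))
    show "alternating_sum gray_indicator (colored_list_of U) = 0"
      unfolding U(2) alternating_sum_recompose using t by simp
    have "coordinate_total n V =
        (\<Sum>k\<in>{1..<n}. sum_list (ps ! (k - 1)))"
    proof (rule sum.cong[OF refl])
      fix k assume k: "k \<in> {1..<n}"
      note a = ab[OF k]
      have "sum_list (frobenius (fst (ab k)) (snd (ab k))) =
          sum_list (fst (ab k)) + sum_list (snd (ab k)) + length (fst (ab k))"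
        using a by (intro partition_frobenius(2)) auto
      then show "sum_mset (V k) + sum_mset (V (2*n - k)) + size (V k) = sum_list (ps ! (k - 1))"
        using a by (simp add: Vk[OF k] sum_mset_sum_list)
    qed
    also have "\<dots> = sum_list (map sum_list ps)"
    proof -
      have "sum_list (map sum_list ps) = (\<Sum>k\<in>{1..<n}. sum_list (runner_partition n V k))"
        by (subst lists[symmetric]) (simp add: comp_def interv_sum_list_conv_sum_set_nat)
      then show ?thesis by (simp add: fr)
    qed
    finally have s: "coordinate_total n V = sum_list (map sum_list ps)" .
    have u: "(\<Sum>x\<in>#U. fst x) = sum_list mu + sum_list nu"
      using sum_fst_colored_list_of[OF U(1)] U(2) sum_recompose[OF pm] by simp
    show "(\<Sum>q\<in>#V n. 2 * q + 1) +
       2 * coordinate_total n V +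
       2 * (\<Sum>x\<in>#U. fst x) = 2 * m + 1"
      unfolding s u Vn sum_mset_sum_list using t by (simp add: ls)
  qed
  ultimately show ?thesis by blast
qed

theorem theorem6p15:
  fixes n m :: nat
  assumes "n \<ge> 3"
  shows "bij_betw (pi_map n) (walls_of_weight n m)
    (\<Union>(m1, m2, m3) \<in> {(m1, m2, m3). m1 + m2 + 2 * m3 = m}. target_component n m1 m2 m3)"
    (is "bij_betw _ _ ?T")
  unfolding bij_betw_def
proof
  have n1: "1 \<le> n" using assms by simp
  note data = walls_of_weight_data[OF assms] and pi = pi_map_eq_pi_data[OF assms]
  show "inj_on (pi_map n) (walls_of_weight n m)"
  proof (rule inj_onI)
    fix Y Y' assume Y: "Y \<in> walls_of_weight n m" "Y' \<in> walls_of_weight n m" and eq: "pi_map n Y = pi_map n Y'"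
    note pi_data_inject[OF n1 data[OF Y(1)] data[OF Y(2)] eq[unfolded pi[OF Y(1)] pi[OF Y(2)]]]
    then show "Y = Y'"
      using Y by (intro wall_determined_by_data[OF assms]) (auto simp: walls_of_weight_def)
  qed
  show "pi_map n ` walls_of_weight n m = ?T"
  proof (rule subset_antisym; rule subsetI)
    fix x assume "x \<in> pi_map n ` walls_of_weight n m"
    then show "x \<in> ?T" using pi_data_in_target[OF data n1] pi by auto
  next
    fix x assume "x \<in> ?T"
    then obtain V U where VU: "bead_data n m V U" "pi_data n V U = x" using pi_data_surj[OF n1] by blast
    obtain Y where Y: "Y \<in> walls_of_weight n m" "\<And>j. j \<in> {1..<2*n} \<Longrightarrow> wall_quotients n Y j = V j"
      "wall_reduce n Y = U" using ex_wall_with_data[OF assms VU(1)] by blast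
    have "pi_map n Y = x" unfolding pi[OF Y(1)] Y(3) using bead_data_cong(2)[OF assms Y(2)] VU(2) by simp
    then show "x \<in> pi_map n ` walls_of_weight n m" using Y(1) by blast
  qed
qed

end
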